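(* Let $p$ be a prime, let $K$ be a finite extension of $\mathbb{Q}_p$, and let $\phi\in K(z)$ be a rational map of degree at least $2$. Suppose that (1) $\phi$ has no wild recurrent critical points in $J_{\mathbb{C}_p}(\phi)\cap\mathbb{P}^1_K$, and (2) each minimal class in $(\mathcal{M}(\phi),\preceq)$ has at most two representatives in $J_{\mathbb{C}_p}(\phi)\cap\mathbb{P}^1_K$. Then $$J_{\mathbb{C}_p}(\phi)\cap\mathbb{P}^1_K=J_K(\phi).$$
   Context: $\mathbb{C}_p$ is the completion of an algebraic closure of $\mathbb{Q}_p$ (containing $K$), with $p$-adic absolute value $|\cdot|_p$. For $L\in\{K,\mathbb{C}_p\}$, $\mathbb{P}^1_L=L\cup\{\infty\}$ carries the spherical metric $\rho(x,y)=\frac{|x-y|_p}{\max\{|x|_p,1\}\max\{|y|_p,1\}}$ for $x,y\in L$, $\rho(x,\infty)=1$ if $|x|_p\le 1$ and $\rho(x,\infty)=1/|x|_p$ if $|x|_p>1$. The Fatou set $F_L(\phi)$ is the set of points of $\mathbb{P}^1_L$ having a neighborhood in $\mathbb{P}^1_L$ on which $\{\phi^n\}_{n\ge 0}$ is equicontinuous with respect to $\rho$; the Julia set is $J_L(\phi)=\mathbb{P}^1_L\setminus F_L(\phi)$. A critical point $c\in\mathbb{P}^1_{\mathbb{C}_p}$ of $\phi$ is wild if $p$ divides the local degree of $\phi$ at $c$, and tame otherwise. A point $x$ is recurrent if it is accumulated by its forward orbit under $\phi$, and non-recurrent otherwise. Let $\mathcal{O}_\phi(x)=\{\phi^n(x)\}_{n\ge0}$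 and $\overline{\mathcal{O}_\phi(x)}$ its closure in $\mathbb{P}^1_{\mathbb{C}_p}$. Let $\mathrm{Crit}^\ast_{\mathbb{C}_p}(\phi)$ be the set of critical points of $\phi$ in $J_{\mathbb{C}_p}(\phi)$. For $c_1,c_2\in\mathrm{Crit}^\ast_{\mathbb{C}_p}(\phi)$ write $c_1\sim c_2$ if $c_1\in\overline{\mathcal{O}_\phi(c_2)}$ and $c_2\in\overline{\mathcal{O}_\phi(c_1)}$; this is an equivalence relation, and $\mathcal{M}(\phi)=\mathrm{Crit}^\ast_{\mathbb{C}_p}(\phi)/\sim$. Partially order $\mathcal{M}(\phi)$ by $[c]\preceq[c']$ iff $\overline{\mathcal{O}_\phi(c)}\subset\overline{\mathcal{O}_\phi(c')}$. A class $[c]$ is minimal if $\mathcal{M}(\phi)$ contains no other element less than $[c]$. *)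

theory Defs
  imports "HOL-Analysis.Analysis" "HOL-Computational_Algebra.Polynomial_Factorial"
begin

locale nonarch_abs =
  fixes v :: "'a::field \<Rightarrow> real"
  assumes nonneg: "0 \<le> v x"
    and eq_zero: "v x = 0 \<longleftrightarrow> x = 0"
    and mult: "v (x * y) = v x * v y"
    and ultra: "v (x + y) \<le> max (v x) (v y)"

definition abs_topology :: "('a::field \<Rightarrow> real) \<Rightarrow> 'a topology" where
  "abs_topology v = Metric_space.mtopology UNIV (\<lambda>x y. v (x - y))"

text \<open>In a complete field of characteristic 0 whose absolute value restricts to the p-adic one
  on the rationals, the closure of the rationals is the completion of the rationals.\<close>

definition padic_numbers :: "('a::field_char_0 \<Rightarrow> real) \<Rightarrow> 'a set" where
  "padic_numbers v = abs_topology v closure_of (range of_rat)"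

definition algebraic_elements :: "'a::field set \<Rightarrow> 'a set" where
  "algebraic_elements F = {x. \<exists>q. q \<noteq> 0 \<and> (\<forall>i. coeff q i \<in> F) \<and> poly q x = 0}"

text \<open>A field with absolute value that is a completion of an algebraic closure of the p-adic
  numbers. Such a field is unique up to isometric isomorphism. The absolute value is normalised
  by \<open>v p = 1 / p\<close>; together with the ultrametric inequality this forces it to be the
  p-adic absolute value on the rationals. That the whole field is algebraically closed is
  Krasner's theorem, hence a consequence and not part of the definition.\<close>

locale padic_complex_field = nonarch_abs v
  for p :: nat and v :: "'a::field_char_0 \<Rightarrow> real" +
  assumes prime_p: "prime p"
    and abs_p: "v (of_nat p) = 1 / real p"
    and complete: "Metric_space.mcomplete UNIV (\<lambda>x y. v (x - y))"
    and alg_closed: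
      "degree q > 0 \<Longrightarrow> (\<And>i. coeff q i \<in> algebraic_elements (padic_numbers v)) \<Longrightarrow>
         \<exists>x \<in> algebraic_elements (padic_numbers v). poly q x = 0"
    and dense: "abs_topology v closure_of (algebraic_elements (padic_numbers v)) = UNIV"

definition is_subfield :: "'a::field set \<Rightarrow> bool" where
  "is_subfield K \<longleftrightarrow> 0 \<in> K \<and> 1 \<in> K \<and>
     (\<forall>x\<in>K. \<forall>y\<in>K. x + y \<in> K \<and> x * y \<in> K) \<and>
     (\<forall>x\<in>K. - x \<in> K \<and> inverse x \<in> K)"

definition finite_extension :: "'a::field set \<Rightarrow> 'a set \<Rightarrow> bool" where
  "finite_extension F K \<longleftrightarrow> is_subfield F \<and> is_subfield K \<and> F \<subseteq> K \<and>
     (\<exists>B. finite B \<and> K = {\<Sum>b\<in>B. c b * b | c. \<forall>b\<in>B. c b \<in> F})"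

datatype 'a proj_line = Pt 'a | Infty

definition proj_line_over :: "'a set \<Rightarrow> 'a proj_line set" where
  "proj_line_over L = insert Infty (Pt ` L)"

fun spherical_dist :: "('a::field \<Rightarrow> real) \<Rightarrow> 'a proj_line \<Rightarrow> 'a proj_line \<Rightarrow> real" where
  "spherical_dist v (Pt x) (Pt y) = v (x - y) / (max (v x) 1 * max (v y) 1)"
| "spherical_dist v (Pt x) Infty = (if v x \<le> 1 then 1 else 1 / v x)"
| "spherical_dist v Infty (Pt x) = (if v x \<le> 1 then 1 else 1 / v x)"
| "spherical_dist v Infty Infty = 0"

definition proj_topology :: "('a::field \<Rightarrow> real) \<Rightarrow> 'a set \<Rightarrow> 'a proj_line topology" where
  "proj_topology v L = Metric_space.mtopology (proj_line_over L) (spherical_dist v)"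

text \<open>A rational map is given by a numerator \<open>P\<close> and a denominator \<open>Q\<close> without common factor.
  Replacing \<open>z\<close> by \<open>1 / w\<close> turns \<open>P / Q\<close> into the quotient of the polynomials
  \<open>w ^ d * P (1 / w)\<close> and \<open>w ^ d * Q (1 / w)\<close>, where \<open>d\<close> is the degree of the map;
  the behaviour at infinity is read off from these at \<open>w = 0\<close>.\<close>

definition rat_degree :: "'a::field poly \<Rightarrow> 'a poly \<Rightarrow> nat" where
  "rat_degree P Q = max (degree P) (degree Q)"

definition rev_poly :: "nat \<Rightarrow> 'a::field poly \<Rightarrow> 'a poly" where
  "rev_poly d P = (\<Sum>i\<le>d. monom (coeff P (d - i)) i)"

definition fin_value :: "'a::field poly \<Rightarrow> 'a poly \<Rightarrow> 'a \<Rightarrow> 'a proj_line" where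
  "fin_value P Q x = (if poly Q x = 0 then Infty else Pt (poly P x / poly Q x))"

fun rat_map :: "'a::field poly \<Rightarrow> 'a poly \<Rightarrow> 'a proj_line \<Rightarrow> 'a proj_line" where
  "rat_map P Q (Pt x) = fin_value P Q x"
| "rat_map P Q Infty =
     fin_value (rev_poly (rat_degree P Q) P) (rev_poly (rat_degree P Q) Q) 0"

text \<open>If \<open>Q x \<noteq> 0\<close> and \<open>y = P x / Q x\<close>, the order of vanishing of \<open>P / Q - y\<close> at \<open>x\<close> is
  that of \<open>P - y * Q\<close>; if \<open>Q x = 0\<close>, then \<open>P x \<noteq> 0\<close> and the order of vanishing of \<open>Q / P\<close>
  is that of \<open>Q\<close>.\<close>

definition fin_local_degree :: "'a::field poly \<Rightarrow> 'a poly \<Rightarrow> 'a \<Rightarrow> nat" where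
  "fin_local_degree P Q x =
     (if poly Q x = 0 then order x Q else order x (P - smult (poly P x / poly Q x) Q))"

fun local_degree :: "'a::field poly \<Rightarrow> 'a poly \<Rightarrow> 'a proj_line \<Rightarrow> nat" where
  "local_degree P Q (Pt x) = fin_local_degree P Q x"
| "local_degree P Q Infty =
     fin_local_degree (rev_poly (rat_degree P Q) P) (rev_poly (rat_degree P Q) Q) 0"

definition critical_point :: "'a::field poly \<Rightarrow> 'a poly \<Rightarrow> 'a proj_line \<Rightarrow> bool" where
  "critical_point P Q c \<longleftrightarrow> local_degree P Q c \<ge> 2"

definition wild :: "nat \<Rightarrow> 'a::field poly \<Rightarrow> 'a poly \<Rightarrow> 'a proj_line \<Rightarrow> bool" where
  "wild p P Q c \<longleftrightarrow> p dvd local_degree P Q c"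

definition iterates_equicontinuous_on ::
    "('a::field \<Rightarrow> real) \<Rightarrow> ('a proj_line \<Rightarrow> 'a proj_line) \<Rightarrow> 'a proj_line set \<Rightarrow> bool" where
  "iterates_equicontinuous_on v f U \<longleftrightarrow>
     (\<forall>x\<in>U. \<forall>e>0. \<exists>d>0. \<forall>y\<in>U. spherical_dist v x y < d \<longrightarrow>
        (\<forall>n. spherical_dist v ((f ^^ n) x) ((f ^^ n) y) < e))"

definition fatou_set ::
    "('a::field \<Rightarrow> real) \<Rightarrow> 'a set \<Rightarrow> ('a proj_line \<Rightarrow> 'a proj_line) \<Rightarrow> 'a proj_line set" where
  "fatou_set v L f = {x \<in> proj_line_over L.
     \<exists>U. openin (proj_topology v L) U \<and> x \<in> U \<and> iterates_equicontinuous_on v f U}"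

definition julia_set ::
    "('a::field \<Rightarrow> real) \<Rightarrow> 'a set \<Rightarrow> ('a proj_line \<Rightarrow> 'a proj_line) \<Rightarrow> 'a proj_line set" where
  "julia_set v L f = proj_line_over L - fatou_set v L f"

definition orbit_closure ::
    "('a::field \<Rightarrow> real) \<Rightarrow> ('a proj_line \<Rightarrow> 'a proj_line) \<Rightarrow> 'a proj_line \<Rightarrow> 'a proj_line set" where
  "orbit_closure v f x = proj_topology v UNIV closure_of (range (\<lambda>n. (f ^^ n) x))"

text \<open>A point is accumulated by its forward orbit if it is a limit point of the sequence of its
  iterates. Periodic points count as recurrent; periodic critical points are superattracting
  and hence never lie in the Julia set.\<close>

definition recurrent ::
    "('a::field \<Rightarrow> real) \<Rightarrow> ('a proj_line \<Rightarrow> 'a proj_line) \<Rightarrow> 'a proj_line \<Rightarrow> bool" where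
  "recurrent v f x \<longleftrightarrow>
     (\<forall>U. openin (proj_topology v UNIV) U \<and> x \<in> U \<longrightarrow> (\<exists>\<^sub>F n in sequentially. (f ^^ n) x \<in> U))"

definition julia_critical_points ::
    "('a::field \<Rightarrow> real) \<Rightarrow> 'a poly \<Rightarrow> 'a poly \<Rightarrow> 'a proj_line set" where
  "julia_critical_points v P Q = {c \<in> julia_set v UNIV (rat_map P Q). critical_point P Q c}"

definition critical_rel ::
    "('a::field \<Rightarrow> real) \<Rightarrow> 'a poly \<Rightarrow> 'a poly \<Rightarrow> ('a proj_line \<times> 'a proj_line) set" where
  "critical_rel v P Q =
     {(c1, c2). c1 \<in> julia_critical_points v P Q \<and> c2 \<in> julia_critical_points v P Q \<and>
        c1 \<in> orbit_closure v (rat_map P Q) c2 \<and> c2 \<in> orbit_closure v (rat_map P Q) c1}"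

definition critical_classes ::
    "('a::field \<Rightarrow> real) \<Rightarrow> 'a poly \<Rightarrow> 'a poly \<Rightarrow> 'a proj_line set set" where
  "critical_classes v P Q = julia_critical_points v P Q // critical_rel v P Q"

text \<open>Equivalent critical points have the same orbit closure, so the choice of representatives
  does not matter.\<close>

definition class_le ::
    "('a::field \<Rightarrow> real) \<Rightarrow> 'a poly \<Rightarrow> 'a poly \<Rightarrow> 'a proj_line set \<Rightarrow> 'a proj_line set \<Rightarrow> bool" where
  "class_le v P Q C C' \<longleftrightarrow>
     (\<exists>c\<in>C. \<exists>c'\<in>C'. orbit_closure v (rat_map P Q) c \<subseteq> orbit_closure v (rat_map P Q) c')"

definition minimal_class ::
    "('a::field \<Rightarrow> real) \<Rightarrow> 'a poly \<Rightarrow> 'a poly \<Rightarrow> 'a proj_line set \<Rightarrow> bool" where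
  "minimal_class v P Q C \<longleftrightarrow> C \<in> critical_classes v P Q \<and>
     (\<forall>D \<in> critical_classes v P Q. class_le v P Q D C \<longrightarrow> D = C)"

context nonarch_abs
begin

lemma v_zero [simp]: "v 0 = 0"
  using eq_zero by blast

lemma v_one [simp]: "v 1 = 1"
  using mult[of 1 1] eq_zero[of 1] by simp

lemma v_minus_one: "v (- 1) = 1"
proof -
  have "v (- 1) * v (- 1) = 1" using mult[of "-1" "-1"] by simp
  then have "v (- 1) = 1 \<or> v (- 1) = - 1"
    by (simp add: square_eq_1_iff)
  then show ?thesis using nonneg[of "- 1"] by auto
qed

lemma v_minus [simp]: "v (- x) = v x"
  using mult[of "- 1" x] v_minus_one by simp

lemma v_diff_commute: "v (x - y) = v (y - x)"
  using v_minus[of "x - y"] by simp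

lemma metric_abs: "Metric_space UNIV (\<lambda>x y. v (x - y))"
proof
  fix x y z
  show "0 \<le> v (x - y)" by (rule nonneg)
  show "v (x - y) = v (y - x)" by (rule v_diff_commute)
  show "(v (x - y) = 0) = (x = y)" by (simp add: eq_zero)
  have "v (x - z) \<le> max (v (x - y)) (v (y - z))"
    using ultra[of "x - y" "y - z"] by simp
  then show "v (x - z) \<le> v (x - y) + v (y - z)"
    using nonneg[of "x - y"] nonneg[of "y - z"] by linarith
qed

end

text \<open>In homogeneous coordinates the spherical distance is
  \<open>v (x0 * y1 - x1 * y0) / (max (v x0) (v x1) * max (v y0) (v y1))\<close>.\<close>

fun hcoord :: "'a::field proj_line \<Rightarrow> 'a \<times> 'a" where
  "hcoord (Pt x) = (x, 1)"
| "hcoord Infty = (1, 0)"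

context nonarch_abs
begin

definition hnorm :: "'a \<times> 'a \<Rightarrow> real" where
  "hnorm a = max (v (fst a)) (v (snd a))"

definition hdet :: "'a \<times> 'a \<Rightarrow> 'a \<times> 'a \<Rightarrow> 'a" where
  "hdet a b = fst a * snd b - snd a * fst b"

lemma spherical_dist_hcoord:
  "spherical_dist v x y = v (hdet (hcoord x) (hcoord y)) / (hnorm (hcoord x) * hnorm (hcoord y))"
  by (cases x; cases y) (auto simp: hdet_def hnorm_def max_def)

lemma hnorm_pos: "hnorm (hcoord x) > 0"
  by (cases x) (auto simp: hnorm_def less_max_iff_disj)

lemma hdet_triangle:
  "v (hdet a c) * hnorm b \<le> max (v (hdet a b) * hnorm c) (v (hdet b c) * hnorm a)"
proof -
  have *: "v (hdet a c) * v s \<le> max (v (hdet a b) * hnorm c) (v (hdet b c) * hnorm a)"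
    if "hdet a c * s = hdet a b * t + hdet b c * u" "v t \<le> hnorm c" "v u \<le> hnorm a" for s t u
  proof -
    have "v (hdet a c) * v s \<le> max (v (hdet a b) * v t) (v (hdet b c) * v u)"
      using ultra[of "hdet a b * t" "hdet b c * u"] that(1) by (simp flip: mult)
    also have "\<dots> \<le> max (v (hdet a b) * hnorm c) (v (hdet b c) * hnorm a)"
      using that(2,3) by (intro max.mono mult_left_mono nonneg)
    finally show ?thesis .
  qed
  have 1: "v (hdet a c) * v (fst b) \<le> max (v (hdet a b) * hnorm c) (v (hdet b c) * hnorm a)"
    by (rule *[of _ "fst c" "fst a"]) (auto simp: hdet_def hnorm_def algebra_simps)
  have 2: "v (hdet a c) * v (snd b) \<le> max (v (hdet a b) * hnorm c) (v (hdet b c) * hnorm a)"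
    by (rule *[of _ "snd c" "snd a"]) (auto simp: hdet_def hnorm_def algebra_simps)
  show ?thesis
  proof (cases "v (fst b) \<le> v (snd b)")
    case True
    then have "hnorm b = v (snd b)" by (simp add: hnorm_def)
    with 2 show ?thesis by simp
  next
    case False
    then have "hnorm b = v (fst b)" by (simp add: hnorm_def)
    with 1 show ?thesis by simp
  qed
qed

lemma spherical_dist_ultra:
  "spherical_dist v x z \<le> max (spherical_dist v x y) (spherical_dist v y z)"
proof -
  let ?a = "hcoord x" and ?b = "hcoord y" and ?c = "hcoord z"
  let ?N = "hnorm ?a * hnorm ?b * hnorm ?c"
  have N: "?N > 0" by (simp add: hnorm_pos)
  have 1: "spherical_dist v x z = v (hdet ?a ?c) * hnorm ?b / ?N"
    using hnorm_pos[of x] hnorm_pos[of y] hnorm_pos[of z]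
    by (simp add: spherical_dist_hcoord)
  have 2: "spherical_dist v x y = v (hdet ?a ?b) * hnorm ?c / ?N"
    using hnorm_pos[of x] hnorm_pos[of y] hnorm_pos[of z]
    by (simp add: spherical_dist_hcoord)
  have 3: "spherical_dist v y z = v (hdet ?b ?c) * hnorm ?a / ?N"
    using hnorm_pos[of x] hnorm_pos[of y] hnorm_pos[of z]
    by (simp add: spherical_dist_hcoord)
  have "v (hdet ?a ?c) * hnorm ?b / ?N \<le>
      max (v (hdet ?a ?b) * hnorm ?c) (v (hdet ?b ?c) * hnorm ?a) / ?N"
    using hdet_triangle[of ?a ?c ?b] N by (intro divide_right_mono) auto
  also have "\<dots> = max (v (hdet ?a ?b) * hnorm ?c / ?N) (v (hdet ?b ?c) * hnorm ?a / ?N)"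
    using N by (simp only: max_divide_distrib_right) auto
  finally show ?thesis unfolding 1 2 3 .
qed

lemma spherical_dist_nonneg: "0 \<le> spherical_dist v x y"
  by (simp add: spherical_dist_hcoord nonneg hnorm_pos less_imp_le)

lemma metric_spherical: "Metric_space (proj_line_over L) (spherical_dist v)"
proof
  fix x y z
  show "0 \<le> spherical_dist v x y" by (rule spherical_dist_nonneg)
  show "spherical_dist v x y = spherical_dist v y x"
    by (cases x; cases y) (auto simp: v_diff_commute mult.commute)
  show "(spherical_dist v x y = 0) = (x = y)"
    by (cases x; cases y) (auto simp: eq_zero max_def split: if_splits)
  show "spherical_dist v x z \<le> spherical_dist v x y + spherical_dist v y z"
    using spherical_dist_ultra[of x z y] spherical_dist_nonneg[of x y] spherical_dist_nonneg[of y z]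
    by linarith
qed

end

end

theory Submission
  imports Defs
begin

text \<open>Suppose that a point lies in the Julia set over \<open>\<complex>\<^sub>p\<close> and in the Fatou set over \<open>K\<close>. As long as an
  iterate of a small disc about it keeps away from the critical points, compared with its radius, it
  multiplies distances by a constant and is onto on \<open>K\<close>-points. This cannot last forever, because the
  images of the \<open>K\<close>-points stay small while the point is in the Julia set. So \<open>K\<close>-points arbitrarily close
  to the given point are mapped onto Julia critical points, and one of these is recurrent and again lies
  in the Fatou set over \<open>K\<close>. By equicontinuity all points of its orbit closure return to it, so its
  class is minimal, hence consists of at most two tame \<open>K\<close>-rational points.

  Apply the argument again to discs on the sphere of radius \<open>q ^ k\<close> about a member of the class. They
  cannot return to the same member, since this would give a repelling return over \<open>K\<close>; so they arrive
  at the other member, at a scale \<open>q ^ j\<close>. Composing the passages in both directions shows that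
  \<open>j = H k\<close> depends on \<open>k\<close> only, that \<open>H\<close> is monotone, and that it is in the end strictly increasing,
  in which case one iterate serves the entire sphere. Such an iterate carries the member itself to
  distance exactly \<open>q ^ H k\<close> from the other member, and the \<open>K\<close>-points of the sphere closer to it. The
  two points of a pair thus exchange their roles at every passage, and the pair climbs to a fixed
  scale, however small it was. This contradicts equicontinuity over \<open>K\<close>.\<close>

text \<open>The obstacle is that the two properties of the point concern different discs. Membership
  in \<open>J\<close> forbids a common Lipschitz bound for all iterates, but only on discs of the
  whole space; membership in \<open>FK\<close> bounds images, but only of points of
  \<open>Z\<close>. A disc about a critical point is never mapped by a similarity, whereas a smaller
  disc about a \<open>Z\<close>-point off the critical point can be. So an orbit segment is followed
  on two concentric discs at once: an upper bound on the large one, a similarity on the small one,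
  and a ratio of radii that is preserved. Control of the small disc, from \<open>FK\<close>, then
  controls the large one, and \<open>J\<close> forces the segment to stop. Tameness matters because
  a similarity near a critical point \<open>c\<close> needs a radius below \<open>\<mu> c\<close>
  times the distance to \<open>c\<close>. The bound two matters because a passage cannot end at its
  starting point: a return that does not expand contradicts \<open>J\<close>, one that expands
  contradicts \<open>FK\<close>. With two members the goal of every passage is therefore known, and
  the same dichotomy for round trips compares the scales.\<close>

section \<open>Iterates on discs of an ultrametric space\<close>

text \<open>The intended model is the spherical metric on the projective line over \<open>\<complex>\<^sub>p\<close>, with \<open>Z\<close> the projective
  line over \<open>K\<close> and \<open>q\<close> the absolute value of a uniformizer of \<open>K\<close>.\<close>

locale ultrametric_dynamics =
  fixes d :: "'p \<Rightarrow> 'p \<Rightarrow> real" and f :: "'p \<Rightarrow> 'p" and Z :: "'p set" and q :: real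
  assumes d_zero: "d x y = 0 \<longleftrightarrow> x = y"
    and d_sym: "d x y = d y x"
    and d_ultra: "d x z \<le> max (d x y) (d y z)"
    and f_cont: "0 < e \<Longrightarrow> \<exists>r>0. \<forall>y. d x y < r \<longrightarrow> d (f x) (f y) < e"
    and q_pos: "0 < q" and q_less: "q < 1"
    and Z_val: "x \<in> Z \<Longrightarrow> y \<in> Z \<Longrightarrow> x \<noteq> y \<Longrightarrow> \<exists>k. d x y = q ^ k"
    and Z_sphere: "x \<in> Z \<Longrightarrow> \<exists>y\<in>Z. d x y = q ^ k"
    and Z_compact: "(\<And>n::nat. s n \<in> Z) \<Longrightarrow> \<exists>x\<in>Z. \<exists>r. strict_mono r \<and> (\<lambda>n. d x (s (r n))) \<longlonglongrightarrow> 0"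
    and f_Z: "x \<in> Z \<Longrightarrow> f x \<in> Z"
    and fin_fibres: "finite {x. f x = y}"
begin

lemma d_self [simp]: "d x x = 0" by (simp add: d_zero)

lemma d_nonneg: "0 \<le> d x y"
  using d_ultra[of x x y] d_sym[of x y] by simp

lemma d_pos: "x \<noteq> y \<Longrightarrow> 0 < d x y"
  using d_nonneg[of x y] d_zero[of x y] by linarith

lemma d_le: "d x y \<le> r \<Longrightarrow> d y z \<le> r \<Longrightarrow> d x z \<le> r"
  using d_ultra[of x z y] by linarith

lemma d_less: "d x y < r \<Longrightarrow> d y z < r \<Longrightarrow> d x z < r"
  using d_ultra[of x z y] by linarith

lemma d_le': "d y x \<le> r \<Longrightarrow> d y z \<le> r \<Longrightarrow> d x z \<le> r"
  using d_le[of x y r z] d_sym[of x y] by simp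

lemma d_isosceles: "d x y < d y z \<Longrightarrow> d x z = d y z"
  using d_ultra[of x z y] d_ultra[of y z x] d_sym[of x y] by linarith

lemma iter_Z: "x \<in> Z \<Longrightarrow> (f ^^ n) x \<in> Z"
  by (induction n) (auto simp: f_Z)

lemma iter_add: "(f ^^ (k + n)) x = (f ^^ k) ((f ^^ n) x)"
  by (simp add: funpow_add)

lemma iter_Suc: "(f ^^ Suc n) x = (f ^^ n) (f x)"
  by (simp add: funpow_Suc_right del: funpow.simps)

lemma q_power_pos [simp]: "0 < q ^ k" by (simp add: q_pos)

lemma q_power_le_iff: "q ^ i \<le> q ^ j \<longleftrightarrow> j \<le> i"
  using q_pos q_less by (rule power_decreasing_iff)

lemma q_power_less_iff: "q ^ i < q ^ j \<longleftrightarrow> j < i"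
  using q_pos q_less by (rule power_strict_decreasing_iff)

lemma q_power_eq_iff: "q ^ i = q ^ j \<longleftrightarrow> i = j"
  by (metis q_power_le_iff order_antisym order_refl)

lemma q_power_small: "0 < e \<Longrightarrow> \<exists>k0. \<forall>k\<ge>k0. q ^ k < e"
proof -
  assume e: "0 < e"
  obtain k0 where "q ^ k0 < e" using real_arch_pow_inv[OF e q_less] by auto
  then have "\<forall>k\<ge>k0. q ^ k < e" using q_power_le_iff by (meson le_less_trans)
  then show ?thesis by auto
qed

lemma Z_gap: "x \<in> Z \<Longrightarrow> y \<in> Z \<Longrightarrow> d x y < q ^ k \<Longrightarrow> d x y \<le> q ^ Suc k"
proof -
  assume a: "x \<in> Z" "y \<in> Z" "d x y < q ^ k"
  show ?thesis
  proof (cases "x = y")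
    case True then show ?thesis using q_power_pos[of "Suc k"] by simp
  next
    case False
    then obtain j where "d x y = q ^ j" using Z_val a by blast
    then show ?thesis using a(3) by (simp only: q_power_le_iff q_power_less_iff Suc_le_eq)
  qed
qed

section \<open>Equicontinuity on the whole space and on \<open>Z\<close>\<close>

definition equicontinuous_on :: "'p set \<Rightarrow> bool" where
  "equicontinuous_on U \<longleftrightarrow> (\<forall>x\<in>U. \<forall>e>0. \<exists>r>0. \<forall>y\<in>U. d x y < r \<longrightarrow>
     (\<forall>n. d ((f ^^ n) x) ((f ^^ n) y) < e))"

definition J :: "'p set" where
  "J = {x. \<forall>r>0. \<not> equicontinuous_on {y. d x y < r}}"

text \<open>\<open>J\<close> refers to discs of the whole space and \<open>FK\<close> to their
  traces on \<open>Z\<close>; the whole abstract argument aims at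
  \<open>FK \<inter> J = {}\<close>.\<close>

definition FK :: "'p set" where
  "FK = {x \<in> Z. \<exists>r>0. equicontinuous_on {y \<in> Z. d x y < r}}"

lemma equicontinuous_on_mono: "equicontinuous_on U \<Longrightarrow> V \<subseteq> U \<Longrightarrow> equicontinuous_on V"
  unfolding equicontinuous_on_def by (meson subsetD)

text \<open>Later contradictions with membership in \<open>J\<close> take this form: a Lipschitz
  constant that serves all iterates on a disc gives equicontinuity there.\<close>

lemma J_not_lipschitz:
  assumes a: "a \<in> J" and r: "r > 0"
    and lip: "\<And>n x y. d a x \<le> r \<Longrightarrow> d a y \<le> r \<Longrightarrow> d ((f ^^ n) x) ((f ^^ n) y) \<le> L * d x y"
  shows False
proof -
  have "equicontinuous_on {y. d a y < r}"
    unfolding equicontinuous_on_def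
  proof (intro ballI allI impI)
    fix x e assume x: "x \<in> {y. d a y < r}" and e: "(0::real) < e"
    let ?M = "max L 1"
    have "d ((f ^^ n) x) ((f ^^ n) y) < e" if y: "y \<in> {y. d a y < r}" "d x y < e / ?M" for y n
    proof -
      have "d ((f ^^ n) x) ((f ^^ n) y) \<le> L * d x y" using lip x y by simp
      also have "\<dots> \<le> ?M * d x y" by (rule mult_right_mono) (auto simp: d_nonneg)
      also have "\<dots> < e" using y(2) by (simp add: field_simps)
      finally show ?thesis .
    qed
    moreover have "e / ?M > 0" using e by simp
    ultimately show "\<exists>s>0. \<forall>y\<in>{y. d a y < r}. d x y < s \<longrightarrow> (\<forall>n. d ((f ^^ n) x) ((f ^^ n) y) < e)"
      by blast
  qed
  then show False using a r unfolding J_def by blast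
qed

lemma J_forward: assumes "x \<in> J" shows "f x \<in> J"
proof (rule ccontr)
  assume "f x \<notin> J"
  then obtain r where r: "r > 0" and eq: "equicontinuous_on {y. d (f x) y < r}"
    unfolding J_def by blast
  obtain s where s: "s > 0" "\<And>y. d x y < s \<Longrightarrow> d (f x) (f y) < r" using f_cont[OF r] by blast
  have "equicontinuous_on {y. d x y < s}"
    unfolding equicontinuous_on_def
  proof (intro ballI allI impI)
    fix y e assume y: "y \<in> {y. d x y < s}" and e: "(0::real) < e"
    obtain t where t: "t > 0" "\<And>z n. d (f x) z < r \<Longrightarrow> d (f y) z < t \<Longrightarrow> d ((f ^^ n) (f y)) ((f ^^ n) z) < e"
      using eq[unfolded equicontinuous_on_def, rule_format, of "f y" e] e y s(2) by blast
    obtain u where u: "u > 0" "\<And>z. d y z < u \<Longrightarrow> d (f y) (f z) < t" using f_cont[OF t(1)] by blast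
    have "d ((f ^^ n) y) ((f ^^ n) z) < e" if z: "z \<in> {y. d x y < s}" "d y z < min u e" for z n
    proof (cases n)
      case 0 then show ?thesis using z by simp
    next
      case (Suc k)
      then show ?thesis using t(2)[of "f z" k] u(2)[of z] s(2)[of z] z by (simp add: iter_Suc del: funpow.simps)
    qed
    moreover have "min u e > 0" using u e by simp
    ultimately show "\<exists>r>0. \<forall>z\<in>{y. d x y < s}. d y z < r \<longrightarrow> (\<forall>n. d ((f ^^ n) y) ((f ^^ n) z) < e)"
      by blast
  qed
  then show False using assms s(1) unfolding J_def by blast
qed

lemma J_iter: "x \<in> J \<Longrightarrow> (f ^^ n) x \<in> J"
  by (induction n) (auto simp: J_forward)

lemma J_closed: assumes "\<And>e. e > 0 \<Longrightarrow> \<exists>y\<in>J. d x y < e" shows "x \<in> J"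
proof (rule ccontr)
  assume "x \<notin> J"
  then obtain r where r: "r > 0" "equicontinuous_on {y. d x y < r}" unfolding J_def by blast
  obtain y where y: "y \<in> J" "d x y < r" using assms r by blast
  have "{z. d y z < r} \<subseteq> {z. d x z < r}" using d_less[OF y(2)] by auto
  with r(2) have "equicontinuous_on {z. d y z < r}" by (rule equicontinuous_on_mono)
  then show False using y r(1) unfolding J_def by blast
qed

definition uniform_on :: "'p \<Rightarrow> real \<Rightarrow> bool" where
  "uniform_on x r \<longleftrightarrow> (\<forall>e>0. \<exists>s>0. \<forall>y\<in>Z. \<forall>z\<in>Z. d x y \<le> r \<longrightarrow> d x z \<le> r \<longrightarrow> d y z < s \<longrightarrow>
     (\<forall>n. d ((f ^^ n) y) ((f ^^ n) z) < e))"

lemma uniform_onD: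
  assumes "uniform_on x r" "e > 0"
  obtains s where "s > 0" "\<And>y z n. y \<in> Z \<Longrightarrow> z \<in> Z \<Longrightarrow> d x y \<le> r \<Longrightarrow> d x z \<le> r \<Longrightarrow> d y z < s \<Longrightarrow>
    d ((f ^^ n) y) ((f ^^ n) z) < e"
  using assms(1)[unfolded uniform_on_def, THEN spec, THEN mp, OF assms(2)]
  by (elim exE conjE) (rule that, assumption, simp)

text \<open>Pointwise equicontinuity becomes uniform by compactness of \<open>Z\<close>:
  counterexamples would accumulate at a point \<open>l\<close>, and both members of a late pair
  would follow the orbit of \<open>l\<close>. The radius is halved so that \<open>l\<close> stays
  inside the original open disc.\<close>

lemma FK_uniform:
  assumes x: "x \<in> FK" obtains r where "r > 0" "uniform_on x r"
proof -
  obtain r0 where r0: "r0 > 0" "equicontinuous_on {y \<in> Z. d x y < r0}" using x unfolding FK_def by blast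
  define r where "r = r0 / 2"
  have r: "r > 0" "r < r0" using r0 by (auto simp: r_def)
  have "uniform_on x r" unfolding uniform_on_def
  proof (intro allI impI, rule ccontr)
    fix e :: real assume e: "e > 0"
    let ?P = "\<lambda>s y z. y\<in>Z \<and> z\<in>Z \<and> d x y \<le> r \<and> d x z \<le> r \<and> d y z < s \<and> (\<exists>n. \<not> d ((f ^^ n) y) ((f ^^ n) z) < e)"
    assume "\<not> (\<exists>s>0. \<forall>y\<in>Z. \<forall>z\<in>Z. d x y \<le> r \<longrightarrow> d x z \<le> r \<longrightarrow> d y z < s \<longrightarrow> (\<forall>n. d ((f ^^ n) y) ((f ^^ n) z) < e))"
    then have "\<forall>s>0. \<exists>y z. ?P s y z" by blast
    then have "\<forall>k::nat. \<exists>y z. ?P (1 / real (Suc k)) y z" by (auto simp del: of_nat_Suc)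
    then obtain y z where yz: "\<And>k. ?P (1 / real (Suc k)) (y k) (z k)" by metis
    obtain l s where l: "l \<in> Z" "strict_mono s" "(\<lambda>n. d l (y (s n))) \<longlonglongrightarrow> 0"
      using Z_compact[of y] yz by blast
    have ev: "\<forall>\<^sub>F n in sequentially. d l (y (s n)) < t" if "t > 0" for t
      using order_tendstoD(2)[OF l(3) that] .
    have "d x l < r0"
    proof -
      obtain n where "d l (y (s n)) < r0" using eventually_happens[OF ev[OF r0(1)]] by auto
      then show ?thesis using d_less[of x "y (s n)" r0 l] yz[of "s n"] r d_sym[of l] by simp
    qed
    then obtain t where t: "t > 0" "\<And>w n. w \<in> Z \<Longrightarrow> d x w < r0 \<Longrightarrow> d l w < t \<Longrightarrow> d ((f ^^ n) l) ((f ^^ n) w) < e"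
      using r0(2)[unfolded equicontinuous_on_def, rule_format, of l e] e l by blast
    have "(\<lambda>n. 1 / real (Suc n)) \<longlonglongrightarrow> 0" by (rule LIMSEQ_Suc[OF lim_1_over_n])
    then have "\<forall>\<^sub>F n in sequentially. 1 / real (Suc n) < t"
      using order_tendstoD(2) t(1) by blast
    then have "\<forall>\<^sub>F n in sequentially. 1 / real (Suc (s n)) < t"
      using eventually_subseq[OF l(2)] by blast
    then obtain n where n: "1 / real (Suc (s n)) < t" "d l (y (s n)) < t"
      using eventually_happens[OF eventually_conj[OF _ ev[OF t(1)]]] by auto
    have yz': "?P t (y (s n)) (z (s n))" using yz[of "s n"] n by auto
    have "d l (z (s n)) < t" using d_less n(2) yz' by blast
    then have "d ((f ^^ m) l) ((f ^^ m) (y (s n))) < e" "d ((f ^^ m) l) ((f ^^ m) (z (s n))) < e" for m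
      using t(2) n(2) yz' r by auto
    then have "d ((f ^^ m) (y (s n))) ((f ^^ m) (z (s n))) < e" for m
      using d_less[of "(f ^^ m) (y (s n))"] d_sym by metis
    then show False using yz' by blast
  qed
  then show ?thesis using that r(1) by blast
qed

lemma uniform_on_subset:
  assumes "uniform_on x r" "d x y \<le> r" "s \<le> r" shows "uniform_on y s"
  unfolding uniform_on_def
proof (intro allI impI)
  fix e :: real assume "e > 0"
  then obtain t where t: "t > 0" "\<And>y z n. y \<in> Z \<Longrightarrow> z \<in> Z \<Longrightarrow> d x y \<le> r \<Longrightarrow> d x z \<le> r \<Longrightarrow> d y z < t \<Longrightarrow>
    d ((f ^^ n) y) ((f ^^ n) z) < e" using uniform_onD[OF assms(1)] by metis
  have "d x z \<le> r" if "d y z \<le> s" for z using d_le[of x y r z] that assms by simp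
  then show "\<exists>t>0. \<forall>ya\<in>Z. \<forall>z\<in>Z. d y ya \<le> s \<longrightarrow> d y z \<le> s \<longrightarrow> d ya z < t \<longrightarrow> (\<forall>n. d ((f ^^ n) ya) ((f ^^ n) z) < e)"
    using t by blast
qed

text \<open>The constant \<open>L\<close> in the last clause is arbitrary: together with an estimate for the return map it
  bounds all iterates, which is impossible at a point of \<open>J\<close>.\<close>

definition lip :: "nat \<Rightarrow> 'p \<Rightarrow> real \<Rightarrow> real \<Rightarrow> bool" where
  "lip n x r r' \<longleftrightarrow> 0 < r' \<and>
     (\<forall>u w. d x u \<le> r \<longrightarrow> d x w \<le> r \<longrightarrow> d ((f ^^ n) u) ((f ^^ n) w) \<le> r' / r * d u w) \<and>
     (\<exists>L. \<forall>i\<le>n. \<forall>u w. d x u \<le> r \<longrightarrow> d x w \<le> r \<longrightarrow> d ((f ^^ i) u) ((f ^^ i) w) \<le> L * d u w)"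

text \<open>The last clause is what allows points of \<open>Z\<close> to be pulled back to points of
  \<open>Z\<close>; the scaling clause alone says nothing about preimages in
  \<open>Z\<close>.\<close>

definition homothety :: "nat \<Rightarrow> 'p \<Rightarrow> real \<Rightarrow> real \<Rightarrow> bool" where
  "homothety n x r r' \<longleftrightarrow> 0 < r' \<and>
     (\<forall>u w. d x u \<le> r \<longrightarrow> d x w \<le> r \<longrightarrow> d ((f ^^ n) u) ((f ^^ n) w) = r' / r * d u w) \<and>
     (\<forall>w\<in>Z. d ((f ^^ n) x) w \<le> r' \<longrightarrow> (\<exists>v\<in>Z. d x v \<le> r \<and> (f ^^ n) v = w))"

lemma lip_image: assumes "lip n x r r'" "0 < r" "d x u \<le> r" shows "d ((f ^^ n) x) ((f ^^ n) u) \<le> r'"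
proof -
  have "r' > 0" using assms unfolding lip_def by auto
  have "d ((f ^^ n) x) ((f ^^ n) u) \<le> r' / r * d x u" using assms unfolding lip_def by auto
  also have "r' / r * d x u \<le> r' / r * r" using assms \<open>r' > 0\<close> by (intro mult_left_mono) auto
  finally show ?thesis using assms by simp
qed

lemma lip_comp:
  assumes r: "0 < r" and 1: "lip n x r r'" and 2: "lip k ((f ^^ n) x) r' r''"
  shows "lip (k + n) x r r''"
proof -
  have r': "r' > 0" "r'' > 0" using 1 2 unfolding lip_def by auto
  obtain L1 where L1: "\<And>i u w. i \<le> n \<Longrightarrow> d x u \<le> r \<Longrightarrow> d x w \<le> r \<Longrightarrow> d ((f ^^ i) u) ((f ^^ i) w) \<le> L1 * d u w"
    using 1 unfolding lip_def by blast
  obtain L2 where L2: "\<And>i u w. i \<le> k \<Longrightarrow> d ((f ^^ n) x) u \<le> r' \<Longrightarrow> d ((f ^^ n) x) w \<le> r' \<Longrightarrow> d ((f ^^ i) u) ((f ^^ i) w) \<le> L2 * d u w"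
    using 2 unfolding lip_def by blast
  have main: "d ((f ^^ (k + n)) u) ((f ^^ (k + n)) w) \<le> r'' / r * d u w" if "d x u \<le> r" "d x w \<le> r" for u w
  proof -
    have "d ((f ^^ (k + n)) u) ((f ^^ (k + n)) w) \<le> r'' / r' * d ((f ^^ n) u) ((f ^^ n) w)"
      using 2 lip_image[OF 1 r that(1)] lip_image[OF 1 r that(2)] unfolding lip_def by (simp add: iter_add)
    also have "\<dots> \<le> r'' / r' * (r' / r * d u w)"
      using 1 that r' unfolding lip_def by (intro mult_left_mono) auto
    finally show ?thesis using r' by simp
  qed
  have "\<exists>L. \<forall>i\<le>k+n. \<forall>u w. d x u \<le> r \<longrightarrow> d x w \<le> r \<longrightarrow> d ((f ^^ i) u) ((f ^^ i) w) \<le> L * d u w"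
  proof (intro exI allI impI)
    fix i u w assume i: "i \<le> k + n" and uw: "d x u \<le> r" "d x w \<le> r"
    let ?L = "max \<bar>L1\<bar> (\<bar>L2\<bar> * (r' / r))"
    show "d ((f ^^ i) u) ((f ^^ i) w) \<le> ?L * d u w"
    proof (cases "i \<le> n")
      case True
      then have "d ((f ^^ i) u) ((f ^^ i) w) \<le> L1 * d u w" using L1 uw by blast
      also have "\<dots> \<le> ?L * d u w" by (intro mult_right_mono d_nonneg) linarith
      finally show ?thesis .
    next
      case False
      then obtain j where j: "i = j + n" "j \<le> k" using i by (metis add.commute le_iff_add nat_le_linear nat_add_left_cancel_le)
      have "d ((f ^^ i) u) ((f ^^ i) w) \<le> L2 * d ((f ^^ n) u) ((f ^^ n) w)"
        using L2[OF j(2)] lip_image[OF 1 r uw(1)] lip_image[OF 1 r uw(2)] by (simp add: j iter_add)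
      also have "\<dots> \<le> \<bar>L2\<bar> * d ((f ^^ n) u) ((f ^^ n) w)" by (intro mult_right_mono d_nonneg) linarith
      also have "\<dots> \<le> \<bar>L2\<bar> * (r' / r * d u w)"
        using 1 uw unfolding lip_def by (intro mult_left_mono) auto
      also have "\<dots> \<le> ?L * d u w" unfolding mult.assoc[symmetric] by (intro mult_right_mono d_nonneg) linarith
      finally show ?thesis .
    qed
  qed
  then show ?thesis using main r' unfolding lip_def by blast
qed

lemma lip_mono:
  assumes "lip n x r r'" "0 < s" "s \<le> r" "d x y \<le> r" shows "lip n y s (s * r' / r)"
proof -
  have *: "d x u \<le> r" if "d y u \<le> s" for u using d_le[of x y r u] that assms by simp
  have "s * r' / r / s = r' / r" using assms by simp
  moreover have "0 < s * r' / r" using assms unfolding lip_def by auto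
  ultimately show ?thesis using assms(1) * unfolding lip_def by (simp only:) blast
qed

lemma lip_weaken: assumes "lip n x r r'" "r' \<le> r''" "0 < r" shows "lip n x r r''"
proof -
  have "r' / r * d u w \<le> r'' / r * d u w" for u w
    using assms by (intro mult_right_mono divide_right_mono) (auto simp: d_nonneg)
  then show ?thesis using assms unfolding lip_def by (meson less_le_trans order_trans)
qed

lemma lip_recenter: "lip n x r r' \<Longrightarrow> 0 < r \<Longrightarrow> d x y \<le> r \<Longrightarrow> lip n y r r'"
  using lip_mono[of n x r r' r y] by simp

lemma homothety_image: assumes "homothety n x r r'" "0 < r" "d x u \<le> r" shows "d ((f ^^ n) x) ((f ^^ n) u) \<le> r'"
proof -
  have "r' > 0" using assms unfolding homothety_def by auto
  have "d ((f ^^ n) x) ((f ^^ n) u) = r' / r * d x u" using assms unfolding homothety_def by auto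
  also have "r' / r * d x u \<le> r' / r * r" using assms \<open>r' > 0\<close> by (intro mult_left_mono) auto
  finally show ?thesis using assms by simp
qed

lemma homothety_comp:
  assumes r: "0 < r" and 1: "homothety n x r r'" and 2: "homothety k ((f ^^ n) x) r' r''"
  shows "homothety (k + n) x r r''"
proof -
  have r': "r' > 0" "r'' > 0" using 1 2 unfolding homothety_def by auto
  have main: "d ((f ^^ (k + n)) u) ((f ^^ (k + n)) w) = r'' / r * d u w" if "d x u \<le> r" "d x w \<le> r" for u w
  proof -
    have "d ((f ^^ (k + n)) u) ((f ^^ (k + n)) w) = r'' / r' * d ((f ^^ n) u) ((f ^^ n) w)"
      using 2 homothety_image[OF 1 r that(1)] homothety_image[OF 1 r that(2)] unfolding homothety_def by (simp add: iter_add)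
    also have "\<dots> = r'' / r' * (r' / r * d u w)"
      using 1 that unfolding homothety_def by simp
    finally show ?thesis using r' by simp
  qed
  have "\<exists>v\<in>Z. d x v \<le> r \<and> (f ^^ (k + n)) v = w" if w: "w \<in> Z" "d ((f ^^ (k + n)) x) w \<le> r''" for w
  proof -
    obtain v where v: "v \<in> Z" "d ((f ^^ n) x) v \<le> r'" "(f ^^ k) v = w"
      using 2 w unfolding homothety_def iter_add by blast
    obtain u where "u \<in> Z" "d x u \<le> r" "(f ^^ n) u = v"
      using 1 v unfolding homothety_def by blast
    then show ?thesis using v by (auto simp: iter_add)
  qed
  then show ?thesis using main r' unfolding homothety_def by blast
qed

text \<open>Preimages for the smaller disc are found in the larger one, and the exact scaling then
  forces them into the smaller one.\<close>

lemma homothety_mono: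
  assumes "homothety n x r r'" "0 < s" "s \<le> r" "d x y \<le> r" shows "homothety n y s (s * r' / r)"
proof -
  have *: "d x u \<le> r" if "d y u \<le> s" for u using d_le[of x y r u] that assms by simp
  have r': "r' > 0" "r > 0" using assms unfolding homothety_def by auto
  have sc: "d ((f ^^ n) u) ((f ^^ n) w) = r' / r * d u w" if "d x u \<le> r" "d x w \<le> r" for u w
    using assms(1) that unfolding homothety_def by blast
  have "\<exists>v\<in>Z. d y v \<le> s \<and> (f ^^ n) v = w" if w: "w \<in> Z" "d ((f ^^ n) y) w \<le> s * r' / r" for w
  proof -
    have "s * r' / r \<le> r'" using assms r' by (simp add: field_simps)
    then have "d ((f ^^ n) x) w \<le> r'"
      using d_le[of _ "(f ^^ n) y"] homothety_image[OF assms(1) r'(2) assms(4)] w by fastforce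
    then obtain v where v: "v \<in> Z" "d x v \<le> r" "(f ^^ n) v = w"
      using assms(1) w unfolding homothety_def by blast
    have "r' / r * d y v \<le> s * r' / r" using sc[of y v] v w assms(4) by simp
    then have "d y v \<le> s" using r' by (simp add: field_simps)
    then show ?thesis using v by blast
  qed
  moreover have "s * r' / r / s = r' / r" "0 < s * r' / r" using assms r' by auto
  ultimately show ?thesis using sc * unfolding homothety_def by (simp only:) blast
qed

section \<open>Local models at ordinary and at critical points\<close>

definition reg_at :: "'p \<Rightarrow> real \<Rightarrow> bool" where
  "reg_at a r \<longleftrightarrow> (\<exists>l>0. (\<forall>x y. d a x \<le> r \<longrightarrow> d a y \<le> r \<longrightarrow> d (f x) (f y) = l * d x y) \<and>
     (\<forall>b\<in>Z. \<forall>s. d a b \<le> r \<longrightarrow> s \<le> r \<longrightarrow> (\<forall>w\<in>Z. d (f b) w \<le> l * s \<longrightarrow> (\<exists>v\<in>Z. d b v \<le> s \<and> f v = w))))"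

text \<open>Metric shadow of \<open>z ^ m\<close> times a nonvanishing factor. In the last clause
  \<open>\<mu> * A * d c b ^ (m - 1)\<close> is the size of the derivative at \<open>b\<close>, with
  \<open>\<mu>\<close> standing for the absolute value of \<open>m\<close>; the linear term
  dominates only on radii below \<open>\<mu> * d c b\<close>.\<close>

definition crit_at :: "'p \<Rightarrow> real \<Rightarrow> nat \<Rightarrow> real \<Rightarrow> real \<Rightarrow> bool" where
  "crit_at c A m \<mu> r \<longleftrightarrow>
     (\<forall>x. d c x \<le> r \<longrightarrow> d (f c) (f x) = A * d c x ^ m) \<and>
     (\<forall>x y. d c x \<le> r \<longrightarrow> d c y \<le> r \<longrightarrow> d (f x) (f y) \<le> A * max (d c x) (d c y) ^ (m - 1) * d x y) \<and>
     (\<forall>b s. d c b \<le> r \<longrightarrow> 0 < s \<longrightarrow> s < \<mu> * d c b \<longrightarrow>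
        (\<forall>x y. d b x \<le> s \<longrightarrow> d b y \<le> s \<longrightarrow> d (f x) (f y) = \<mu> * A * d c b ^ (m - 1) * d x y) \<and>
        (b \<in> Z \<longrightarrow> (\<forall>w\<in>Z. d (f b) w \<le> \<mu> * A * d c b ^ (m - 1) * s \<longrightarrow> (\<exists>v\<in>Z. d b v \<le> s \<and> f v = w))))"

lemma reg_at_mono: assumes "reg_at a r" "d a b \<le> r" "s \<le> r" shows "reg_at b s"
proof -
  have *: "d a x \<le> r" if "d b x \<le> s" for x using d_le[of a b r x] that assms by simp
  obtain l where l: "l > 0" "\<And>x y. d a x \<le> r \<Longrightarrow> d a y \<le> r \<Longrightarrow> d (f x) (f y) = l * d x y"
    "\<And>b s w. b \<in> Z \<Longrightarrow> d a b \<le> r \<Longrightarrow> s \<le> r \<Longrightarrow> w \<in> Z \<Longrightarrow> d (f b) w \<le> l * s \<Longrightarrow> \<exists>v\<in>Z. d b v \<le> s \<and> f v = w"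
    using assms(1) unfolding reg_at_def by blast
  show ?thesis unfolding reg_at_def
  proof (rule exI[of _ l], intro conjI ballI allI impI)
    show "l > 0" by (rule l)
    show "d (f x) (f y) = l * d x y" if "d b x \<le> s" "d b y \<le> s" for x y using l(2) * that by blast
    show "\<exists>v\<in>Z. d b' v \<le> s' \<and> f v = w" if "b' \<in> Z" "d b b' \<le> s" "s' \<le> s" "w \<in> Z" "d (f b') w \<le> l * s'"
      for b' s' w using l(3)[of b' s' w] * that assms(3) by simp
  qed
qed

lemma crit_at_mono: assumes "crit_at c A m \<mu> r" "s \<le> r" shows "crit_at c A m \<mu> s"
proof -
  have *: "d c x \<le> s \<Longrightarrow> d c x \<le> r" for x using assms by simp
  show ?thesis using assms(1) unfolding crit_at_def
    by (elim conjE, intro conjI) (use * in \<open>simp_all\<close>)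
qed

lemma finite_positive_bound:
  assumes "finite C" "\<And>c. c \<in> C \<Longrightarrow> \<exists>r>0. P c (r::real)" "\<And>c r s. P c r \<Longrightarrow> s \<le> r \<Longrightarrow> P c s"
  shows "\<exists>r>0. \<forall>c\<in>C. P c r"
  using assms(1,2)
proof (induction C)
  case empty then show ?case by (intro exI[of _ 1]) simp
next
  case (insert c C)
  obtain r where r: "r > 0" "\<forall>c\<in>C. P c r" using insert by blast
  obtain s where s: "s > 0" "P c s" using insert by blast
  have "min r s > 0" "P c (min r s)" using r s assms(3)[of c s] by auto
  moreover have "\<forall>c\<in>C. P c (min r s)" using r assms(3)[of _ r "min r s"] by auto
  ultimately show ?case by blast
qed

text \<open>The uniform \<open>\<eta>\<close> comes from compactness: points of \<open>J\<close> and
  \<open>Z\<close> away from \<open>C\<close> with ever smaller regular radius would accumulate at a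
  point of \<open>J\<close> outside \<open>C\<close>, because \<open>J\<close> is closed, and the
  regular disc of the limit serves all late points of the sequence.\<close>

lemma uniform_constants:
  assumes C: "finite C" "\<And>c. c \<in> C \<Longrightarrow> \<exists>r>0. crit_at c (A c) (m c) (\<mu> c) r"
    and reg: "\<And>x. x \<in> J \<Longrightarrow> x \<in> Z \<Longrightarrow> x \<notin> C \<Longrightarrow> \<exists>r>0. reg_at x r"
  shows "\<exists>\<delta> \<eta>. 0 < \<eta> \<and> \<eta> \<le> \<delta> \<and> (\<forall>c\<in>C. crit_at c (A c) (m c) (\<mu> c) \<delta>) \<and>
     (\<forall>c\<in>C. \<forall>c'\<in>C. c \<noteq> c' \<longrightarrow> \<delta> < d c c') \<and>
     (\<forall>a. a \<in> J \<longrightarrow> a \<in> Z \<longrightarrow> (\<forall>c\<in>C. \<delta> < d c a) \<longrightarrow> reg_at a \<eta>)"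
proof -
  have one: "\<exists>r>0. \<forall>c'\<in>C. c' \<noteq> c \<longrightarrow> r < d c c'" for c
  proof (rule finite_positive_bound[OF C(1)])
    show "\<exists>r>0. c' \<noteq> c \<longrightarrow> r < d c c'" for c'
    proof (cases "c' = c")
      case False
      then have "0 < d c c' / 2" "d c c' / 2 < d c c'" using d_pos[of c c'] by auto
      then show ?thesis by blast
    qed (auto intro: exI[of _ 1])
  qed auto
  have sep: "\<exists>r>0. \<forall>c\<in>C. \<forall>c'\<in>C. c' \<noteq> c \<longrightarrow> r < d c c'"
  proof (rule finite_positive_bound[OF C(1)])
    show "\<exists>r>0. \<forall>c'\<in>C. c' \<noteq> c \<longrightarrow> r < d c c'" for c by (rule one)
    show "\<forall>c'\<in>C. c' \<noteq> c \<longrightarrow> s < d c c'" if "\<forall>c'\<in>C. c' \<noteq> c \<longrightarrow> r < d c c'" "s \<le> r" for c r s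
      using that by force
  qed
  obtain r1 where r1: "r1 > 0" "\<And>c c'. c \<in> C \<Longrightarrow> c' \<in> C \<Longrightarrow> c' \<noteq> c \<Longrightarrow> r1 < d c c'" using sep by blast
  have "\<exists>r>0. \<forall>c\<in>C. crit_at c (A c) (m c) (\<mu> c) r"
  proof (rule finite_positive_bound[OF C(1)])
    show "\<exists>r>0. crit_at c (A c) (m c) (\<mu> c) r" if "c \<in> C" for c by (rule C(2)[OF that])
    show "crit_at c (A c) (m c) (\<mu> c) s" if "crit_at c (A c) (m c) (\<mu> c) r" "s \<le> r" for c r s
      by (rule crit_at_mono[OF that])
  qed
  then obtain r2 where r2: "r2 > 0" "\<And>c. c \<in> C \<Longrightarrow> crit_at c (A c) (m c) (\<mu> c) r2" by blast
  define \<delta> where "\<delta> = min r1 r2"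
  have \<delta>: "\<delta> > 0" "\<delta> \<le> r1" "\<delta> \<le> r2" using r1 r2 by (auto simp: \<delta>_def)
  have "\<exists>\<eta>. 0 < \<eta> \<and> \<eta> \<le> \<delta> \<and> (\<forall>a. a \<in> J \<longrightarrow> a \<in> Z \<longrightarrow> (\<forall>c\<in>C. \<delta> < d c a) \<longrightarrow> reg_at a \<eta>)"
  proof (rule ccontr)
    assume "\<not> ?thesis"
    then have no: "\<exists>a. a \<in> J \<and> a \<in> Z \<and> (\<forall>c\<in>C. \<delta> < d c a) \<and> \<not> reg_at a \<eta>" if "0 < \<eta>" "\<eta> \<le> \<delta>" for \<eta>
      using that by blast
    have "0 < \<delta> / real (Suc n)" "\<delta> / real (Suc n) \<le> \<delta>" for n using \<delta> by (auto simp: field_simps)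
    then have "\<forall>n. \<exists>a. a \<in> J \<and> a \<in> Z \<and> (\<forall>c\<in>C. \<delta> < d c a) \<and> \<not> reg_at a (\<delta> / real (Suc n))"
      using no by blast
    then obtain s where s: "\<And>n. s n \<in> J" "\<And>n. s n \<in> Z" "\<And>n c. c \<in> C \<Longrightarrow> \<delta> < d c (s n)"
      "\<And>n. \<not> reg_at (s n) (\<delta> / real (Suc n))" by metis
    obtain x t where x: "x \<in> Z" "strict_mono t" "(\<lambda>n. d x (s (t n))) \<longlonglongrightarrow> 0"
      using Z_compact[of s] s(2) by blast
    have ev: "\<forall>\<^sub>F n in sequentially. d x (s (t n)) < e" if "e > 0" for e
      using order_tendstoD(2)[OF x(3) that] .
    have "x \<in> J"
      by (rule J_closed) (use ev s(1) eventually_happens in force)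
    moreover have "x \<notin> C"
    proof
      assume "x \<in> C"
      then have "\<delta> < d x (s (t n))" for n using s(3) by blast
      then show False using eventually_happens[OF ev[OF \<delta>(1)]] by (meson less_asym trivial_limit_sequentially)
    qed
    ultimately obtain r where r: "r > 0" "reg_at x r" using reg x(1) by blast
    have "(\<lambda>n. \<delta> * (1 / real (Suc n))) \<longlonglongrightarrow> \<delta> * 0"
      by (intro tendsto_mult tendsto_const LIMSEQ_Suc[OF lim_1_over_n])
    then have "\<forall>\<^sub>F n in sequentially. \<delta> / real (Suc n) < r"
      using order_tendstoD(2)[of "\<lambda>n. \<delta> / real (Suc n)" 0] r(1) by simp
    then have "\<forall>\<^sub>F n in sequentially. \<delta> / real (Suc (t n)) < r"
      using eventually_subseq[OF x(2)] by blast
    then obtain n where "\<delta> / real (Suc (t n)) < r" "d x (s (t n)) < r"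
      using eventually_happens[OF eventually_conj[OF _ ev[OF r(1)]]] by auto
    then have "reg_at (s (t n)) (\<delta> / real (Suc (t n)))" using reg_at_mono[OF r(2)] by simp
    then show False using s(4) by blast
  qed
  then obtain \<eta> where "0 < \<eta>" "\<eta> \<le> \<delta>" "\<And>a. a \<in> J \<Longrightarrow> a \<in> Z \<Longrightarrow> (\<forall>c\<in>C. \<delta> < d c a) \<Longrightarrow> reg_at a \<eta>" by blast
  moreover have "\<forall>c\<in>C. crit_at c (A c) (m c) (\<mu> c) \<delta>" using r2 crit_at_mono \<delta> by blast
  moreover have "\<forall>c\<in>C. \<forall>c'\<in>C. c \<noteq> c' \<longrightarrow> \<delta> < d c c'" using r1 \<delta> by force
  ultimately show ?thesis by blast
qed

lemma lip_oneI:
  assumes "0 < r'" "\<And>u w. d b u \<le> h \<Longrightarrow> d b w \<le> h \<Longrightarrow> d (f u) (f w) \<le> r' / h * d u w"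
  shows "lip 1 b h r'"
proof -
  have "\<exists>L. \<forall>i\<le>1. \<forall>u w. d b u \<le> h \<longrightarrow> d b w \<le> h \<longrightarrow> d ((f ^^ i) u) ((f ^^ i) w) \<le> L * d u w"
  proof (intro exI allI impI)
    fix i u w assume i: "i \<le> (1::nat)" and uw: "d b u \<le> h" "d b w \<le> h"
    let ?L = "max 1 (r' / h)"
    have "d u w \<le> ?L * d u w" "r' / h * d u w \<le> ?L * d u w"
      using mult_right_mono[OF _ d_nonneg, of 1 ?L u w] mult_right_mono[OF _ d_nonneg, of "r' / h" ?L u w] by auto
    then show "d ((f ^^ i) u) ((f ^^ i) w) \<le> ?L * d u w"
      using i assms(2)[OF uw] by (cases i) auto
  qed
  then show ?thesis using assms unfolding lip_def by simp
qed

text \<open>\<open>f ^^ n\<close> expands by the same factor on the large disc, where only the upper bound is known, and on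
  the small one, where it is a similarity.\<close>

definition good :: "nat \<Rightarrow> 'p \<Rightarrow> real \<Rightarrow> real \<Rightarrow> real \<Rightarrow> real \<Rightarrow> bool" where
  "good n b h \<beta> h' \<beta>' \<longleftrightarrow> lip n b h h' \<and> homothety n b \<beta> \<beta>' \<and> \<beta>' * h = \<beta> * h'"

lemma good_comp:
  assumes "0 < h" "0 < \<beta>" "good n b h \<beta> h' \<beta>'" "good k ((f ^^ n) b) h' \<beta>' h'' \<beta>''"
  shows "good (k + n) b h \<beta> h'' \<beta>''"
proof -
  have pos: "h' > 0" "\<beta>' > 0" using assms unfolding good_def lip_def homothety_def by auto
  have "\<beta>' * h = \<beta> * h'" "\<beta>'' * h' = \<beta>' * h''" using assms unfolding good_def by auto
  then have "\<beta>'' * h * (h' * \<beta>') = \<beta> * h'' * (h' * \<beta>')" by algebra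
  then have "\<beta>'' * h = \<beta> * h''" using pos by simp
  then show ?thesis using assms lip_comp homothety_comp unfolding good_def by blast
qed

end

text \<open>\<open>m c\<close> is the local degree at \<open>c\<close> and \<open>\<mu> c\<close> its absolute value, so \<open>\<mu> c = 1\<close> if and only if \<open>c\<close> is tame.\<close>

locale critical_dynamics = ultrametric_dynamics +
  fixes C :: "'a set" and A \<mu> :: "'a \<Rightarrow> real" and m :: "'a \<Rightarrow> nat" and \<delta> \<eta> :: real
  assumes finite_C: "finite C" and C_J: "c \<in> C \<Longrightarrow> c \<in> J" and C_Z: "c \<in> C \<Longrightarrow> c \<in> Z"
    and A_pos: "c \<in> C \<Longrightarrow> 0 < A c" and m_ge: "c \<in> C \<Longrightarrow> 2 \<le> m c"
    and mu_pos: "c \<in> C \<Longrightarrow> 0 < \<mu> c" and mu_le: "c \<in> C \<Longrightarrow> \<mu> c \<le> 1"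
    and eta_pos: "0 < \<eta>" and eta_le: "\<eta> \<le> \<delta>"
    and crit: "c \<in> C \<Longrightarrow> crit_at c (A c) (m c) (\<mu> c) \<delta>"
    and sep: "c \<in> C \<Longrightarrow> c' \<in> C \<Longrightarrow> c \<noteq> c' \<Longrightarrow> \<delta> < d c c'"
    and reg: "a \<in> J \<Longrightarrow> a \<in> Z \<Longrightarrow> (\<And>c. c \<in> C \<Longrightarrow> \<delta> < d c a) \<Longrightarrow> reg_at a \<eta>"
begin

lemma critD1: "c \<in> C \<Longrightarrow> d c x \<le> \<delta> \<Longrightarrow> d (f c) (f x) = A c * d c x ^ m c"
  using crit unfolding crit_at_def by blast

lemma critD2: "c \<in> C \<Longrightarrow> d c x \<le> \<delta> \<Longrightarrow> d c y \<le> \<delta> \<Longrightarrow>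
    d (f x) (f y) \<le> A c * max (d c x) (d c y) ^ (m c - 1) * d x y"
  using crit unfolding crit_at_def by blast

lemma critD3: "c \<in> C \<Longrightarrow> d c b \<le> \<delta> \<Longrightarrow> 0 < s \<Longrightarrow> s < \<mu> c * d c b \<Longrightarrow> d b x \<le> s \<Longrightarrow> d b y \<le> s \<Longrightarrow>
    d (f x) (f y) = \<mu> c * A c * d c b ^ (m c - 1) * d x y"
  using crit unfolding crit_at_def by blast

lemma critD4: "c \<in> C \<Longrightarrow> d c b \<le> \<delta> \<Longrightarrow> 0 < s \<Longrightarrow> s < \<mu> c * d c b \<Longrightarrow> b \<in> Z \<Longrightarrow> w \<in> Z \<Longrightarrow>
    d (f b) w \<le> \<mu> c * A c * d c b ^ (m c - 1) * s \<Longrightarrow> \<exists>v\<in>Z. d b v \<le> s \<and> f v = w"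
  using crit unfolding crit_at_def by blast

lemma crit_homothety:
  assumes c: "c \<in> C" "d c b \<le> \<delta>" "s < \<mu> c * d c b" "0 < s" "b \<in> Z"
  shows "homothety 1 b s (\<mu> c * A c * d c b ^ (m c - 1) * s)"
proof -
  have "0 < \<mu> c * d c b" using c by linarith
  then have "0 < d c b" using mu_pos[OF c(1)] by (simp add: zero_less_mult_iff)
  then show ?thesis
    using critD3[OF c(1,2,4,3)] critD4[OF c(1,2,4,3,5)] c(4) mu_pos[OF c(1)] A_pos[OF c(1)] unfolding homothety_def
    by simp
qed

lemma crit_lip:
  assumes c: "c \<in> C" "d c b \<le> h" "h \<le> \<delta>" "0 < h"
  shows "lip 1 b h (A c * h ^ m c)"
proof (rule lip_oneI)
  have eq: "A c * h ^ m c / h = A c * h ^ (m c - 1)"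
    using m_ge[OF c(1)] c(4) by (cases "m c") auto
  fix u w assume uw: "d b u \<le> h" "d b w \<le> h"
  have u: "d c u \<le> h" "d c w \<le> h" using d_le[OF c(2)] uw by auto
  have "d (f u) (f w) \<le> A c * max (d c u) (d c w) ^ (m c - 1) * d u w"
    using critD2[OF c(1)] u c(3) by simp
  also have "\<dots> \<le> A c * h ^ (m c - 1) * d u w"
    using u A_pos[OF c(1)] d_nonneg by (intro mult_right_mono mult_left_mono power_mono) (auto simp: le_max_iff_disj)
  finally show "d (f u) (f w) \<le> A c * h ^ m c / h * d u w" unfolding eq .
qed (use A_pos c in auto)

text \<open>If no event occurs, the disc of radius \<open>h\<close> about \<open>b\<close> is far from all critical points, or else \<open>b\<close> lies
  on the sphere of radius \<open>h\<close> about a tame one and the disc of radius \<open>\<beta>\<close> is mapped by a similarity.\<close>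

definition event :: "'a \<Rightarrow> real \<Rightarrow> real \<Rightarrow> bool" where
  "event b h \<beta> \<longleftrightarrow> (\<exists>c\<in>C. \<mu> c * d c b \<le> h \<and> \<not> (\<mu> c = 1 \<and> d c b = h \<and> \<beta> < h))"

text \<open>If every critical point is far, \<open>f\<close> is a similarity on the whole large
  disc. If a tame one lies on its boundary sphere, the Lipschitz bound on the large disc and the
  exact factor on the small one are both \<open>A c * h ^ (m c - 1)\<close>, thanks to
  \<open>\<mu> c = 1\<close>; so the ratio of the radii survives.\<close>

lemma good_step:
  assumes a: "a \<in> J" "a \<in> Z" and b: "b \<in> Z" "d a b \<le> h" and h: "0 < \<beta>" "\<beta> \<le> h" "h \<le> \<eta>"
    and no: "\<not> event b h \<beta>"
  shows "\<exists>h' \<beta>'. good 1 b h \<beta> h' \<beta>'"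
proof (cases "\<exists>c\<in>C. \<mu> c = 1 \<and> d c b = h \<and> \<beta> < h")
  case True
  then obtain c where c: "c \<in> C" "\<mu> c = 1" "d c b = h" "\<beta> < h" by blast
  have hd: "h \<le> \<delta>" using h eta_le by simp
  have "lip 1 b h (A c * h ^ m c)" using crit_lip[OF c(1)] c hd h by simp
  moreover have "homothety 1 b \<beta> (A c * h ^ (m c - 1) * \<beta>)"
    using crit_homothety[OF c(1), of b \<beta>] c hd h b by simp
  moreover have "A c * h ^ (m c - 1) * \<beta> * h = \<beta> * (A c * h ^ m c)"
    using m_ge[OF c(1)] by (cases "m c") (auto simp: mult_ac)
  ultimately show ?thesis unfolding good_def by blast
next
  case False
  then have far: "h < \<mu> c * d c b" if "c \<in> C" for c
    using no that unfolding event_def by (metis not_less)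
  have "\<exists>l>0. (\<forall>x y. d b x \<le> h \<longrightarrow> d b y \<le> h \<longrightarrow> d (f x) (f y) = l * d x y) \<and>
     (\<forall>w\<in>Z. d (f b) w \<le> l * \<beta> \<longrightarrow> (\<exists>v\<in>Z. d b v \<le> \<beta> \<and> f v = w))"
  \<comment> \<open>The split is made for \<open>a\<close> and not for \<open>b\<close>, since
    \<open>reg\<close> applies to points of \<open>J\<close> only. The disc of radius
    \<open>h\<close> about \<open>a\<close> contains \<open>b\<close>, so either local model carries
    over to \<open>b\<close>.\<close>
  proof (cases "\<exists>c\<in>C. d c a \<le> \<delta>")
    case True
    then obtain c where c: "c \<in> C" "d c a \<le> \<delta>" by blast
    have cb: "d c b \<le> \<delta>" using d_le[OF c(2), of b] b h eta_le by simp
    have "0 < \<mu> c * d c b" using far[OF c(1)] h by linarith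
    then have "0 < d c b" using mu_pos[OF c(1)] by (simp add: zero_less_mult_iff)
    then have "0 < \<mu> c * A c * d c b ^ (m c - 1)" using mu_pos A_pos c by simp
    then show ?thesis using critD3[OF c(1) cb less_le_trans[OF h(1,2)] far[OF c(1)]]
      critD4[OF c(1) cb h(1) le_less_trans[OF h(2) far[OF c(1)]] b(1)] by blast
  next
    case False
    then have "reg_at a \<eta>" using reg a by force
    then have "reg_at b h" using reg_at_mono[of a \<eta> b h] b h by simp
    then obtain l where l: "l > 0" "\<And>x y. d b x \<le> h \<Longrightarrow> d b y \<le> h \<Longrightarrow> d (f x) (f y) = l * d x y"
    "\<And>b' s w. b' \<in> Z \<Longrightarrow> d b b' \<le> h \<Longrightarrow> s \<le> h \<Longrightarrow> w \<in> Z \<Longrightarrow> d (f b') w \<le> l * s \<Longrightarrow> \<exists>v\<in>Z. d b' v \<le> s \<and> f v = w"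
      unfolding reg_at_def by blast
    then show ?thesis using l(3)[of b \<beta>] b h by auto
  qed
  then obtain l where l: "l > 0" "\<And>x y. d b x \<le> h \<Longrightarrow> d b y \<le> h \<Longrightarrow> d (f x) (f y) = l * d x y"
     "\<And>w. w \<in> Z \<Longrightarrow> d (f b) w \<le> l * \<beta> \<Longrightarrow> \<exists>v\<in>Z. d b v \<le> \<beta> \<and> f v = w" by blast
  have "lip 1 b h (l * h)" by (rule lip_oneI) (use l h in auto)
  moreover have "homothety 1 b \<beta> (l * \<beta>)" using l h unfolding homothety_def by auto
  ultimately have "good 1 b h \<beta> (l * h) (l * \<beta>)" unfolding good_def by simp
  then show ?thesis by blast
qed

lemma good_zero: "0 < h \<Longrightarrow> 0 < \<beta> \<Longrightarrow> good 0 b h \<beta> h \<beta>"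
  unfolding good_def lip_def homothety_def by (auto intro: exI[of _ 1])

text \<open>Without an event the steps could be continued forever, and the bound
  \<open>\<eta>\<close> on the large radii would make \<open>\<eta> / h\<close> a Lipschitz constant
  for all iterates near the point \<open>a\<close> of \<open>J\<close>. The bound on the radii will
  come from equicontinuity on \<open>Z\<close>.\<close>

lemma run_until_event:
  assumes a: "a \<in> J" "a \<in> Z" and b: "b \<in> Z" "d a b \<le> h" and h: "0 < \<beta>" "\<beta> \<le> h"
    and bd: "\<And>n h' \<beta>'. good n b h \<beta> h' \<beta>' \<Longrightarrow> h' \<le> \<eta>"
  shows "\<exists>n h' \<beta>'. good n b h \<beta> h' \<beta>' \<and> event ((f ^^ n) b) h' \<beta>'"
proof (rule ccontr)
  assume "\<not> ?thesis"
  then have no: "\<not> event ((f ^^ n) b) h' \<beta>'" if "good n b h \<beta> h' \<beta>'" for n h' \<beta>' using that by blast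
  have h0: "0 < h" using h by simp
  have all: "\<exists>h' \<beta>'. good n b h \<beta> h' \<beta>'" for n
  proof (induction n)
    case 0 then show ?case using good_zero[OF h0 h(1)] by blast
  next
    case (Suc n)
    then obtain h' \<beta>' where g: "good n b h \<beta> h' \<beta>'" by blast
    have pos: "h' > 0" "\<beta>' > 0" and eq: "\<beta>' * h = \<beta> * h'" using g unfolding good_def lip_def homothety_def by auto
    have "\<beta>' * h \<le> h' * h" unfolding eq using h pos by (simp add: mult.commute mult_left_mono)
    then have le: "\<beta>' \<le> h'" using h0 by simp
    have "lip n b h h'" using g unfolding good_def by simp
    moreover have "d b a \<le> h" using b d_sym by simp
    ultimately have "d ((f ^^ n) a) ((f ^^ n) b) \<le> h'" using lip_image[OF _ h0] d_sym by metis
    then obtain h'' \<beta>'' where "good 1 ((f ^^ n) b) h' \<beta>' h'' \<beta>''"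
      using good_step[OF J_iter[OF a(1)] iter_Z[OF a(2)] iter_Z[OF b(1)] _ pos(2) le bd[OF g] no[OF g]] by blast
    then show ?case using good_comp[OF h0 h(1) g] by (metis plus_1_eq_Suc)
  qed
  have "d ((f ^^ n) x) ((f ^^ n) y) \<le> \<eta> / h * d x y" if xy: "d a x \<le> h" "d a y \<le> h" for n x y
  proof -
    obtain h' \<beta>' where g: "good n b h \<beta> h' \<beta>'" using all by blast
    have "d b x \<le> h" "d b y \<le> h" using d_le'[OF b(2)] xy by auto
    then have "d ((f ^^ n) x) ((f ^^ n) y) \<le> h' / h * d x y" using g unfolding good_def lip_def by blast
    also have "\<dots> \<le> \<eta> / h * d x y"
      using bd[OF g] h0 by (intro mult_right_mono divide_right_mono d_nonneg) auto
    finally show ?thesis .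
  qed
  then show False using J_not_lipschitz[OF a(1) h0] by blast
qed

end

section \<open>Recurrent critical points\<close>

context ultrametric_dynamics begin

lemma q_nonzero [simp]: "q \<noteq> 0" using q_pos by simp

lemma q_nonneg [simp]: "0 \<le> q" using q_pos by simp

definition orbit_cl :: "'p \<Rightarrow> 'p set" where
  "orbit_cl x = {z. \<forall>e>0. \<exists>n. d ((f ^^ n) x) z < e}"

lemma orbit_cl_iter: "(f ^^ n) x \<in> orbit_cl x"
  unfolding orbit_cl_def by (auto intro: exI[of _ n])

lemma orbit_cl_self: "x \<in> orbit_cl x"
  using orbit_cl_iter[of 0] by simp

lemma orbit_cl_forward: assumes "z \<in> orbit_cl x" shows "f z \<in> orbit_cl x"
  unfolding orbit_cl_def
proof (intro CollectI allI impI)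
  fix e :: real assume "e > 0"
  then obtain r where r: "r > 0" "\<And>y. d z y < r \<Longrightarrow> d (f z) (f y) < e" using f_cont by blast
  obtain n where "d ((f ^^ n) x) z < r" using assms r(1) unfolding orbit_cl_def by blast
  then have "d ((f ^^ Suc n) x) (f z) < e" using r(2)[of "(f ^^ n) x"] d_sym by simp
  then show "\<exists>n. d ((f ^^ n) x) (f z) < e" by blast
qed

lemma orbit_cl_forward_iter: "z \<in> orbit_cl x \<Longrightarrow> (f ^^ n) z \<in> orbit_cl x"
  by (induction n) (auto simp: orbit_cl_forward)

lemma orbit_cl_trans: assumes z: "z \<in> orbit_cl x" and w: "w \<in> orbit_cl z" shows "w \<in> orbit_cl x"
  unfolding orbit_cl_def
proof (intro CollectI allI impI)
  fix e :: real assume e: "e > 0"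
  obtain n where n: "d ((f ^^ n) z) w < e" using w e unfolding orbit_cl_def by blast
  obtain k where "d ((f ^^ k) x) ((f ^^ n) z) < e" using orbit_cl_forward_iter[OF z, of n] e unfolding orbit_cl_def by blast
  then show "\<exists>n. d ((f ^^ n) x) w < e" using d_less n by blast
qed

lemma orbit_cl_gap: assumes "c \<notin> orbit_cl x" shows "\<exists>e>0. \<forall>y\<in>orbit_cl x. e < d c y"
proof -
  obtain e where e: "e > 0" "\<And>n. \<not> d ((f ^^ n) x) c < e" using assms unfolding orbit_cl_def by blast
  have "e / 2 < d c y" if y: "y \<in> orbit_cl x" for y
  proof (rule ccontr)
    assume "\<not> e / 2 < d c y"
    then have "d y c < e" using e(1) d_sym[of c y] by simp
    moreover obtain n where "d ((f ^^ n) x) y < e" using y e(1) unfolding orbit_cl_def by blast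
    ultimately show False using e(2) d_less by blast
  qed
  then show ?thesis using e(1) by (intro exI[of _ "e / 2"]) simp
qed

section \<open>Pulling points of \<open>Z\<close> back along an orbit segment\<close>

definition small_on :: "'p \<Rightarrow> real \<Rightarrow> real \<Rightarrow> bool" where
  "small_on b r \<epsilon> \<longleftrightarrow> (\<forall>n. \<forall>u\<in>Z. \<forall>v\<in>Z. d b u \<le> r \<longrightarrow> d b v \<le> r \<longrightarrow> d ((f ^^ n) u) ((f ^^ n) v) \<le> \<epsilon>)"

lemma small_on_mono: "small_on b r \<epsilon> \<Longrightarrow> s \<le> r \<Longrightarrow> small_on b s \<epsilon>"
  unfolding small_on_def by (meson order_trans)

lemma small_on_image:
  assumes "homothety n b r r'" "small_on b r \<epsilon>" shows "small_on ((f ^^ n) b) r' \<epsilon>"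
  unfolding small_on_def
proof (intro allI ballI impI)
  fix k u v assume uv: "u \<in> Z" "v \<in> Z" "d ((f ^^ n) b) u \<le> r'" "d ((f ^^ n) b) v \<le> r'"
  obtain u' where u': "u' \<in> Z" "d b u' \<le> r" "(f ^^ n) u' = u"
    using assms(1) uv unfolding homothety_def by blast
  obtain v' where v': "v' \<in> Z" "d b v' \<le> r" "(f ^^ n) v' = v"
    using assms(1) uv unfolding homothety_def by blast
  have "d ((f ^^ (k + n)) u') ((f ^^ (k + n)) v') \<le> \<epsilon>"
    using assms(2) u' v' unfolding small_on_def by blast
  then show "d ((f ^^ k) u) ((f ^^ k) v) \<le> \<epsilon>" using u' v' by (simp add: iter_add)
qed

lemma homothety_value:
  assumes "homothety n b (q ^ k) r'" "b \<in> Z" obtains j where "r' = q ^ j"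
proof -
  obtain v where v: "v \<in> Z" "d b v = q ^ k" using Z_sphere[OF assms(2)] by blast
  have h: "0 < r'" "\<And>u w. d b u \<le> q ^ k \<Longrightarrow> d b w \<le> q ^ k \<Longrightarrow> d ((f ^^ n) u) ((f ^^ n) w) = r' / q ^ k * d u w"
    using assms(1) unfolding homothety_def by blast+
  have "d ((f ^^ n) b) ((f ^^ n) v) = r'" using h(2)[of b v] v by simp
  moreover from this have "(f ^^ n) b \<noteq> (f ^^ n) v" using h(1) by auto
  ultimately show ?thesis using that Z_val[OF iter_Z[OF assms(2)] iter_Z[OF v(1)]] by metis
qed

text \<open>The image radius is attained as the distance between the images of two points of
  \<open>Z\<close>. So equicontinuity on \<open>Z\<close> limits how far a similarity can
  expand.\<close>

lemma homothety_small:
  assumes "homothety n b (q ^ k) r'" "b \<in> Z" "small_on b (q ^ k) \<epsilon>" shows "r' \<le> \<epsilon>"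
proof -
  obtain v where v: "v \<in> Z" "d b v = q ^ k" using Z_sphere[OF assms(2)] by blast
  have h: "\<And>u w. d b u \<le> q ^ k \<Longrightarrow> d b w \<le> q ^ k \<Longrightarrow> d ((f ^^ n) u) ((f ^^ n) w) = r' / q ^ k * d u w"
    using assms(1) unfolding homothety_def by blast
  have "d ((f ^^ n) b) ((f ^^ n) v) = r'" using h[of b v] v by simp
  then show ?thesis using assms(2,3) v unfolding small_on_def by (metis d_self order_refl q_power_pos less_imp_le)
qed

text \<open>Keeps from a homothety only the inverse branch on pairs of points of \<open>Z\<close>
  and its Lipschitz constant. In this form it survives a change of centres, a larger source and a
  smaller target, and hence composition along several passages.\<close>

definition lifts :: "nat \<Rightarrow> 'p \<Rightarrow> real \<Rightarrow> 'p \<Rightarrow> real \<Rightarrow> real \<Rightarrow> bool" where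
  "lifts n b r c r' L \<longleftrightarrow> (\<forall>w1\<in>Z. \<forall>w2\<in>Z. d c w1 \<le> r' \<longrightarrow> d c w2 \<le> r' \<longrightarrow>
     (\<exists>v1\<in>Z. \<exists>v2\<in>Z. d b v1 \<le> r \<and> d b v2 \<le> r \<and> (f ^^ n) v1 = w1 \<and> (f ^^ n) v2 = w2 \<and> d v1 v2 \<le> L * d w1 w2))"

lemma liftsD: assumes "lifts n b r c r' L" "w1 \<in> Z" "w2 \<in> Z" "d c w1 \<le> r'" "d c w2 \<le> r'"
  obtains v1 v2 where "v1 \<in> Z" "v2 \<in> Z" "d b v1 \<le> r" "d b v2 \<le> r" "(f ^^ n) v1 = w1" "(f ^^ n) v2 = w2"
    "d v1 v2 \<le> L * d w1 w2"
  using assms unfolding lifts_def by blast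

lemma homothety_lifts:
  assumes "homothety n b r r'" "0 < r" "d ((f ^^ n) b) c \<le> r'" shows "lifts n b r c r' (r / r')"
  unfolding lifts_def
proof (intro ballI impI)
  fix w1 w2 assume w: "w1 \<in> Z" "w2 \<in> Z" "d c w1 \<le> r'" "d c w2 \<le> r'"
  have sc: "\<And>u w. d b u \<le> r \<Longrightarrow> d b w \<le> r \<Longrightarrow> d ((f ^^ n) u) ((f ^^ n) w) = r' / r * d u w" and r': "0 < r'"
    and sur: "\<And>w. w \<in> Z \<Longrightarrow> d ((f ^^ n) b) w \<le> r' \<Longrightarrow> \<exists>v\<in>Z. d b v \<le> r \<and> (f ^^ n) v = w"
    using assms(1) unfolding homothety_def by blast+
  obtain v1 where v1: "v1 \<in> Z" "d b v1 \<le> r" "(f ^^ n) v1 = w1" using sur[OF w(1)] d_le[OF assms(3) w(3)] by blast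
  obtain v2 where v2: "v2 \<in> Z" "d b v2 \<le> r" "(f ^^ n) v2 = w2" using sur[OF w(2)] d_le[OF assms(3) w(4)] by blast
  have "d v1 v2 \<le> r / r' * d w1 w2" using sc[OF v1(2) v2(2)] v1 v2 assms(2) r' by simp
  then show "\<exists>v1\<in>Z. \<exists>v2\<in>Z. d b v1 \<le> r \<and> d b v2 \<le> r \<and> (f ^^ n) v1 = w1 \<and> (f ^^ n) v2 = w2 \<and> d v1 v2 \<le> r / r' * d w1 w2"
    using v1 v2 by blast
qed

lemma lifts_comp:
  assumes 1: "lifts n b r b' r' L" and 2: "lifts k b' r' c r'' L'" and L: "0 \<le> L"
  shows "lifts (k + n) b r c r'' (L * L')"
  unfolding lifts_def
proof (intro ballI impI)
  fix w1 w2 assume w: "w1 \<in> Z" "w2 \<in> Z" "d c w1 \<le> r''" "d c w2 \<le> r''"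
  obtain u1 u2 where u: "u1 \<in> Z" "u2 \<in> Z" "d b' u1 \<le> r'" "d b' u2 \<le> r'" "(f ^^ k) u1 = w1" "(f ^^ k) u2 = w2"
    "d u1 u2 \<le> L' * d w1 w2" using liftsD[OF 2 w] by metis
  obtain v1 v2 where v: "v1 \<in> Z" "v2 \<in> Z" "d b v1 \<le> r" "d b v2 \<le> r" "(f ^^ n) v1 = u1" "(f ^^ n) v2 = u2"
    "d v1 v2 \<le> L * d u1 u2" using liftsD[OF 1 u(1-4)] by metis
  have "d v1 v2 \<le> L * (L' * d w1 w2)" using v(7) u(7) L by (meson mult_left_mono order_trans)
  then show "\<exists>v1\<in>Z. \<exists>v2\<in>Z. d b v1 \<le> r \<and> d b v2 \<le> r \<and> (f ^^ (k + n)) v1 = w1 \<and> (f ^^ (k + n)) v2 = w2 \<and> d v1 v2 \<le> L * L' * d w1 w2"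
    using v u by (intro bexI[of _ v1] bexI[of _ v2]) (auto simp: iter_add mult.assoc)
qed

lemma lifts_mono:
  assumes "lifts n b r c r' L" "r \<le> R" "d b b2 \<le> R" "R' \<le> r'" "d c c2 \<le> r'"
  shows "lifts n b2 R c2 R' L"
  unfolding lifts_def
proof (intro ballI impI)
  fix w1 w2 assume w: "w1 \<in> Z" "w2 \<in> Z" "d c2 w1 \<le> R'" "d c2 w2 \<le> R'"
  have "d c w1 \<le> r'" "d c w2 \<le> r'" using d_le[OF assms(5)] w assms(4) by (meson order_trans)+
  then obtain v1 v2 where v: "v1 \<in> Z" "v2 \<in> Z" "d b v1 \<le> r" "d b v2 \<le> r" "(f ^^ n) v1 = w1" "(f ^^ n) v2 = w2"
    "d v1 v2 \<le> L * d w1 w2" using liftsD[OF assms(1) w(1,2)] by metis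
  moreover have "d b2 v1 \<le> R" "d b2 v2 \<le> R" using d_le'[OF assms(3)] v assms(2) by (meson order_trans)+
  ultimately show "\<exists>v1\<in>Z. \<exists>v2\<in>Z. d b2 v1 \<le> R \<and> d b2 v2 \<le> R \<and> (f ^^ n) v1 = w1 \<and> (f ^^ n) v2 = w2 \<and> d v1 v2 \<le> L * d w1 w2"
    by blast
qed

text \<open>Equicontinuity is carried forward along inverse branches: the iterate \<open>j\<close>
  of two points near \<open>c\<close> is the iterate \<open>j + n\<close> of their lifts, which are
  close together in a disc of uniform equicontinuity.\<close>

lemma lifts_FK:
  assumes u: "uniform_on x r0" "d x b \<le> r0" "r \<le> r0" and l: "lifts n b r c r' L" and c: "c \<in> Z" "0 < r'"
    and L: "0 < L"
  shows "c \<in> FK"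
proof -
  have "equicontinuous_on {y \<in> Z. d c y < r'}"
    unfolding equicontinuous_on_def
  proof (intro ballI allI impI)
    fix w1 e assume w1: "w1 \<in> {y \<in> Z. d c y < r'}" and e: "(0::real) < e"
    obtain s where s: "s > 0" "\<And>y z n. y \<in> Z \<Longrightarrow> z \<in> Z \<Longrightarrow> d x y \<le> r0 \<Longrightarrow> d x z \<le> r0 \<Longrightarrow> d y z < s \<Longrightarrow>
      d ((f ^^ n) y) ((f ^^ n) z) < e" using uniform_onD[OF u(1) e] by metis
    have "d ((f ^^ j) w1) ((f ^^ j) w2) < e" if w2: "w2 \<in> {y \<in> Z. d c y < r'}" "d w1 w2 < s / L" for w2 j
    proof -
      obtain v1 v2 where v: "v1 \<in> Z" "v2 \<in> Z" "d b v1 \<le> r" "d b v2 \<le> r" "(f ^^ n) v1 = w1" "(f ^^ n) v2 = w2"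
        "d v1 v2 \<le> L * d w1 w2" using liftsD[OF l, of w1 w2] w1 w2 by auto
      have "L * d w1 w2 < s" using w2(2) L by (simp add: field_simps)
      then have "d v1 v2 < s" using v by simp
      moreover have "d x v1 \<le> r0" "d x v2 \<le> r0" using d_le[OF u(2)] v u(3) by auto
      ultimately have "d ((f ^^ (j + n)) v1) ((f ^^ (j + n)) v2) < e" using s(2) v by blast
      then show ?thesis using v by (simp add: iter_add)
    qed
    moreover have "s / L > 0" using s L by simp
    ultimately show "\<exists>t>0. \<forall>y\<in>{y \<in> Z. d c y < r'}. d w1 y < t \<longrightarrow> (\<forall>n. d ((f ^^ n) w1) ((f ^^ n) y) < e)" by blast
  qed
  then show ?thesis using c unfolding FK_def by blast
qed

lemma finite_iter_fibre: "finite {x. (f ^^ n) x = y}"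
proof (induction n arbitrary: y)
  case (Suc n)
  have "{x. (f ^^ Suc n) x = y} = (\<Union>z\<in>{z. (f ^^ n) z = y}. {x. f x = z})"
    unfolding iter_Suc by auto
  then show ?case using Suc fin_fibres by simp
qed simp

text \<open>Between two visits of the orbit of \<open>x\<close> near \<open>c\<close>, the orbit of
  \<open>c\<close> follows that of \<open>x\<close> by equicontinuity, so it returns too. The second
  visit is taken strictly later, which gives at least one step and hence the orbit closure of
  \<open>f c\<close>.\<close>

lemma recurrent_of_limit:
  assumes c: "c \<in> FK" and lim: "\<And>e N. 0 < e \<Longrightarrow> \<exists>n\<ge>N. d ((f ^^ n) x) c < e" and x: "x \<in> Z"
  shows "c \<in> orbit_cl (f c)"
  unfolding orbit_cl_def
proof (intro CollectI allI impI)
  fix e :: real assume e: "e > 0"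
  obtain r where r: "r > 0" "uniform_on c r" using FK_uniform[OF c] by blast
  obtain s where s: "s > 0" "\<And>y z n. y \<in> Z \<Longrightarrow> z \<in> Z \<Longrightarrow> d c y \<le> r \<Longrightarrow> d c z \<le> r \<Longrightarrow> d y z < s \<Longrightarrow>
    d ((f ^^ n) y) ((f ^^ n) z) < e" using uniform_onD[OF r(2) e] by metis
  obtain n1 where n1: "d ((f ^^ n1) x) c < min s r" using lim[of "min s r" 0] s r by auto
  obtain n2 where n2: "n2 \<ge> Suc n1" "d ((f ^^ n2) x) c < e" using lim[of e "Suc n1"] e by auto
  obtain N where N: "n2 = Suc N + n1" using n2(1) by (metis add.commute le_iff_add add_Suc_right)
  have "c \<in> Z" using c unfolding FK_def by blast
  then have "d ((f ^^ Suc N) c) ((f ^^ Suc N) ((f ^^ n1) x)) < e"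
    using n1 d_sym[of c] r by (intro s(2) iter_Z x) auto
  then have "d ((f ^^ Suc N) c) c < e" using n2(2) unfolding N iter_add by (rule d_less)
  then show "\<exists>n. d ((f ^^ n) (f c)) c < e" unfolding iter_Suc by blast
qed

end

section \<open>Reaching a critical point from every small sphere\<close>

context critical_dynamics begin

definition wild_pts :: "'a set" where "wild_pts = {c \<in> C. \<mu> c < 1}"

text \<open>Collects what the next induction needs from the orbit closure of the current point of
  \<open>J\<close>. In the induction \<open>Y\<close> may be replaced by a smaller set of the same
  kind, the orbit closure of \<open>f c\<close> for a wild \<open>c\<close> in
  \<open>Y\<close>.\<close>

definition inv_set :: "real \<Rightarrow> 'a set \<Rightarrow> bool" where
  "inv_set g Y \<longleftrightarrow> (\<forall>y\<in>Y. f y \<in> Y) \<and> (\<forall>c\<in>C. \<forall>y\<in>Y. d c y \<le> g \<longrightarrow> c \<in> Y) \<and> (\<forall>c\<in>C \<inter> Y. orbit_cl (f c) \<subseteq> Y)"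

lemma inv_set_iter: "inv_set g Y \<Longrightarrow> y \<in> Y \<Longrightarrow> (f ^^ n) y \<in> Y"
  by (induction n) (auto simp: inv_set_def)

text \<open>A run that starts at the disc of radius \<open>q ^ k\<close> about \<open>b\<close> ends near a critical point \<open>c\<close>. If \<open>c\<close> lies in
  the image of this disc, we are done. If \<open>c\<close> is tame, start again with centre \<open>c\<close> and with \<open>i\<close>
  decreased. If \<open>c\<close> is wild, shrink the disc by \<open>q ^ s\<close> and start again at \<open>f c\<close>: the orbit closure of
  \<open>f c\<close> does not contain \<open>c\<close>, so one wild point is lost.\<close>

lemma hit_critical_point:
  assumes g: "0 < g" "\<And>w. w \<in> C \<Longrightarrow> inv_set g (orbit_cl (f w))"
    and norec: "\<And>c. c \<in> C \<Longrightarrow> \<mu> c < 1 \<Longrightarrow> c \<notin> orbit_cl (f c)"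
    and s: "\<And>c. c \<in> C \<Longrightarrow> q ^ s < \<mu> c"
    and \<epsilon>: "\<epsilon> \<le> min \<eta> g * q ^ s * q ^ I"
  shows "\<lbrakk>i + (3 * s + 1) * card (wild_pts \<inter> Y) \<le> I; inv_set g Y; a \<in> Y; a \<in> J; a \<in> Z; b \<in> Z;
    d a b * q ^ i \<le> q ^ k; small_on b (q ^ k) \<epsilon>\<rbrakk>
    \<Longrightarrow> \<exists>n c r L. c \<in> C \<and> 0 < r \<and> 0 < L \<and> lifts n b (q ^ k) c r L"
proof (induction "i + (3 * s + 1) * card (wild_pts \<inter> Y)" arbitrary: i Y a b k rule: less_induct)
  case less
  note Y = less.prems(2,3) and a = less.prems(4,5) and b = less.prems(6) and ab = less.prems(7) and sm = less.prems(8)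
  \<comment> \<open>Two discs about \<open>b\<close> are followed: the one of radius
    \<open>q ^ k\<close> carries the points of \<open>Z\<close>, and the one of radius
    \<open>h\<close> is just enlarged enough to contain the point \<open>a\<close> of
    \<open>J\<close>.\<close>
  define h where "h = q ^ k / q ^ i"
  have h: "0 < h" "q ^ k \<le> h" "q ^ k = q ^ i * h" "d a b \<le> h"
    using ab q_power_pos[of i] q_power_pos[of k] power_le_one[of q i] q_pos q_less by (auto simp: h_def field_simps)
  have iI: "q ^ I \<le> q ^ i" using less.prems(1) q_power_le_iff by simp
  \<comment> \<open>Equicontinuity bounds the small radius by \<open>\<epsilon>\<close>. Division by
    \<open>q ^ i\<close>, with \<open>i \<le> I\<close>, leaves \<open>min \<eta> g * q ^ s\<close>
    for the large one; the spare factor \<open>q ^ s\<close> pays for a division by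
    \<open>\<mu> c\<close> below.\<close>
  have bd: "h' \<le> min \<eta> g * q ^ s \<and> \<beta>' = q ^ i * h'" if gd: "good n b h (q ^ k) h' \<beta>'" for n h' \<beta>'
  proof -
    have \<beta>': "\<beta>' = q ^ i * h'" using gd h unfolding good_def by auto
    have "\<beta>' \<le> \<epsilon>" using homothety_small[OF _ b sm] gd unfolding good_def by blast
    then have "q ^ i * h' \<le> min \<eta> g * q ^ s * q ^ I" unfolding \<beta>' using \<epsilon> by linarith
    also have "\<dots> \<le> min \<eta> g * q ^ s * q ^ i" using iI g(1) eta_pos q_power_pos[of s] by (intro mult_left_mono mult_nonneg_nonneg) (auto intro: less_imp_le)
    finally show ?thesis using \<beta>' q_power_pos[of i] by (simp add: mult.commute del: q_power_pos)
  qed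
  have qs: "q ^ s \<le> 1" using power_le_one[of q s] q_pos q_less by simp
  have mg: "0 < min \<eta> g" using g eta_pos by simp
  have "min \<eta> g * q ^ s \<le> min \<eta> g * 1" using qs mg by (intro mult_left_mono) auto
  then have bd1: "h' \<le> \<eta>" if "good n b h (q ^ k) h' \<beta>'" for n h' \<beta>' using bd[OF that] by linarith
  have "\<exists>n h' \<beta>'. good n b h (q ^ k) h' \<beta>' \<and> event ((f ^^ n) b) h' \<beta>'"
    by (rule run_until_event[OF a b h(4) q_power_pos h(2)]) (rule bd1)
  then obtain n h' \<beta>' where gd: "good n b h (q ^ k) h' \<beta>'" and ev: "event ((f ^^ n) b) h' \<beta>'"
    by blast
  note bd' = bd[OF gd]
  have lp: "lip n b h h'" and hm: "homothety n b (q ^ k) \<beta>'" using gd unfolding good_def by auto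
  obtain k' where k': "\<beta>' = q ^ k'" using homothety_value[OF hm b] by blast
  have h': "0 < h'" using lp unfolding lip_def by blast
  define b' where "b' = (f ^^ n) b"
  have b': "b' \<in> Z" using iter_Z b by (simp add: b'_def)
  obtain c where c: "c \<in> C" "\<mu> c * d c b' \<le> h'" "\<not> (\<mu> c = 1 \<and> d c b' = h' \<and> \<beta>' < h')"
    using ev unfolding event_def b'_def by blast
  define H where "H = d c b'"
  have \<mu>: "0 < \<mu> c" "q ^ s < \<mu> c" "\<mu> c \<le> 1" using mu_pos mu_le s c(1) by auto
  have H0: "0 \<le> H" by (simp add: H_def d_nonneg)
  have "q ^ s * H \<le> \<mu> c * H" using \<mu> H0 by (intro mult_right_mono) auto
  also have "\<dots> \<le> min \<eta> g * q ^ s" using c(2) bd' by (simp add: H_def)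
  finally have "H * q ^ s \<le> min \<eta> g * q ^ s" by (simp add: mult.commute)
  then have Hle: "H \<le> min \<eta> g" using q_power_pos[of s] mult_le_cancel_right_pos by blast
  have h'le: "h' \<le> min \<eta> g"
    using bd' \<open>min \<eta> g * q ^ s \<le> min \<eta> g * 1\<close> by linarith
  have "d ((f ^^ n) b) ((f ^^ n) a) \<le> h'" using lip_image[OF lp h(1)] h(4) d_sym by simp
  \<comment> \<open>The image of the large disc contains the iterate of \<open>a\<close>, a point of
    \<open>Y\<close>; so \<open>c\<close> is within \<open>g\<close> of \<open>Y\<close> and belongs
    to it.\<close>
  then have "d c ((f ^^ n) a) \<le> min \<eta> g" using d_le[OF Hle[unfolded H_def], of "(f ^^ n) a"] h'le unfolding b'_def by linarith
  moreover have "(f ^^ n) a \<in> Y" using inv_set_iter Y by blast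
  ultimately have cY: "c \<in> Y" using Y(1) c(1) unfolding inv_set_def by (meson min.boundedE)
  have sm': "small_on b' (q ^ k') \<epsilon>" using small_on_image[OF hm sm] by (simp add: b'_def k')
  have l1: "lifts n b (q ^ k) b' \<beta>' (q ^ k / \<beta>')" using homothety_lifts[OF hm, of b'] k' by (simp add: b'_def)
  have \<beta>'0: "0 < \<beta>'" by (simp add: k')
  have Hd: "H \<le> \<delta>" using Hle eta_le by simp
  consider "H \<le> \<beta>'" | "\<beta>' < H" "\<mu> c = 1" | "\<beta>' < H" "\<mu> c < 1" using \<mu>(3) by linarith
  then show ?case
  proof cases
    case 1
    then have "lifts n b (q ^ k) c \<beta>' (q ^ k / \<beta>')"
      using homothety_lifts[OF hm, of c] d_sym[of c] by (simp add: H_def b'_def)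
    moreover have "0 < q ^ k / \<beta>'" using \<beta>'0 by simp
    ultimately show ?thesis using c(1) \<beta>'0 by blast
  next
    case 2
    \<comment> \<open>Equality is excluded, because a tame point on the boundary of the large disc
      is no event while the small radius is below \<open>h'\<close>. With \<open>c\<close> in place
      of \<open>a\<close>, the new large disc about \<open>b'\<close> has radius
      \<open>H < h'\<close>, and this lowers \<open>i\<close>.\<close>
    then have "H < h'" using c(2,3) unfolding H_def[symmetric] by force
    have "c \<noteq> b'" using 2 \<beta>'0 by (auto simp: H_def)
    then obtain l where l: "H = q ^ l" using Z_val[OF C_Z[OF c(1)] b'] by (auto simp: H_def)
    have lk: "l < k'" using 2 q_power_less_iff unfolding l k' by simp
    define i' where "i' = k' - l"
    have eq: "H * q ^ i' = q ^ k'" using lk by (simp add: l i'_def flip: power_add)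
    have "H * q ^ i' = q ^ i * h'" using eq bd' k' by simp
    also have "\<dots> > q ^ i * H" using \<open>H < h'\<close> by simp
    finally have "H * q ^ i < H * q ^ i'" by (simp add: mult.commute)
    then have "q ^ i < q ^ i'" using l by simp
    then have i': "i' < i" using q_power_less_iff by simp
    have "\<exists>n c r L. c \<in> C \<and> 0 < r \<and> 0 < L \<and> lifts n b' (q ^ k') c r L"
      by (rule less.hyps[of i' Y c b' k'])
        (use i' less.prems(1) Y cY C_J C_Z c(1) b' eq sm' in \<open>auto simp: H_def\<close>)
    then obtain n2 c2 r L where "c2 \<in> C" "0 < r" "0 < L" "lifts n2 b' (q ^ k') c2 r L" by blast
    moreover have "lifts (n2 + n) b (q ^ k) c2 r (q ^ k / \<beta>' * L)"
      using lifts_comp[OF l1 _ , of n2 c2 r L] calculation \<beta>'0 k' by simp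
    moreover have "0 < q ^ k / \<beta>' * L" using \<beta>'0 calculation by simp
    ultimately show ?thesis by blast
  next
    case 3
    have H1: "0 < H" using 3 \<beta>'0 by linarith
    \<comment> \<open>Because of \<open>q ^ s < \<mu> c\<close> and \<open>\<beta>' < H\<close>,
      this shrinking brings the radius below \<open>\<mu> c * H\<close>, where \<open>f\<close> is a
      similarity about \<open>b'\<close>.\<close>
    define \<beta>2 where "\<beta>2 = q ^ s * \<beta>'"
    have \<beta>2: "0 < \<beta>2" using \<beta>'0 by (simp add: \<beta>2_def)
    have "q ^ s * \<beta>' < q ^ s * H" using 3(1) by simp
    also have "\<dots> < \<mu> c * H" using \<mu>(2) H1 by simp
    finally have "\<beta>2 < \<mu> c * H" by (simp add: \<beta>2_def)
    then have h1: "homothety 1 b' \<beta>2 (\<mu> c * A c * H ^ (m c - 1) * \<beta>2)"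
      using crit_homothety[OF c(1)] Hd \<beta>2 b' by (simp add: H_def)
    define \<beta>3 where "\<beta>3 = \<mu> c * A c * H ^ (m c - 1) * \<beta>2"
    have kk: "q ^ s * q ^ k = q ^ (s + k)" by (simp add: power_add)
    have "homothety n b (q ^ (s + k)) (q ^ (s + k) * \<beta>' / q ^ k)"
      by (rule homothety_mono[OF hm]) (auto simp: q_power_le_iff)
    moreover have "q ^ (s + k) * \<beta>' / q ^ k = \<beta>2" by (simp add: \<beta>2_def power_add)
    ultimately have h2: "homothety n b (q ^ (s + k)) \<beta>2" by simp
    have h3: "homothety (1 + n) b (q ^ (s + k)) \<beta>3"
      by (rule homothety_comp[OF _ h2]) (use h1 in \<open>simp_all add: \<beta>3_def b'_def\<close>)
    obtain k3 where k3: "\<beta>3 = q ^ k3" using homothety_value[OF h3 b] by blast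
    have fb: "(f ^^ (1 + n)) b = f b'" by (simp add: b'_def)
    have sm3: "small_on (f b') (q ^ k3) \<epsilon>"
      using small_on_image[OF h3 small_on_mono[OF sm]] unfolding fb k3 by (simp add: q_power_le_iff)
    let ?Y = "orbit_cl (f c)"
    have "wild_pts \<inter> ?Y \<subseteq> wild_pts \<inter> Y" using Y(1) cY c(1) unfolding inv_set_def by blast
    moreover have "c \<in> wild_pts \<inter> Y" "c \<notin> ?Y" using c(1) cY 3(2) norec by (auto simp: wild_pts_def)
    ultimately have "wild_pts \<inter> ?Y \<subset> wild_pts \<inter> Y" by blast
    then have card: "card (wild_pts \<inter> ?Y) < card (wild_pts \<inter> Y)" using finite_C by (intro psubset_card_mono) (auto simp: wild_pts_def)
    then have "(3 * s + 1) * Suc (card (wild_pts \<inter> ?Y)) \<le> (3 * s + 1) * card (wild_pts \<inter> Y)" by (intro mult_le_mono2) simp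
    \<comment> \<open>The wild point that is lost frees \<open>3 * s + 1\<close> units:
      \<open>3 * s\<close> of them are spent on the larger \<open>i\<close>, and the last one makes
      the measure drop.\<close>
    then have meas: "(i + 3 * s) + (3 * s + 1) * card (wild_pts \<inter> ?Y) < i + (3 * s + 1) * card (wild_pts \<inter> Y)" by simp
    have dfc: "d (f c) (f b') = A c * H ^ m c" using critD1[OF c(1)] Hd by (simp add: H_def)
    have m1: "H ^ m c = H ^ (m c - 1) * H" using m_ge[OF c(1)] by (cases "m c") auto
    have "H * q ^ s * q ^ s \<le> H * \<mu> c * \<mu> c"
      using \<mu> H0 by (intro mult_mono) (auto intro: mult_nonneg_nonneg)
    also have "\<dots> \<le> h' * \<mu> c" using c(2) \<mu> by (intro mult_right_mono) (auto simp: H_def mult.commute)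
    finally have e1: "H * q ^ s * q ^ s \<le> h' * \<mu> c" .
    \<comment> \<open>Origin of \<open>3 * s\<close>: one factor \<open>q ^ s\<close> from the
      shrinking, one factor \<open>\<mu> c\<close> from the derivative, and one more
      \<open>\<mu> c\<close> from the event bound \<open>\<mu> c * H \<le> h'\<close>. Each
      \<open>\<mu> c\<close> exceeds \<open>q ^ s\<close>.\<close>
    have "d (f c) (f b') * q ^ (i + 3 * s) = A c * H ^ (m c - 1) * q ^ s * q ^ i * (H * q ^ s * q ^ s)"
      unfolding dfc m1 by (simp add: power_add power_mult eval_nat_numeral power_mult_distrib mult_ac)
    also have "\<dots> \<le> A c * H ^ (m c - 1) * q ^ s * q ^ i * (h' * \<mu> c)"
      using e1 A_pos[OF c(1)] H0 by (intro mult_left_mono) (auto intro!: mult_nonneg_nonneg)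
    also have "\<dots> = \<beta>3" using bd' by (simp add: \<beta>3_def \<beta>2_def mult_ac)
    finally have d3: "d (f c) (f b') * q ^ (i + 3 * s) \<le> q ^ k3" by (simp add: k3)
    have "\<exists>n c r L. c \<in> C \<and> 0 < r \<and> 0 < L \<and> lifts n (f b') (q ^ k3) c r L"
      by (rule less.hyps[of "i + 3 * s" ?Y "f c" "f b'" k3, OF meas])
        (use meas less.prems(1) g c(1) orbit_cl_self J_forward C_J C_Z f_Z b' d3 sm3 in \<open>simp_all\<close>)
    then obtain n2 c2 r L where l2: "c2 \<in> C" "0 < r" "0 < L" "lifts n2 (f b') (q ^ k3) c2 r L" by blast
    have "lifts (1 + n) b (q ^ (s + k)) (f b') (q ^ k3) (q ^ (s + k) / \<beta>3)"
      using homothety_lifts[OF h3, of "f b'"] k3 unfolding fb by simp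
    then have "lifts (n2 + (1 + n)) b (q ^ (s + k)) c2 r (q ^ (s + k) / \<beta>3 * L)"
      by (rule lifts_comp[OF _ l2(4)]) (simp add: k3)
    then have "lifts (n2 + (1 + n)) b (q ^ k) c2 r (q ^ (s + k) / \<beta>3 * L)"
      by (rule lifts_mono) (use l2 in \<open>auto simp: q_power_le_iff d_nonneg\<close>)
    moreover have "0 < q ^ (s + k) / \<beta>3 * L" using l2 by (simp add: k3)
    ultimately show ?thesis using l2 by blast
  qed
qed

text \<open>A critical point outside an orbit closure has positive distance from it; finitely many
  closures and critical points admit a common \<open>g\<close>.\<close>

lemma uniform_gap:
  obtains g where "0 < g" "inv_set g (orbit_cl x)" "\<And>w. w \<in> C \<Longrightarrow> inv_set g (orbit_cl (f w))"
proof -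
  let ?P = "\<lambda>z c r. c \<in> orbit_cl z \<or> (\<forall>y\<in>orbit_cl z. r < d c y)"
  have P: "\<exists>r>0. \<forall>c\<in>C. ?P z c r" for z
  proof (rule finite_positive_bound[OF finite_C])
    show "\<exists>r>0. ?P z c r" for c using orbit_cl_gap[of c z] by (meson zero_less_one)
    show "?P z c s" if "?P z c r" "s \<le> r" for c r s using that by (meson le_less_trans)
  qed
  have "\<exists>r>0. \<forall>w\<in>C. \<forall>c\<in>C. ?P (f w) c r"
  proof (rule finite_positive_bound[OF finite_C])
    show "\<exists>r>0. \<forall>c\<in>C. ?P (f w) c r" for w by (rule P)
    show "\<forall>c\<in>C. ?P (f w) c s" if "\<forall>c\<in>C. ?P (f w) c r" "s \<le> r" for w r s using that by (meson le_less_trans)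
  qed
  then obtain r1 where r1: "r1 > 0" "\<And>w c. w \<in> C \<Longrightarrow> c \<in> C \<Longrightarrow> ?P (f w) c r1" by blast
  obtain r2 where r2: "r2 > 0" "\<And>c. c \<in> C \<Longrightarrow> ?P x c r2" using P by blast
  have inv: "inv_set (min r1 r2) (orbit_cl z)" if "\<And>c. c \<in> C \<Longrightarrow> ?P z c (min r1 r2)" for z
    unfolding inv_set_def
  proof (intro conjI ballI impI)
    show "f y \<in> orbit_cl z" if "y \<in> orbit_cl z" for y using orbit_cl_forward that .
    show "c \<in> orbit_cl z" if "c \<in> C" "y \<in> orbit_cl z" "d c y \<le> min r1 r2" for c y
      using \<open>\<And>c. c \<in> C \<Longrightarrow> ?P z c (min r1 r2)\<close>[OF that(1)] that by (meson not_less)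
    show "orbit_cl (f c) \<subseteq> orbit_cl z" if "c \<in> C \<inter> orbit_cl z" for c
      using orbit_cl_trans[OF orbit_cl_forward] that by blast
  qed
  have "inv_set (min r1 r2) (orbit_cl x)" by (rule inv) (use r2 in force)
  moreover have "inv_set (min r1 r2) (orbit_cl (f w))" if "w \<in> C" for w by (rule inv) (use r1 that in force)
  ultimately show ?thesis using that[of "min r1 r2"] r1 r2 by simp
qed

lemma uniform_small:
  assumes u: "uniform_on x r" "0 < r" and \<epsilon>: "0 < \<epsilon>"
  obtains k0 where "\<And>k. k \<ge> k0 \<Longrightarrow> small_on x (q ^ k) \<epsilon>" "\<And>k. k \<ge> k0 \<Longrightarrow> q ^ k \<le> r"
proof -
  obtain s where s: "s > 0" "\<And>y z n. y \<in> Z \<Longrightarrow> z \<in> Z \<Longrightarrow> d x y \<le> r \<Longrightarrow> d x z \<le> r \<Longrightarrow> d y z < s \<Longrightarrow>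
      d ((f ^^ n) y) ((f ^^ n) z) < \<epsilon>" using uniform_onD[OF u(1) \<epsilon>] by metis
  obtain k0 where k0: "\<forall>k\<ge>k0. q ^ k < min s r" using q_power_small[of "min s r"] s u by auto
  have "small_on x (q ^ k) \<epsilon>" if k: "k \<ge> k0" for k
    unfolding small_on_def
  proof (intro allI ballI impI)
    fix n y z assume yz: "y \<in> Z" "z \<in> Z" "d x y \<le> q ^ k" "d x z \<le> q ^ k"
    have "q ^ k < min s r" using k0 k by blast
    moreover have "d y z \<le> q ^ k" using d_le'[OF yz(3,4)] .
    ultimately show "d ((f ^^ n) y) ((f ^^ n) z) \<le> \<epsilon>"
      using s(2)[of y z n] yz by linarith
  qed
  then show ?thesis using that[of k0] k0 by force
qed

text \<open>On every small sphere about \<open>x\<close>, \<open>hit_critical_point\<close> finds a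
  point of \<open>Z\<close> that lands exactly on a member of \<open>C\<close>, and
  \<open>lifts_FK\<close> puts this member into \<open>FK\<close>. The landing times are unbounded,
  so by equicontinuity the orbit of \<open>x\<close> itself comes close to these finitely many
  members at arbitrarily late times, and one of them is a limit point.\<close>

lemma recurrent_critical_point:
  assumes x: "x \<in> FK" "x \<in> J"
    and norec: "\<And>c. c \<in> C \<Longrightarrow> \<mu> c < 1 \<Longrightarrow> c \<notin> orbit_cl (f c)"
  shows "\<exists>c\<in>C \<inter> FK. c \<in> orbit_cl (f c)"
proof -
  have xZ: "x \<in> Z" using x unfolding FK_def by blast
  obtain r0 where r0: "0 < r0" "uniform_on x r0" using FK_uniform[OF x(1)] by blast
  obtain g where g: "0 < g" "inv_set g (orbit_cl x)" "\<And>w. w \<in> C \<Longrightarrow> inv_set g (orbit_cl (f w))"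
    using uniform_gap[of x] by blast
  have "\<exists>r>0. \<forall>c\<in>C. r < \<mu> c"
    by (rule finite_positive_bound[OF finite_C]) (auto dest: mu_pos dense)
  then obtain r where r: "r > 0" "\<And>c. c \<in> C \<Longrightarrow> r < \<mu> c" by blast
  obtain s where "q ^ s < r" using q_power_small[OF r(1)] by blast
  then have s: "q ^ s < \<mu> c" if "c \<in> C" for c using r(2)[OF that] by linarith
  \<comment> \<open>The leading 1 is the initial value of \<open>i\<close>: the starting disc about
    \<open>y\<close> has radius \<open>q ^ Suc k\<close>, and \<open>x\<close> is at distance
    \<open>q ^ k\<close> from its centre.\<close>
  define I where "I = 1 + (3 * s + 1) * card (wild_pts \<inter> orbit_cl x)"
  define \<epsilon> where "\<epsilon> = min \<eta> g * q ^ s * q ^ I"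
  have \<epsilon>: "0 < \<epsilon>" using g eta_pos by (simp add: \<epsilon>_def)
  obtain k0 where k0: "\<And>k. k \<ge> k0 \<Longrightarrow> small_on x (q ^ k) \<epsilon>" "\<And>k. k \<ge> k0 \<Longrightarrow> q ^ k \<le> r0"
    using uniform_small[OF r0(2,1) \<epsilon>] by blast
  have hit: "\<exists>t n c. t \<in> Z \<and> d x t = q ^ k \<and> c \<in> C \<inter> FK \<and> (f ^^ n) t = c" if k: "k \<ge> k0" for k
  proof -
    obtain y where y: "y \<in> Z" "d x y = q ^ k" using Z_sphere[OF xZ] by blast
    have sub: "d x u \<le> q ^ k" if "d y u \<le> q ^ Suc k" for u
    proof -
      have "d y u \<le> q ^ k" using that q_power_le_iff[of "Suc k" k] by linarith
      then show ?thesis using d_le[of x y "q ^ k" u] y by simp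
    qed
    have "small_on y (q ^ Suc k) \<epsilon>"
      using k0(1)[OF k] sub unfolding small_on_def by blast
    then have "\<exists>n c r L. c \<in> C \<and> 0 < r \<and> 0 < L \<and> lifts n y (q ^ Suc k) c r L"
      using hit_critical_point[OF g(1,3) norec s, where I = I and i = 1 and Y = "orbit_cl x" and a = x and b = y and k = "Suc k" and \<epsilon> = \<epsilon>]
      using g(2) orbit_cl_self x xZ y by (simp add: I_def \<epsilon>_def mult.commute)
    then obtain n c r L where l: "c \<in> C" "0 < r" "0 < L" "lifts n y (q ^ Suc k) c r L" by blast
    have "c \<in> FK"
    proof (rule lifts_FK[OF r0(2) _ _ l(4) C_Z[OF l(1)] l(2,3)])
      show "d x y \<le> r0" using k0(2)[OF k] y by simp
      show "q ^ Suc k \<le> r0" using k0(2)[of "Suc k"] k by simp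
    qed
    obtain t where t: "t \<in> Z" "d y t \<le> q ^ Suc k" "(f ^^ n) t = c"
      using liftsD[OF l(4) C_Z[OF l(1)] C_Z[OF l(1)]] l(2) by (metis d_self less_imp_le)
    have "d t y < d y x" using t(2) y(2) q_power_less_iff[of "Suc k" k] d_sym[of t y] d_sym[of x y] by linarith
    then have "d t x = d y x" by (rule d_isosceles)
    then have "d x t = q ^ k" using y d_sym by simp
    then show ?thesis using t l(1) \<open>c \<in> FK\<close> by blast
  qed
  \<comment> \<open>Points on different spheres are distinct, whereas only finitely many points
    reach \<open>C\<close> in fewer than \<open>N\<close> steps.\<close>
  have far: "\<exists>k\<ge>K. \<exists>t n c. t \<in> Z \<and> d x t = q ^ k \<and> c \<in> C \<inter> FK \<and> (f ^^ n) t = c \<and> N \<le> n" if K: "K \<ge> k0" for K N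
  proof (rule ccontr)
    assume no: "\<not> ?thesis"
    have "\<forall>k. \<exists>t. d x t = q ^ (K + k) \<and> (\<exists>n<N. \<exists>c\<in>C. (f ^^ n) t = c)"
    proof
      fix k
      obtain t n c where t: "t \<in> Z" "d x t = q ^ (K + k)" "c \<in> C \<inter> FK" "(f ^^ n) t = c"
        using hit[of "K + k"] K by auto
      then have "n < N" using no by (meson le_add1 not_less)
      then show "\<exists>t. d x t = q ^ (K + k) \<and> (\<exists>n<N. \<exists>c\<in>C. (f ^^ n) t = c)" using t by blast
    qed
    then obtain t where t: "\<And>k. d x (t k) = q ^ (K + k)" "\<And>k. \<exists>n<N. \<exists>c\<in>C. (f ^^ n) (t k) = c" by metis
    have "inj t"
    proof (rule injI)
      fix i j assume "t i = t j"
      then have "q ^ (K + i) = q ^ (K + j)" using t(1) by metis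
      then show "i = j" using q_power_eq_iff by simp
    qed
    moreover have "range t \<subseteq> (\<Union>n\<in>{..<N}. \<Union>c\<in>C. {z. (f ^^ n) z = c})" using t(2) by force
    moreover have "finite (\<Union>n\<in>{..<N}. \<Union>c\<in>C. {z. (f ^^ n) z = c})" using finite_C finite_iter_fibre by blast
    ultimately show False using finite_subset finite_imageD infinite_UNIV_nat by blast
  qed
  have near: "\<exists>n\<ge>N. \<exists>c\<in>C \<inter> FK. d ((f ^^ n) x) c < e" if e: "e > 0" for e N
  proof -
    have "0 < e / 2" using e by simp
    then obtain k1 where k1: "\<And>k. k \<ge> k1 \<Longrightarrow> small_on x (q ^ k) (e / 2)" using uniform_small[OF r0(2,1)] by blast
    obtain k t n c where t: "k \<ge> max k0 k1" "t \<in> Z" "d x t = q ^ k" "c \<in> C \<inter> FK" "(f ^^ n) t = c" "N \<le> n"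
      using far[of "max k0 k1" N] by auto
    have "d ((f ^^ n) x) ((f ^^ n) t) \<le> e / 2" using k1[of k] t xZ unfolding small_on_def by auto
    then show ?thesis using t e by (intro exI[of _ n]) force
  qed
  have "\<forall>j. \<exists>n c. j \<le> n \<and> c \<in> C \<inter> FK \<and> d ((f ^^ n) x) c < q ^ j" using near[of "q ^ j" j for j] by (meson q_power_pos)
  then obtain n c where nc: "\<And>j. j \<le> n j" "\<And>j. c j \<in> C \<inter> FK" "\<And>j. d ((f ^^ n j) x) (c j) < q ^ j" by metis
  have "finite (c ` UNIV)" by (rule finite_subset[of _ C]) (use nc finite_C in auto)
  \<comment> \<open>Some critical point is approached for infinitely many \<open>j\<close>; it is
    the limit point required.\<close>
  then obtain j0 where inf: "infinite {j. c j = c j0}" using pigeonhole_infinite[of UNIV c] by auto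
  have "c j0 \<in> orbit_cl (f (c j0))"
  proof (rule recurrent_of_limit[OF _ _ xZ])
    show "c j0 \<in> FK" using nc by blast
    fix e :: real and N assume "0 < e"
    then obtain k1 where k1: "\<forall>k\<ge>k1. q ^ k < e" using q_power_small by blast
    obtain j where "j > max N k1" "c j = c j0" using inf unfolding infinite_nat_iff_unbounded by blast
    then have "N \<le> n j" "d ((f ^^ n j) x) (c j0) < e" using nc(1,3)[of j] k1 by (auto intro: less_trans)
    then show "\<exists>n\<ge>N. d ((f ^^ n) x) (c j0) < e" by blast
  qed
  then show ?thesis using nc(2) by blast
qed

end

section \<open>Minimal classes with at most two members\<close>

context ultrametric_dynamics begin

lemma q_Suc_le: "q ^ Suc k \<le> q ^ k"
  using q_power_le_iff[of "Suc k" k] le_SucI by blast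

lemma iter_cont: "0 < e \<Longrightarrow> \<exists>r>0. \<forall>y. d x y < r \<longrightarrow> d ((f ^^ n) x) ((f ^^ n) y) < e"
proof (induction n arbitrary: x)
  case (Suc n)
  obtain r where r: "r > 0" "\<And>y. d (f x) y < r \<Longrightarrow> d ((f ^^ n) (f x)) ((f ^^ n) y) < e" using Suc by blast
  obtain s where "s > 0" "\<And>y. d x y < s \<Longrightarrow> d (f x) (f y) < r" using f_cont[OF r(1)] by blast
  then show ?case unfolding iter_Suc using r(2) by blast
qed auto

text \<open>One close return of \<open>c\<close>, after \<open>M\<close> steps, makes all multiples
  of \<open>M\<close> return times. So every stretch of \<open>M\<close> consecutive iterates of
  \<open>c\<close> contains a return, and \<open>z\<close>, which shadows such a stretch, comes near
  \<open>c\<close> within \<open>M\<close> steps.\<close>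

lemma recurrent_return:
  assumes c: "c \<in> FK" "c \<in> orbit_cl (f c)" and z: "z \<in> orbit_cl c" shows "c \<in> orbit_cl (f z)"
  unfolding orbit_cl_def
proof (intro CollectI allI impI)
  fix e :: real assume e: "e > 0"
  have cZ: "c \<in> Z" using c unfolding FK_def by blast
  obtain r where r: "r > 0" "uniform_on c r" using FK_uniform[OF c(1)] by blast
  obtain s where s: "s > 0" "\<And>y z n. y \<in> Z \<Longrightarrow> z \<in> Z \<Longrightarrow> d c y \<le> r \<Longrightarrow> d c z \<le> r \<Longrightarrow> d y z < s \<Longrightarrow>
    d ((f ^^ n) y) ((f ^^ n) z) < e" using uniform_onD[OF r(2) e] by metis
  have "0 < min s r" using s r by simp
  then obtain N where N: "d ((f ^^ N) (f c)) c < min s r" using c(2) unfolding orbit_cl_def by blast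
  define M where "M = Suc N"
  have M: "d c ((f ^^ M) c) < min s r" using N d_sym by (simp add: M_def iter_Suc del: funpow.simps)
  \<comment> \<open>Consecutive points of this sequence are closer than \<open>e\<close>, and in an
    ultrametric such moves do not add up.\<close>
  have ret: "d c ((f ^^ (j * M)) c) < e" for j
  proof (induction j)
    case 0 then show ?case using e by simp
  next
    case (Suc j)
    have "d ((f ^^ (j * M)) c) ((f ^^ (j * M)) ((f ^^ M) c)) < e"
      using M r by (intro s(2) cZ iter_Z) auto
    moreover have "Suc j * M = j * M + M" by simp
    ultimately have "d ((f ^^ (j * M)) c) ((f ^^ (Suc j * M)) c) < e" by (simp only: iter_add)
    then show ?case using Suc d_less by blast
  qed
  have "\<exists>t>0. \<forall>j\<in>{..M}. \<forall>y. d z y < t \<longrightarrow> d ((f ^^ j) z) ((f ^^ j) y) < e"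
    by (rule finite_positive_bound) (use iter_cont[OF e] in \<open>auto intro: less_le_trans\<close>)
  then obtain t where t: "t > 0" "\<And>j y. j \<le> M \<Longrightarrow> d z y < t \<Longrightarrow> d ((f ^^ j) z) ((f ^^ j) y) < e" by blast
  obtain n where n: "d ((f ^^ n) c) z < t" using z t(1) unfolding orbit_cl_def by blast
  \<comment> \<open>Completes \<open>n\<close> to a multiple of \<open>M\<close> by a positive
    amount. Only iterates of \<open>z\<close> up to \<open>M\<close> are compared, so continuity at
    \<open>z\<close> suffices.\<close>
  define j where "j = M - n mod M"
  have j: "0 < j" "j \<le> M" by (auto simp: j_def M_def)
  have "n + j = (n div M + 1) * M"
    using mod_less_divisor[of M n] div_mult_mod_eq[of n M] unfolding j_def by (simp add: M_def algebra_simps)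
  then have "d c ((f ^^ j) ((f ^^ n) c)) < e" using ret[of "n div M + 1"] by (metis add.commute iter_add)
  moreover have "d ((f ^^ j) z) ((f ^^ j) ((f ^^ n) c)) < e" using t(2)[OF j(2), of "(f ^^ n) c"] n d_sym[of z] by simp
  ultimately have "d ((f ^^ j) z) c < e" using d_less[of "(f ^^ j) z"] d_sym by metis
  moreover obtain i where "j = Suc i" using j(1) by (cases j) auto
  ultimately show "\<exists>n. d ((f ^^ n) (f z)) c < e" unfolding iter_Suc by (metis iter_Suc)
qed

text \<open>Repeated lifting brings two distinct points arbitrarily close together, yet some iterate
  of the lifted pair is the original pair again; this contradicts uniform equicontinuity.\<close>

lemma no_repeller:
  assumes u: "uniform_on e r" and S: "\<And>w. w \<in> S \<Longrightarrow> w \<in> Z \<and> d e w \<le> r" and w: "w1 \<in> S" "w2 \<in> S" "w1 \<noteq> w2"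
    and step: "\<And>u v. u \<in> S \<Longrightarrow> v \<in> S \<Longrightarrow> \<exists>u'\<in>S. \<exists>v'\<in>S. (f ^^ n) u' = u \<and> (f ^^ n) v' = v \<and> d u' v' \<le> \<theta> * d u v"
    and \<theta>: "0 \<le> \<theta>" "\<theta> < 1"
  shows False
proof -
  have it: "\<exists>u\<in>S. \<exists>v\<in>S. (f ^^ (j * n)) u = w1 \<and> (f ^^ (j * n)) v = w2 \<and> d u v \<le> \<theta> ^ j * d w1 w2" for j
  proof (induction j)
    case 0 then show ?case using w by auto
  next
    case (Suc j)
    then obtain u v where uv: "u \<in> S" "v \<in> S" "(f ^^ (j * n)) u = w1" "(f ^^ (j * n)) v = w2" "d u v \<le> \<theta> ^ j * d w1 w2" by blast
    obtain u' v' where s: "u' \<in> S" "v' \<in> S" "(f ^^ n) u' = u" "(f ^^ n) v' = v" "d u' v' \<le> \<theta> * d u v" using step[OF uv(1,2)] by blast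
    have "d u' v' \<le> \<theta> * (\<theta> ^ j * d w1 w2)" using s(5) uv(5) \<theta> by (meson mult_left_mono order_trans)
    moreover have "Suc j * n = j * n + n" by simp
    then have "(f ^^ (Suc j * n)) u' = w1" "(f ^^ (Suc j * n)) v' = w2"
      using s uv by (simp_all only: iter_add)
    ultimately show ?case using s by (intro bexI[of _ u'] bexI[of _ v']) (auto simp: mult.assoc)
  qed
  have pos: "0 < d w1 w2" using d_pos w by blast
  obtain s where s: "s > 0" "\<And>y z n. y \<in> Z \<Longrightarrow> z \<in> Z \<Longrightarrow> d e y \<le> r \<Longrightarrow> d e z \<le> r \<Longrightarrow> d y z < s \<Longrightarrow>
    d ((f ^^ n) y) ((f ^^ n) z) < d w1 w2" using uniform_onD[OF u pos] by metis
  have "0 < s / d w1 w2" using s pos by simp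
  then obtain j where "\<theta> ^ j < s / d w1 w2" using real_arch_pow_inv \<theta> by blast
  then have "\<theta> ^ j * d w1 w2 < s" using pos by (simp add: field_simps)
  moreover obtain u v where "u \<in> S" "v \<in> S" "(f ^^ (j * n)) u = w1" "(f ^^ (j * n)) v = w2" "d u v \<le> \<theta> ^ j * d w1 w2"
    using it by blast
  ultimately show False using s(2)[of u v "j * n"] S by force
qed

text \<open>The upper bounds of a passage without any statement about preimages. Such steps compose
  as soon as the next disc is large enough, and that is all a contradiction with \<open>J\<close>
  requires.\<close>

definition reaches :: "nat \<Rightarrow> 'p \<Rightarrow> nat \<Rightarrow> 'p \<Rightarrow> nat \<Rightarrow> bool" where
  "reaches n x k x' k' \<longleftrightarrow> lip n x (q ^ k) (q ^ k') \<and> d ((f ^^ n) x) x' \<le> q ^ k'"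

lemma reaches_comp:
  assumes 1: "reaches n x k x' k'" and 2: "reaches n' x' l x'' k2" and le: "l \<le> k'"
  shows "reaches (n' + n) x k x'' k2"
proof -
  have l2: "lip n' x' (q ^ l) (q ^ k2)" using 2 unfolding reaches_def by blast
  have kl: "q ^ k' \<le> q ^ l" using le q_power_le_iff by blast
  have dx: "d x' ((f ^^ n) x) \<le> q ^ k'" using 1 d_sym unfolding reaches_def by simp
  then have dl: "d x' ((f ^^ n) x) \<le> q ^ l" using kl by linarith
  have "lip n' ((f ^^ n) x) (q ^ k') (q ^ k' * q ^ k2 / q ^ l)" using lip_mono[OF l2 _ kl dl] by simp
  then have "lip (n' + n) x (q ^ k) (q ^ k' * q ^ k2 / q ^ l)"
    using lip_comp[OF q_power_pos] 1 unfolding reaches_def by blast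
  moreover have "q ^ k' * q ^ k2 / q ^ l \<le> q ^ k2" using kl by (simp add: field_simps)
  ultimately have "lip (n' + n) x (q ^ k) (q ^ k2)" using lip_weaken by simp
  moreover have "d ((f ^^ n') x') ((f ^^ n') ((f ^^ n) x)) \<le> q ^ k2" using lip_image[OF l2 _ dl] by simp
  then have "d ((f ^^ (n' + n)) x) x'' \<le> q ^ k2"
    unfolding iter_add using 2 d_le' unfolding reaches_def by blast
  ultimately show ?thesis unfolding reaches_def by blast
qed

text \<open>A disc that \<open>f ^^ n\<close> maps into itself without expanding has bounded
  Lipschitz constants: only the constant of the first \<open>n\<close> iterates counts. This cannot
  happen about a point of \<open>J\<close>.\<close>

lemma reaches_self:
  assumes e: "e \<in> J" and r: "reaches n e k e k'" and k: "k \<le> k'" and n: "1 \<le> n" shows False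
proof -
  have lp: "lip n e (q ^ k) (q ^ k')" and ee: "d ((f ^^ n) e) e \<le> q ^ k'" using r unfolding reaches_def by auto
  obtain L where L: "\<And>i u w. i \<le> n \<Longrightarrow> d e u \<le> q ^ k \<Longrightarrow> d e w \<le> q ^ k \<Longrightarrow> d ((f ^^ i) u) ((f ^^ i) w) \<le> L * d u w"
    using lp unfolding lip_def by blast
  have kk: "q ^ k' \<le> q ^ k" using k q_power_le_iff by blast
  have maps: "d e ((f ^^ n) u) \<le> q ^ k" if "d e u \<le> q ^ k" for u
    using d_le'[OF ee lip_image[OF lp q_power_pos that]] kk by linarith
  have one: "d ((f ^^ n) u) ((f ^^ n) w) \<le> d u w" if "d e u \<le> q ^ k" "d e w \<le> q ^ k" for u w
  proof -
    have "d ((f ^^ n) u) ((f ^^ n) w) \<le> q ^ k' / q ^ k * d u w" using lp that unfolding lip_def by blast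
    also have "\<dots> \<le> 1 * d u w" using kk by (intro mult_right_mono d_nonneg) simp
    finally show ?thesis by simp
  qed
  have "\<forall>u w. d e u \<le> q ^ k \<longrightarrow> d e w \<le> q ^ k \<longrightarrow> d ((f ^^ j) u) ((f ^^ j) w) \<le> \<bar>L\<bar> * d u w" for j
  proof (induction j rule: less_induct)
    case (less j)
    show ?case
    proof (intro allI impI)
      fix u w assume uw: "d e u \<le> q ^ k" "d e w \<le> q ^ k"
      show "d ((f ^^ j) u) ((f ^^ j) w) \<le> \<bar>L\<bar> * d u w"
      proof (cases "j \<le> n")
        case True
        have "L * d u w \<le> \<bar>L\<bar> * d u w" by (intro mult_right_mono d_nonneg) simp
        then show ?thesis using L[OF True uw] by linarith
      next
        case False
        then have j: "j = (j - n) + n" "j - n < j" using n by auto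
        have "d ((f ^^ (j - n)) ((f ^^ n) u)) ((f ^^ (j - n)) ((f ^^ n) w)) \<le> \<bar>L\<bar> * d ((f ^^ n) u) ((f ^^ n) w)"
          using less[OF j(2)] maps uw by blast
        also have "\<dots> \<le> \<bar>L\<bar> * d u w" using one[OF uw] by (intro mult_left_mono) auto
        finally show ?thesis using j(1) iter_add by metis
      qed
    qed
  qed
  then show False using J_not_lipschitz[OF e q_power_pos[of k]] by blast
qed

end

text \<open>\<open>C0\<close> is to be the set of all members of \<open>C\<close> in the orbit
  closure of a recurrent one. Accordingly \<open>hit\<close> says that below the scale
  \<open>\<zeta>\<close> an event along the orbit of a member can only be caused by a
  member.\<close>

locale minimal_class_dynamics = critical_dynamics +
  fixes C0 :: "'a set" and \<zeta> :: real and K0 :: nat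
  assumes C0_sub: "e \<in> C0 \<Longrightarrow> e \<in> C" and C0_tame: "e \<in> C0 \<Longrightarrow> \<mu> e = 1"
    and card_C0: "card C0 \<le> 2"
    and zeta_pos: "0 < \<zeta>" and zeta_le: "\<zeta> \<le> \<eta>" and zeta_le1: "\<zeta> \<le> 1"
    and hit: "e \<in> C0 \<Longrightarrow> c \<in> C \<Longrightarrow> d ((f ^^ n) e) b \<le> h \<Longrightarrow> h \<le> \<zeta> \<Longrightarrow> \<mu> c * d c b \<le> h \<Longrightarrow> c \<in> C0"
    and small: "e \<in> C0 \<Longrightarrow> e \<in> FK \<Longrightarrow> k \<ge> K0 \<Longrightarrow> small_on e (q ^ k) (q * \<zeta>)"
    and unif: "e \<in> C0 \<Longrightarrow> e \<in> FK \<Longrightarrow> uniform_on e (q ^ K0)"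
    and K0_delta: "q ^ K0 \<le> \<delta>"
begin

section \<open>Passages from one member of the class to another\<close>

definition E :: "'a set" where "E = C0 \<inter> FK"

lemma E_C: "e \<in> E \<Longrightarrow> e \<in> C" and E_C0: "e \<in> E \<Longrightarrow> e \<in> C0" and E_J: "e \<in> E \<Longrightarrow> e \<in> J"
  and E_Z: "e \<in> E \<Longrightarrow> e \<in> Z" and E_FK: "e \<in> E \<Longrightarrow> e \<in> FK" and E_tame: "e \<in> E \<Longrightarrow> \<mu> e = 1"
  using C0_sub C0_tame C_J C_Z unfolding E_def by auto

lemma disc_sub: "d e y = q ^ k \<Longrightarrow> d y u \<le> q ^ Suc k \<Longrightarrow> d e u \<le> q ^ k"
  using d_le[of e y "q ^ k" u] q_Suc_le[of k] by linarith

text \<open>The disc of radius \<open>q ^ k\<close> about \<open>e\<close> is mapped into the disc of radius \<open>q ^ k'\<close> about \<open>e'\<close>, and the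
  smaller disc about the point \<open>y\<close> of its boundary sphere is mapped onto a neighbourhood of \<open>e'\<close>.\<close>

definition visit :: "'a \<Rightarrow> nat \<Rightarrow> 'a \<Rightarrow> nat \<Rightarrow> 'a \<Rightarrow> nat \<Rightarrow> bool" where
  "visit e k y n e' k' \<longleftrightarrow> e \<in> E \<and> e' \<in> E \<and> y \<in> Z \<and> d e y = q ^ k \<and>
     good n y (q ^ k) (q ^ Suc k) (q ^ k') (q ^ Suc k') \<and> d ((f ^^ n) y) e' \<le> q ^ Suc k'"

lemma sphere_small:
  assumes e: "e \<in> E" and sm: "small_on e (q ^ k) \<epsilon>" and y: "d e y = q ^ k"
  shows "small_on y (q ^ Suc k) \<epsilon>"
  using sm disc_sub[OF y] unfolding small_on_def by blast

lemma lift_E: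
  assumes e: "e \<in> E" and k: "k \<ge> K0" and y: "d e y = q ^ k" and c: "c \<in> C0"
    and l: "lifts n y (q ^ Suc k) c r L" and pos: "0 < r" "0 < L"
  shows "c \<in> E"
proof -
  have "q ^ k \<le> q ^ K0" using k q_power_le_iff by blast
  moreover have "q ^ Suc k \<le> q ^ k" by (rule q_Suc_le)
  ultimately have "d e y \<le> q ^ K0" "q ^ Suc k \<le> q ^ K0" using y by linarith+
  then have "c \<in> FK"
    using lifts_FK[OF unif[OF E_C0[OF e] E_FK[OF e]] _ _ l C_Z[OF C0_sub[OF c]] pos] by blast
  then show ?thesis using c by (simp add: E_def)
qed

text \<open>The run starts with radii in the ratio \<open>q\<close>, the large disc containing
  \<open>e\<close>. The ratio persists, and by \<open>hit\<close> the event is caused by a member of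
  the class, which turns out to lie in the small disc.\<close>

lemma visit_exists:
  assumes e: "e \<in> E" and k: "k \<ge> K0" and y: "y \<in> Z" "d e y = q ^ k"
  shows "\<exists>n e' k'. visit e k y n e' k'"
proof -
  have sm: "small_on y (q ^ Suc k) (q * \<zeta>)"
    using sphere_small[OF e small[OF E_C0[OF e] E_FK[OF e] k] y(2)] .
  have bd: "\<beta>' = q * h' \<and> h' \<le> \<zeta>" if g: "good n y (q ^ k) (q ^ Suc k) h' \<beta>'" for n h' \<beta>'
  proof -
    have "\<beta>' * q ^ k = q * h' * q ^ k" using g unfolding good_def by (simp add: mult_ac)
    then have "\<beta>' = q * h'" by simp
    moreover have "\<beta>' \<le> q * \<zeta>" using homothety_small[OF _ y(1) sm] g unfolding good_def by blast
    ultimately show ?thesis using q_pos by simp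
  qed
  have "\<exists>n h' \<beta>'. good n y (q ^ k) (q ^ Suc k) h' \<beta>' \<and> event ((f ^^ n) y) h' \<beta>'"
  proof (rule run_until_event[OF E_J[OF e] E_Z[OF e] y(1)])
    show "h' \<le> \<eta>" if "good n y (q ^ k) (q ^ Suc k) h' \<beta>'" for n h' \<beta>'
      using bd[OF that] zeta_le by linarith
  qed (use y q_Suc_le in \<open>simp_all del: power_Suc\<close>)
  then obtain n h' \<beta>' where g: "good n y (q ^ k) (q ^ Suc k) h' \<beta>'" and ev: "event ((f ^^ n) y) h' \<beta>'" by blast
  have lp: "lip n y (q ^ k) h'" and hm: "homothety n y (q ^ Suc k) \<beta>'" using g unfolding good_def by auto
  have h': "0 < h'" using lp unfolding lip_def by blast
  obtain j where j: "\<beta>' = q ^ j" using homothety_value[OF hm y(1)] by blast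
  \<comment> \<open>The small radius is below 1, so its exponent is a successor and the large radius
    is a power of \<open>q\<close> with natural exponent as well.\<close>
  have "q ^ j \<le> q * \<zeta>" using bd[OF g] j q_pos by simp
  also have "\<dots> \<le> q * 1" using zeta_le1 q_pos by (intro mult_left_mono) auto
  finally have "q ^ j < q ^ 0" using q_less by simp
  then have "0 < j" using q_power_less_iff by blast
  then obtain k' where k': "j = Suc k'" using gr0_conv_Suc by blast
  have h'k: "h' = q ^ k'" using bd[OF g] j k' by simp
  let ?b = "(f ^^ n) y"
  obtain c where c: "c \<in> C" "\<mu> c * d c ?b \<le> h'" "\<not> (\<mu> c = 1 \<and> d c ?b = h' \<and> \<beta>' < h')"
    using ev unfolding event_def by blast
  have "d ((f ^^ n) e) ?b \<le> h'" using lip_image[OF lp, of e] y d_sym by simp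
  then have c0: "c \<in> C0" using hit[OF E_C0[OF e] c(1) _ _ c(2)] bd[OF g] by blast
  \<comment> \<open>\<open>c\<close> is tame and \<open>\<beta>' < h'\<close>, so a tie would be no
    event. By discreteness of the distances in \<open>Z\<close>, \<open>c\<close> then lies in the
    small disc.\<close>
  then have "d c ?b \<le> h'" "d c ?b \<noteq> h'"
    using c(2,3) C0_tame bd[OF g] h' q_less by auto
  then have "d c ?b < q ^ k'" using h'k by simp
  then have cb: "d c ?b \<le> q ^ Suc k'" using Z_gap C_Z[OF c(1)] iter_Z[OF y(1)] by blast
  then have cb': "d ?b c \<le> q ^ Suc k'" using d_sym by simp
  have "lifts n y (q ^ Suc k) c (q ^ Suc k') (q ^ Suc k / q ^ Suc k')"
    by (rule homothety_lifts[OF hm[unfolded j k'] q_power_pos cb'])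
  then have "c \<in> E" using lift_E[OF e k y(2) c0 _ q_power_pos] q_power_pos divide_pos_pos by blast
  then have "visit e k y n c k'" unfolding visit_def using e y g cb' h'k j k' by simp
  then show ?thesis by blast
qed

lemma visit_lifts:
  assumes "visit e k y n e' k'" shows "lifts n y (q ^ Suc k) e' (q ^ Suc k') (q ^ Suc k / q ^ Suc k')"
  using assms homothety_lifts[OF _ q_power_pos] unfolding visit_def good_def by blast

lemma visit_reaches: assumes "visit e k y n e' k'" shows "reaches n e k e' k'"
proof -
  have c: "lip n y (q ^ k) (q ^ k')" "d e y = q ^ k" "d ((f ^^ n) y) e' \<le> q ^ Suc k'"
    using assms unfolding visit_def good_def by auto
  have l: "lip n e (q ^ k) (q ^ k')" using lip_recenter[OF c(1)] c(2) d_sym by simp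
  have "d ((f ^^ n) e) ((f ^^ n) y) \<le> q ^ k'" using lip_image[OF l] c by simp
  moreover have "d ((f ^^ n) y) e' \<le> q ^ k'" using c(3) q_Suc_le[of k'] by linarith
  ultimately show ?thesis using l d_le unfolding reaches_def by blast
qed

text \<open>For \<open>n = 0\<close> the scales would agree and \<open>e'\<close> would lie on the
  sphere of radius \<open>q ^ k\<close> about \<open>e\<close>, closer than the separation
  \<open>\<delta>\<close> of distinct critical points.\<close>

lemma visit_pos: assumes c: "visit e k y n e' k'" and k: "k \<ge> K0" shows "1 \<le> n"
proof (rule ccontr)
  assume "\<not> 1 \<le> n"
  then have n: "n = 0" by simp
  have cc: "homothety 0 y (q ^ Suc k) (q ^ Suc k')" "d e y = q ^ k" "d y e' \<le> q ^ Suc k'" "y \<in> Z" "e \<in> E" "e' \<in> E"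
    using c unfolding visit_def good_def n by auto
  obtain v where v: "v \<in> Z" "d y v = q ^ Suc k" using Z_sphere[OF cc(4)] by blast
  have "d y v = q ^ Suc k' / q ^ Suc k * d y v" using cc(1) v unfolding homothety_def
    by (metis d_self funpow_0 order_refl q_power_pos less_imp_le)
  then have "q ^ Suc k = q ^ Suc k'" using v by simp
  then have "d y e' < d e y" using cc(2,3) q_power_less_iff[of "Suc k" k] by linarith
  then have "d e' e = d e y" using d_isosceles[of e' y e] d_sym by metis
  then have e: "d e e' = q ^ k" using cc(2) d_sym by simp
  then have "e \<noteq> e'" by auto
  then have "\<delta> < d e e'" using sep E_C cc by blast
  moreover have "q ^ k \<le> q ^ K0" using k q_power_le_iff by blast
  ultimately show False using e K0_delta by linarith
qed

text \<open>Since \<open>k2 < k\<close>, the target disc contains the whole disc of radius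
  \<open>q ^ k\<close> about \<open>e\<close>, so the inverse branch acts on the points of
  \<open>Z\<close> in that disc and \<open>no_repeller\<close> applies.\<close>

lemma self_lift:
  assumes e: "e \<in> E" and k: "k \<ge> K0" and y: "y \<in> Z" "d e y = q ^ k"
    and l: "lifts n y (q ^ Suc k) e (q ^ Suc k2) L" and k2: "k2 < k" and L: "0 \<le> L" "L < 1"
  shows False
proof (rule no_repeller[OF unif[OF E_C0[OF e] E_FK[OF e]], of "{w \<in> Z. d e w \<le> q ^ k}" e y n L])
  show "w \<in> Z \<and> d e w \<le> q ^ K0" if "w \<in> {w \<in> Z. d e w \<le> q ^ k}" for w
    using that q_power_le_iff[of k K0] k by auto
  show "e \<in> {w \<in> Z. d e w \<le> q ^ k}" "y \<in> {w \<in> Z. d e w \<le> q ^ k}" using E_Z[OF e] y by auto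
  show "e \<noteq> y" using y by auto
  show "\<exists>u'\<in>{w \<in> Z. d e w \<le> q ^ k}. \<exists>v'\<in>{w \<in> Z. d e w \<le> q ^ k}. (f ^^ n) u' = u \<and> (f ^^ n) v' = v \<and> d u' v' \<le> L * d u v"
    if uv: "u \<in> {w \<in> Z. d e w \<le> q ^ k}" "v \<in> {w \<in> Z. d e w \<le> q ^ k}" for u v
  proof -
    have "q ^ k \<le> q ^ Suc k2" using k2 q_power_le_iff Suc_le_eq by blast
    then have "d e u \<le> q ^ Suc k2" "d e v \<le> q ^ Suc k2" using uv by auto
    then obtain u' v' where "u' \<in> Z" "v' \<in> Z" "d y u' \<le> q ^ Suc k" "d y v' \<le> q ^ Suc k" "(f ^^ n) u' = u" "(f ^^ n) v' = v"
      "d u' v' \<le> L * d u v" using liftsD[OF l, of u v] uv by blast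
    then show ?thesis using disc_sub[OF y(2)] by blast
  qed
qed (use L in auto)

text \<open>For \<open>k \<le> k'\<close> the disc about \<open>e\<close> would be mapped into
  itself without expansion, against \<open>J\<close>; for \<open>k' < k\<close> the return would be
  repelling on \<open>Z\<close>, against \<open>FK\<close>. The next two lemmas apply the same
  dichotomy to round trips.\<close>

lemma visit_not_self: assumes c: "visit e k y n e k'" and k: "k \<ge> K0" shows False
proof -
  have e: "e \<in> E" "y \<in> Z" "d e y = q ^ k" using c unfolding visit_def by auto
  have lt: "k' < k" using reaches_self[OF E_J[OF e(1)] visit_reaches[OF c] _ visit_pos[OF c k]] by (meson not_less)
  have "q ^ Suc k < q ^ Suc k'" using lt q_power_less_iff[of "Suc k" "Suc k'"] by blast
  then have "q ^ Suc k / q ^ Suc k' < 1" by (rule divide_less_eq_1_pos[OF q_power_pos, THEN iffD2])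
  then show False using self_lift[OF e(1) k e(2,3) visit_lifts[OF c] lt] by simp
qed

text \<open>The second passage starts inside the disc that the first one covers, so the inverse
  branches compose; \<open>k2 < k\<close> would make the round trip repelling.\<close>

lemma visit_up:
  assumes c: "visit e k y n e' j" and c': "visit e' l y' n' e k2" and lj: "j < l" and k: "k \<ge> K0"
  shows "k \<le> k2"
proof (rule ccontr)
  assume "\<not> k \<le> k2"
  then have lt: "k2 < k" by simp
  have e: "e \<in> E" "y \<in> Z" "d e y = q ^ k" using c unfolding visit_def by auto
  have y': "d e' y' = q ^ l" using c' unfolding visit_def by auto
  have "q ^ l \<le> q ^ Suc j" using lj q_power_le_iff Suc_le_eq by blast
  moreover have "q ^ Suc l \<le> q ^ l" by (rule q_Suc_le)
  ultimately have "lifts n' e' (q ^ Suc j) e (q ^ Suc k2) (q ^ Suc l / q ^ Suc k2)"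
    using y' d_sym[of y' e'] by (intro lifts_mono[OF visit_lifts[OF c']]) (simp_all del: power_Suc)
  then have L: "lifts (n' + n) y (q ^ Suc k) e (q ^ Suc k2) (q ^ Suc k / q ^ Suc j * (q ^ Suc l / q ^ Suc k2))"
    by (rule lifts_comp[OF visit_lifts[OF c]]) simp
  have "q ^ (k + l) < q ^ (j + k2)" using lt lj q_power_less_iff by simp
  then have "q ^ Suc k / q ^ Suc j * (q ^ Suc l / q ^ Suc k2) < 1"
    by (simp add: field_simps power_add del: power_Suc) (simp add: mult_ac q_pos)
  then show False using self_lift[OF e(1) k e(2,3) L lt] by simp
qed

text \<open>The first passage ends inside the disc from which the second one starts, so the upper
  bounds compose; \<open>k \<le> k2\<close> would give a non-expanding return.\<close>

lemma visit_down:
  assumes c: "visit e k y n e' j" and c': "visit e' l y' n' e k2" and lj: "l \<le> j" and k: "k \<ge> K0"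
  shows "k2 < k"
proof (rule ccontr)
  assume "\<not> k2 < k"
  have "e \<in> E" using c unfolding visit_def by auto
  then show False using reaches_self[OF E_J reaches_comp[OF visit_reaches[OF c] visit_reaches[OF c'] lj]] visit_pos[OF c k] \<open>\<not> k2 < k\<close> by simp
qed

end

text \<open>The thresholds keep consecutive passages in range: a start at exponent \<open>K1\<close>
  or more leads to an arrival at \<open>K0\<close> or more, and a start at \<open>K2\<close> or more
  to an arrival at \<open>K1\<close> or more.\<close>

locale two_critical_points = minimal_class_dynamics +
  fixes K1 K2 :: nat
  assumes E_ne: "E \<noteq> {}"
    and K01: "K0 \<le> K1" and K12: "K1 \<le> K2"
    and small1: "e \<in> E \<Longrightarrow> k \<ge> K1 \<Longrightarrow> small_on e (q ^ k) (q ^ Suc K0)"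
    and small2: "e \<in> E \<Longrightarrow> k \<ge> K2 \<Longrightarrow> small_on e (q ^ k) (q ^ Suc K1)"
begin

text \<open>A passage from \<open>e\<close> ends at a member other than \<open>e\<close>, so a class
  with one member is already contradictory, and in a class with at most two members the target is
  determined.\<close>

lemma E_other: assumes e: "e \<in> E" shows "\<exists>e'\<in>E. e' \<noteq> e \<and> C0 = {e, e'}"
proof -
  obtain y where "y \<in> Z" "d e y = q ^ K0" using Z_sphere[OF E_Z[OF e]] by blast
  then obtain n e' k' where c: "visit e K0 y n e' k'" using visit_exists[OF e] by blast
  have ne: "e' \<noteq> e" using visit_not_self c by blast
  have e': "e' \<in> E" using c unfolding visit_def by blast
  have "finite C0" by (rule finite_subset[OF subsetI[OF C0_sub] finite_C])
  moreover have "card C0 \<le> card {e, e'}" using ne card_C0 by simp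
  moreover have "{e, e'} \<subseteq> C0" using e e' E_C0 by blast
  ultimately have "{e, e'} = C0" by (intro card_seteq)
  then show ?thesis using ne e' by blast
qed

section \<open>The scale of arrival as a function of the scale of departure\<close>

definition other :: "'a \<Rightarrow> 'a" where "other e = (SOME e'. e' \<in> E \<and> e' \<noteq> e \<and> C0 = {e, e'})"

lemma other: assumes "e \<in> E" shows "other e \<in> E" "other e \<noteq> e" "C0 = {e, other e}"
  using someI_ex[of "\<lambda>e'. e' \<in> E \<and> e' \<noteq> e \<and> C0 = {e, e'}"] E_other[OF assms] unfolding other_def by blast+

lemma other_eq: "e \<in> E \<Longrightarrow> e' \<in> C0 \<Longrightarrow> e' \<noteq> e \<Longrightarrow> e' = other e"
  using other(3)[of e] by blast

lemma other_other: "e \<in> E \<Longrightarrow> other (other e) = e"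
  using other_eq[OF other(1), of e e] other(2)[of e] E_C0[of e] by simp

lemma E_cases: "e \<in> E \<Longrightarrow> e' \<in> E \<Longrightarrow> e' = e \<or> e' = other e"
  using other_eq E_C0 by blast

lemma visit_ex: assumes "e \<in> E" "k \<ge> K0" "y \<in> Z" "d e y = q ^ k" shows "\<exists>n j. visit e k y n (other e) j"
proof -
  obtain n e' j where c: "visit e k y n e' j" using visit_exists[OF assms] by blast
  have "e' \<in> E" "e' \<noteq> e" using c visit_not_self assms(2) unfolding visit_def by blast+
  then show ?thesis using c other_eq[OF assms(1)] E_C0 by blast
qed

lemma visit_E: "visit e k y n e' j \<Longrightarrow> e \<in> E \<and> e' \<in> E \<and> y \<in> Z"
  unfolding visit_def by blast

lemma visit_small: assumes c: "visit e k y n e' j" and s: "small_on e (q ^ k) (q ^ Suc M)" shows "M \<le> j"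
proof -
  have a: "e \<in> E" "y \<in> Z" "d e y = q ^ k" "homothety n y (q ^ Suc k) (q ^ Suc j)" using c unfolding visit_def good_def by auto
  have "q ^ Suc j \<le> q ^ Suc M" using homothety_small[OF a(4,2) sphere_small[OF a(1) s a(3)]] .
  then show ?thesis using q_power_le_iff by blast
qed

lemma visit_K0: "visit e k y n e' j \<Longrightarrow> k \<ge> K1 \<Longrightarrow> j \<ge> K0"
  using visit_small small1 visit_E by blast

text \<open>If \<open>j < j'\<close>, a return from the sphere of radius \<open>q ^ j'\<close> is
  governed by \<open>visit_up\<close> with respect to the first passage and by
  \<open>visit_down\<close> with respect to the second; the two conclusions are
  incompatible.\<close>

lemma visit_unique_less: assumes c: "visit e k y n (other e) j" and c': "visit e k y' n' (other e) j'" and k: "k \<ge> K1"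
  shows "j' \<le> j"
proof (rule ccontr)
  assume lt: "\<not> j' \<le> j"
  have k0: "k \<ge> K0" using k K01 by simp
  have e: "e \<in> E" "other e \<in> E" using c visit_E by blast+
  obtain z where z: "z \<in> Z" "d (other e) z = q ^ j'" using Z_sphere[OF E_Z[OF e(2)]] by blast
  obtain n2 k2 where "visit (other e) j' z n2 e k2" using visit_ex[OF e(2) visit_K0[OF c' k] z] other_other[OF e(1)] by auto
  then have "k \<le> k2" "k2 < k" using visit_up[OF c _ _ k0] visit_down[OF c' _ _ k0] lt by auto
  then show False by simp
qed

text \<open>By \<open>visit_up\<close> and \<open>visit_down\<close> the scale of arrival depends neither on \<open>y\<close> nor on \<open>n\<close>.\<close>

definition H :: "'a \<Rightarrow> nat \<Rightarrow> nat" where "H e k = (SOME j. \<exists>y n. visit e k y n (other e) j)"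

lemma H_eq: assumes c: "visit e k y n (other e) j" and k: "k \<ge> K1" shows "H e k = j"
proof -
  obtain y' n' where "visit e k y' n' (other e) (H e k)"
    using someI[of "\<lambda>j. \<exists>y n. visit e k y n (other e) j"] c unfolding H_def by blast
  then show ?thesis using visit_unique_less[OF c _ k] visit_unique_less[OF _ c k] by (meson order_antisym)
qed

lemma H_visit: assumes "e \<in> E" "k \<ge> K1" "y \<in> Z" "d e y = q ^ k" obtains n where "visit e k y n (other e) (H e k)"
  using visit_ex[of e k y] H_eq assms K01 by (metis order_trans)

lemma H_ex: assumes e: "e \<in> E" "k \<ge> K1" obtains y n where "visit e k y n (other e) (H e k)"
  using Z_sphere[OF E_Z[OF e(1)], of k] H_visit[OF e] by metis

lemma H_ge: "e \<in> E \<Longrightarrow> k \<ge> K1 \<Longrightarrow> H e k \<ge> K0"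
  using H_ex visit_K0 by metis

lemma H_ge2: assumes "e \<in> E" "k \<ge> K2" shows "H e k \<ge> K1"
proof -
  obtain y n where "visit e k y n (other e) (H e k)" using H_ex[of e k] assms K12 by (metis order_trans)
  then show ?thesis using visit_small small2 assms by blast
qed

text \<open>Together with \<open>H_down\<close>: a passage back from exponent \<open>l\<close>
  arrives at \<open>k\<close> or more exactly if \<open>H e k < l\<close>. So the two arrival
  functions are almost inverse to each other.\<close>

lemma H_up: assumes e: "e \<in> E" and k: "k \<ge> K1" and c: "visit (other e) l z n e k2" and l: "H e k < l" shows "k \<le> k2"
proof -
  obtain y n' where "visit e k y n' (other e) (H e k)" using H_ex[OF e k] by blast
  then show ?thesis using visit_up[OF _ c l] k K01 by simp
qed

lemma H_down: assumes e: "e \<in> E" and k: "k \<ge> K1" and c: "visit (other e) l z n e k2" and l: "l \<le> H e k" shows "k2 < k"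
proof -
  obtain y n' where "visit e k y n' (other e) (H e k)" using H_ex[OF e k] by blast
  then show ?thesis using visit_down[OF _ c l] k K01 by simp
qed

lemma other_visit: assumes "e \<in> E" "l \<ge> K0" obtains z n k2 where "visit (other e) l z n e k2"
proof -
  obtain z where "z \<in> Z" "d (other e) z = q ^ l" using Z_sphere[OF E_Z[OF other(1)[OF assms(1)]]] by blast
  then show ?thesis using visit_ex[OF other(1)[OF assms(1)] assms(2)] other_other[OF assms(1)] that by metis
qed

text \<open>If \<open>H e k\<close> exceeded \<open>H e k'\<close>, a return from exponent
  \<open>H e k\<close> would have to arrive below \<open>k\<close> and at \<open>k'\<close> or
  more.\<close>

lemma H_mono: assumes e: "e \<in> E" and k: "K1 \<le> k" "k \<le> k'" shows "H e k \<le> H e k'"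
proof (rule ccontr)
  assume "\<not> H e k \<le> H e k'"
  moreover obtain z n k2 where c: "visit (other e) (H e k) z n e k2" using other_visit[OF e H_ge[OF e k(1)]] by blast
  ultimately have "k2 < k" "k' \<le> k2" using H_down[OF e k(1) c] H_up[OF e _ c] k by auto
  then show False using k by simp
qed

text \<open>After the first step the iterate is a similarity on the image of the disc, so that a single \<open>n\<close> serves
  all points of the sphere.\<close>

definition direct :: "'a \<Rightarrow> nat \<Rightarrow> nat \<Rightarrow> nat \<Rightarrow> bool" where
  "direct e k n j \<longleftrightarrow> (\<forall>u w. d e u \<le> q ^ k \<longrightarrow> d e w \<le> q ^ k \<longrightarrow>
        d ((f ^^ n) u) ((f ^^ n) w) = q ^ j / (A e * (q ^ k) ^ m e) * d (f u) (f w)) \<and>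
     (\<forall>y\<in>Z. d e y = q ^ k \<longrightarrow> good n y (q ^ k) (q ^ Suc k) (q ^ j) (q ^ Suc j)) \<and> lip n e (q ^ k) (q ^ j)"

text \<open>The run starts at \<open>f e\<close> with both radii equal to the image radius
  \<open>h1\<close>. With equal radii a critical point on the boundary is an event too; hence
  \<open>e'\<close> is only known to be within \<open>q ^ j\<close>, possibly at exactly this
  distance, and it may still be \<open>e\<close> itself.\<close>

lemma first_visit:
  assumes e: "e \<in> E" and k: "k \<ge> K2"
  shows "\<exists>n j e'. direct e k n j \<and> 1 \<le> n \<and> K1 \<le> j \<and> e' \<in> C0 \<and> d ((f ^^ n) e) e' \<le> q ^ j"
proof -
  define h1 where "h1 = A e * (q ^ k) ^ m e"
  have eC: "e \<in> C" using E_C[OF e] .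
  have h1: "0 < h1" using A_pos[OF eC] by (simp add: h1_def)
  have k0: "k \<ge> K0" using k K01 K12 by simp
  have kd: "q ^ k \<le> \<delta>" using k0 q_power_le_iff[of k K0] K0_delta by linarith
  have fe: "f e \<in> J" "f e \<in> Z" using J_forward E_J f_Z E_Z e by auto
  have sph: "d (f e) (f y) = h1" if "d e y = q ^ k" for y
    using critD1[OF eC, of y] that kd by (simp add: h1_def)
  obtain y0 where y0: "y0 \<in> Z" "d e y0 = q ^ k" using Z_sphere[OF E_Z[OF e]] by blast
  \<comment> \<open>The common radius is the distance between two orbit points in \<open>Z\<close>;
    so it is a power of \<open>q\<close> and is bounded by equicontinuity.\<close>
  have val: "\<beta>' = h' \<and> h' = d ((f ^^ Suc n) e) ((f ^^ Suc n) y0)" if g: "good n (f e) h1 h1 h' \<beta>'" for n h' \<beta>'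
  proof -
    have "\<beta>' = h'" using g h1 unfolding good_def by simp
    moreover have "d ((f ^^ n) (f e)) ((f ^^ n) (f y0)) = \<beta>' / h1 * d (f e) (f y0)"
      using g sph[OF y0(2)] h1 unfolding good_def homothety_def by (metis d_self less_imp_le order_refl)
    ultimately show ?thesis using sph[OF y0(2)] h1 unfolding iter_Suc by simp
  qed
  have sm: "d ((f ^^ n) e) ((f ^^ n) y0) \<le> \<epsilon>" if "small_on e (q ^ k) \<epsilon>" for n \<epsilon>
    using that y0 E_Z[OF e] unfolding small_on_def by simp
  have z1: "q * \<zeta> \<le> \<zeta>" using q_less zeta_pos by simp
  have bd: "h' \<le> \<zeta>" if g: "good n (f e) h1 h1 h' \<beta>'" for n h' \<beta>'
    using val[OF g] sm[OF small[OF E_C0[OF e] E_FK[OF e] k0]] z1 by (metis order_trans)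
  have "\<exists>n h' \<beta>'. good n (f e) h1 h1 h' \<beta>' \<and> event ((f ^^ n) (f e)) h' \<beta>'"
  proof (rule run_until_event[OF fe fe(2)])
    show "h' \<le> \<eta>" if "good n (f e) h1 h1 h' \<beta>'" for n h' \<beta>' using bd[OF that] zeta_le by linarith
  qed (use h1 in auto)
  then obtain n h' \<beta>' where g: "good n (f e) h1 h1 h' \<beta>'" and ev: "event ((f ^^ n) (f e)) h' \<beta>'" by blast
  have \<beta>': "\<beta>' = h'" and h'v: "h' = d ((f ^^ Suc n) e) ((f ^^ Suc n) y0)" using val[OF g] by auto
  have h': "0 < h'" using g unfolding good_def lip_def by blast
  then have "(f ^^ Suc n) e \<noteq> (f ^^ Suc n) y0" using h'v d_self by (metis less_irrefl)
  then obtain j where j: "h' = q ^ j" using Z_val[OF iter_Z[OF E_Z[OF e]] iter_Z[OF y0(1)]] h'v by metis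
  have "q ^ j \<le> q ^ Suc K1" using sm[OF small2[OF e k]] h'v j by metis
  then have K1j: "K1 \<le> j" using q_power_le_iff Suc_le_D by (metis Suc_leD)
  obtain c where c: "c \<in> C" "\<mu> c * d c ((f ^^ Suc n) e) \<le> h'" "\<not> (\<mu> c = 1 \<and> d c ((f ^^ Suc n) e) = h' \<and> \<beta>' < h')"
    using ev unfolding event_def iter_Suc by blast
  have "d ((f ^^ Suc n) e) ((f ^^ Suc n) e) \<le> h'" using h' by simp
  then have c0: "c \<in> C0" by (rule hit[OF E_C0[OF e] c(1) _ bd[OF g] c(2)])
  then have near: "d ((f ^^ Suc n) e) c \<le> q ^ j" using c(2) C0_tame d_sym j by simp
  have lp: "lip n (f e) h1 h'" and hm: "homothety n (f e) h1 h'" using g \<beta>' unfolding good_def by auto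
  have lip1: "lip 1 b (q ^ k) h1" if "d e b \<le> q ^ k" for b
    using crit_lip[OF eC that kd] by (simp add: h1_def)
  have img: "d (f e) (f u) \<le> h1" if "d e u \<le> q ^ k" for u
    using lip_image[OF lip1[of e] _ that] by simp
  have "lip (n + 1) e (q ^ k) h'" using lip_comp[OF _ lip1[of e], of n h'] lp by simp
  then have LL: "lip (Suc n) e (q ^ k) (q ^ j)" using j by simp
  have good: "good (Suc n) y (q ^ k) (q ^ Suc k) (q ^ j) (q ^ Suc j)" if y: "y \<in> Z" "d e y = q ^ k" for y
  proof -
    have h1m: "h1 = A e * (q ^ k) ^ (m e - 1) * q ^ k" unfolding h1_def using m_ge[OF eC] by (cases "m e") auto
    have lt: "q ^ Suc k < q ^ k" using q_power_less_iff by blast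
    have "homothety 1 y (q ^ Suc k) (\<mu> e * A e * d e y ^ (m e - 1) * q ^ Suc k)"
      by (rule crit_homothety[OF eC]) (use y kd lt E_tame[OF e] in \<open>simp_all del: power_Suc\<close>)
    then have h1y: "homothety 1 y (q ^ Suc k) (q * h1)" using E_tame[OF e] y h1m by (simp add: mult_ac)
    have qh: "q * h1 \<le> h1" using q_less h1 by simp
    have fy: "d (f e) (f y) \<le> h1" using sph[OF y(2)] by simp
    have "homothety n (f y) (q * h1) (q * h1 * h' / h1)"
      by (rule homothety_mono[OF hm _ qh fy]) (use q_pos h1 in simp)
    then have h2y: "homothety n (f y) (q * h1) (q ^ Suc j)" using h1 j by simp
    have "homothety (n + 1) y (q ^ Suc k) (q ^ Suc j)"
      by (rule homothety_comp[OF q_power_pos h1y]) (use h2y in simp)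
    moreover have "lip (n + 1) y (q ^ k) h'"
      by (rule lip_comp[OF q_power_pos lip1]) (use y lip_recenter[OF lp h1 fy] in simp_all)
    ultimately show ?thesis unfolding good_def using j by simp
  qed
  have "d ((f ^^ Suc n) u) ((f ^^ Suc n) w) = q ^ j / (A e * (q ^ k) ^ m e) * d (f u) (f w)"
    if "d e u \<le> q ^ k" "d e w \<le> q ^ k" for u w
    using hm img that j unfolding homothety_def h1_def[symmetric] iter_Suc by blast
  then have "direct e k (Suc n) j" unfolding direct_def using good LL by blast
  then show ?thesis using K1j c0 near by (intro exI[of _ "Suc n"] exI[of _ j] exI[of _ c]) simp
qed

lemma direct_sphere:
  assumes e: "e \<in> E" and k: "k \<ge> K0" and dr: "direct e k n j" and u: "d e u \<le> q ^ k"
  shows "d ((f ^^ n) e) ((f ^^ n) u) = q ^ j * (d e u / q ^ k) ^ m e"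
proof -
  have eC: "e \<in> C" using E_C[OF e] .
  have "q ^ k \<le> q ^ K0" using k q_power_le_iff by blast
  then have "d e u \<le> \<delta>" using K0_delta u by linarith
  then have "d (f e) (f u) = A e * d e u ^ m e" using critD1[OF eC] by blast
  moreover have "d ((f ^^ n) e) ((f ^^ n) u) = q ^ j / (A e * (q ^ k) ^ m e) * d (f e) (f u)"
    using dr u unfolding direct_def by simp
  ultimately show ?thesis using A_pos[OF eC] by (simp add: power_divide)
qed

text \<open>The hypothesis \<open>top\<close>, a jump of \<open>H e\<close> at \<open>k\<close>,
  excludes \<open>e' = e\<close> in \<open>first_visit\<close>: such an arrival would be at some
  \<open>j < k\<close>, and continuing from there would give
  \<open>H e k = H e j \<le> H e (k - 1)\<close>.\<close>

lemma top_direct: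
  assumes e: "e \<in> E" and k: "k > K2" and top: "H e (k - 1) < H e k"
  obtains n where "direct e k n (H e k)" "1 \<le> n" "d ((f ^^ n) e) (other e) = q ^ H e k"
    "\<And>y. y \<in> Z \<Longrightarrow> d e y = q ^ k \<Longrightarrow> visit e k y n (other e) (H e k)"
proof -
  obtain n j e' where v: "direct e k n j" "1 \<le> n" "K1 \<le> j" "e' \<in> C0" "d ((f ^^ n) e) e' \<le> q ^ j"
    using first_visit[OF e, of k] k by auto
  have k0: "k \<ge> K0" and k1: "k \<ge> K1" using k K01 K12 by auto
  have jK0: "j \<ge> K0" using v(3) K01 by simp
  have sph: "d ((f ^^ n) e) ((f ^^ n) y) = q ^ j" if "d e y = q ^ k" for y
    using direct_sphere[OF e k0 v(1), of y] that by simp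
  have gd: "good n y (q ^ k) (q ^ Suc k) (q ^ j) (q ^ Suc j)" if "y \<in> Z" "d e y = q ^ k" for y
    using v(1) that unfolding direct_def by blast
  have dist: "d e' ((f ^^ n) y) \<le> q ^ j" if "d e y = q ^ k" for y
    using d_le'[OF v(5), of "(f ^^ n) y"] sph[OF that] by simp
  have covI: "visit e k y n e' j" if y: "y \<in> Z" "d e y = q ^ k" and ne: "d e' ((f ^^ n) y) \<noteq> q ^ j" and e': "e' \<in> E" for y
  proof -
    have "d e' ((f ^^ n) y) \<le> q ^ Suc j" using dist[OF y(2)] ne Z_gap[OF E_Z[OF e'] iter_Z[OF y(1)]] by force
    then show ?thesis unfolding visit_def using e e' y gd[OF y] d_sym by simp
  qed
  have trans: "visit e k y (n2 + n) e2 j2" if y: "y \<in> Z" "d e y = q ^ k" and c: "visit e'' j ((f ^^ n) y) n2 e2 j2" for y n2 e2 j2 e''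
    using good_comp[OF q_power_pos q_power_pos gd[OF y], of n2 "q ^ j2" "q ^ Suc j2"] c e y
    unfolding visit_def by (simp add: iter_add del: power_Suc)
  obtain y0 where y0: "y0 \<in> Z" "d e y0 = q ^ k" using Z_sphere[OF E_Z[OF e]] by blast
  have "e' \<noteq> e"
  proof
    assume eq: "e' = e"
    have r: "reaches n e k e j" using v(1,5) eq unfolding reaches_def direct_def by blast
    have jk: "j < k" using reaches_self[OF E_J[OF e] r _ v(2)] by (meson not_less)
    show False
    proof (cases "d e ((f ^^ n) y0) = q ^ j")
      case False
      then show False using covI[OF y0] eq e visit_not_self k0 by blast
    next
      case True
      obtain n2 where c: "visit e j ((f ^^ n) y0) n2 (other e) (H e j)"
        using H_visit[OF e v(3) iter_Z[OF y0(1)] True] by blast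
      have "H e k = H e j" using H_eq[OF trans[OF y0 c] k1] .
      moreover have "H e j \<le> H e (k - 1)" using H_mono[OF e v(3)] jk by simp
      ultimately show False using top by simp
    qed
  qed
  then have e': "e' = other e" using other_eq[OF e v(4)] by blast
  have e'E: "e' \<in> E" using e' other e by simp
  \<comment> \<open>A point arriving on the boundary sphere about \<open>other e\<close> could be
    continued to a visit of \<open>e\<close> itself, which is impossible. So every point of the
    sphere arrives strictly inside, with the same \<open>n\<close>.\<close>
  have all: "visit e k y n (other e) j" if y: "y \<in> Z" "d e y = q ^ k" for y
  proof (cases "d e' ((f ^^ n) y) = q ^ j")
    case False then show ?thesis using covI[OF y _ e'E] e' by blast
  next
    case True
    obtain n2 j2 where "visit e' j ((f ^^ n) y) n2 (other e') j2"
      using visit_ex[OF e'E jK0 iter_Z[OF y(1)] True] by blast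
    then have "visit e k y (n2 + n) e j2" using trans[OF y] e' other_other[OF e] by metis
    then show ?thesis using visit_not_self k0 by blast
  qed
  then have jH: "H e k = j" using H_eq k1 y0 by blast
  \<comment> \<open>The image of \<open>e\<close> is at distance \<open>q ^ j\<close> from the image
    of \<open>y0\<close>, which is closer than that to \<open>other e\<close>; by the isosceles
    property the image of \<open>e\<close> is at distance exactly \<open>q ^ j\<close> from
    \<open>other e\<close>.\<close>
  have "d e' ((f ^^ n) y0) < q ^ j"
    using all[OF y0] e' d_sym q_power_less_iff[of "Suc j" j] unfolding visit_def by (metis lessI le_less_trans)
  then have "d e' ((f ^^ n) y0) < d ((f ^^ n) y0) ((f ^^ n) e)" using sph[OF y0(2)] d_sym by metis
  then have "d e' ((f ^^ n) e) = q ^ j" using d_isosceles sph[OF y0(2)] d_sym by metis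
  then show ?thesis using that[of n] v(1,2) all jH e' d_sym by metis
qed

text \<open>The orbit of the centre \<open>e\<close> is followed: to \<open>x\<close> on the sphere
  of radius \<open>q ^ H e k\<close> about \<open>other e\<close>, back to \<open>x'\<close> on the
  sphere of radius \<open>q ^ k\<close> about \<open>e\<close>, and to \<open>other e\<close> again.
  As \<open>m e \<ge> 2\<close>, the disc of radius \<open>q ^ Suc k\<close> about \<open>e\<close>
  shrinks by an extra factor \<open>q\<close> at the first passage, so in the end it lies within
  \<open>q ^ Suc (H e k)\<close> of \<open>other e\<close>. Without growth of \<open>H e\<close> at
  \<open>Suc k\<close>, the way back would complete a non-expanding return.\<close>

lemma top_Suc:
  assumes e: "e \<in> E" and k: "k > K2" and top: "H e (k - 1) < H e k"
  shows "H e k < H e (Suc k)"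
proof -
  let ?j = "H e k"
  obtain n where dr: "direct e k n ?j" and n: "1 \<le> n" and a: "d ((f ^^ n) e) (other e) = q ^ ?j"
    and cv: "\<And>y. y \<in> Z \<Longrightarrow> d e y = q ^ k \<Longrightarrow> visit e k y n (other e) ?j"
    using top_direct[OF assms] by blast
  have k01: "k \<ge> K0" "k \<ge> K1" "k - 1 \<ge> K1" using k K01 K12 by auto
  have e': "other e \<in> E" using other e by blast
  define x where "x = (f ^^ n) e"
  have x: "x \<in> Z" using iter_Z E_Z[OF e] by (simp add: x_def)
  have jK1: "?j \<ge> K1" using H_ge2[OF e] k by simp
  then have jK0: "?j \<ge> K0" using K01 by simp
  obtain n' g where c: "visit (other e) ?j x n' e g"
    using visit_ex[OF e' jK0 x] a d_sym other_other[OF e] unfolding x_def by metis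
  have "g < k" using H_down[OF e k01(2) c] by simp
  moreover have "k - 1 \<le> g" using H_up[OF e k01(3) c top] .
  \<comment> \<open>The jump at \<open>k\<close> pins the scale of return down from both
    sides.\<close>
  ultimately have g: "Suc g = k" using k by simp
  define x' where "x' = (f ^^ n') x"
  have x': "x' \<in> Z" using iter_Z x by (simp add: x'_def)
  have hm: "homothety n' x (q ^ Suc ?j) (q ^ k)" and x'e: "d x' e \<le> q ^ k" and lp': "lip n' x (q ^ ?j) (q ^ g)"
    using c g unfolding visit_def good_def x'_def by auto
  have r1: "reaches n e (Suc k) x (Suc (Suc ?j))"
  proof -
    have lpk: "lip n e (q ^ k) (q ^ ?j)" using dr unfolding direct_def by blast
    have eC: "e \<in> C" using E_C[OF e] .
    have kd: "q ^ Suc k \<le> \<delta>"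
      using q_power_le_iff[of "Suc k" K0] k01(1) K0_delta by (meson le_SucI order_trans)
    have sub: "d e u \<le> q ^ k" if "d e u \<le> q ^ Suc k" for u using that q_Suc_le[of k] by linarith
    have "d ((f ^^ n) u) ((f ^^ n) w) \<le> q ^ Suc (Suc ?j) / q ^ Suc k * d u w"
      if uw: "d e u \<le> q ^ Suc k" "d e w \<le> q ^ Suc k" for u w
    proof -
      obtain m' where m': "m e = Suc (Suc m')" using m_ge[OF eC] nat_le_iff_add[of 2 "m e"] by auto
      have qk: "(q ^ Suc k) ^ Suc m' \<le> q * (q ^ k) ^ Suc m'"
      proof -
        have "(q ^ Suc k) ^ Suc m' = q ^ m' * (q * (q ^ k) ^ Suc m')" by (simp add: power_mult_distrib)
        also have "\<dots> \<le> 1 * (q * (q ^ k) ^ Suc m')"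
          using power_le_one[of q m'] q_less q_pos by (intro mult_right_mono) auto
        finally show ?thesis by simp
      qed
      have "d (f u) (f w) \<le> A e * max (d e u) (d e w) ^ (m e - 1) * d u w"
        using critD2[OF eC] uw kd by (meson order_trans)
      also have "\<dots> \<le> A e * (q ^ Suc k) ^ (m e - 1) * d u w"
        using uw A_pos[OF eC] d_nonneg by (intro mult_right_mono mult_left_mono power_mono) (auto simp: le_max_iff_disj)
      also have "\<dots> \<le> A e * (q * (q ^ k) ^ Suc m') * d u w"
        using qk A_pos[OF eC] d_nonneg by (intro mult_right_mono mult_left_mono) (auto simp: m')
      finally have 1: "d (f u) (f w) \<le> A e * (q * (q ^ k) ^ Suc m') * d u w" .
      have "d ((f ^^ n) u) ((f ^^ n) w) = q ^ ?j / (A e * (q ^ k) ^ m e) * d (f u) (f w)"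
        using dr sub[OF uw(1)] sub[OF uw(2)] unfolding direct_def by blast
      also have "\<dots> \<le> q ^ ?j / (A e * (q ^ k) ^ m e) * (A e * (q * (q ^ k) ^ Suc m') * d u w)"
        using 1 A_pos[OF eC] by (intro mult_left_mono) auto
      also have "\<dots> = q ^ Suc (Suc ?j) / q ^ Suc k * d u w"
        using A_pos[OF eC] by (simp add: m' field_simps)
      finally show ?thesis .
    qed
    moreover have "\<exists>L. \<forall>i\<le>n. \<forall>u w. d e u \<le> q ^ Suc k \<longrightarrow> d e w \<le> q ^ Suc k \<longrightarrow> d ((f ^^ i) u) ((f ^^ i) w) \<le> L * d u w"
      using lpk sub unfolding lip_def by blast
    ultimately show ?thesis unfolding reaches_def lip_def x_def using q_power_pos[of "Suc (Suc ?j)"]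
      by (simp del: power_Suc)
  qed
  have hl: "lip i b r r'" if h: "homothety i b r r'" and L: "lip i b r2 r3" and r: "r \<le> r2" for i b r r' r2 r3
  proof -
    have "d b u \<le> r2" if "d b u \<le> r" for u using that r by simp
    then have "\<exists>L. \<forall>i'\<le>i. \<forall>u w. d b u \<le> r \<longrightarrow> d b w \<le> r \<longrightarrow> d ((f ^^ i') u) ((f ^^ i') w) \<le> L * d u w"
      using L unfolding lip_def by blast
    then show ?thesis using h unfolding lip_def homothety_def by auto
  qed
  have l2: "lip n' x (q ^ Suc ?j) (q ^ k)" using hl[OF hm lp' q_Suc_le] .
  have r2: "reaches n' x (Suc (Suc ?j)) x' (Suc k)"
  proof -
    have "lip n' x (q ^ Suc (Suc ?j)) (q ^ Suc (Suc ?j) * q ^ k / q ^ Suc ?j)"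
      by (rule lip_mono[OF l2 q_power_pos q_Suc_le]) simp
    then show ?thesis unfolding reaches_def x'_def by simp
  qed
  have r12: "reaches (n' + n) e (Suc k) x' (Suc k)" by (rule reaches_comp[OF r1 r2]) simp
  \<comment> \<open>If \<open>x'\<close> were nearer to \<open>e\<close>, the disc of radius
    \<open>q ^ Suc k\<close> about \<open>e\<close> would be mapped into itself without
    expansion.\<close>
  have x'ne: "d e x' = q ^ k"
  proof (rule ccontr)
    assume "d e x' \<noteq> q ^ k"
    then have "d e x' < q ^ k" using x'e d_sym by (metis less_le)
    then have "d x' e \<le> q ^ Suc k" using Z_gap[OF E_Z[OF e] x'] d_sym by metis
    then have "d ((f ^^ (n' + n)) e) e \<le> q ^ Suc k" by (simp add: iter_add x'_def x_def)
    then have "reaches (n' + n) e (Suc k) e (Suc k)" using r12 unfolding reaches_def by blast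
    then show False using reaches_self[OF E_J[OF e]] n by (meson le_refl trans_le_add2)
  qed
  have c2: "visit e k x' n (other e) ?j" using cv[OF x' x'ne] .
  then have "homothety n x' (q ^ Suc k) (q ^ Suc ?j)" "lip n x' (q ^ k) (q ^ ?j)" "d ((f ^^ n) x') (other e) \<le> q ^ Suc ?j"
    unfolding visit_def good_def by auto
  then have r3: "reaches n x' (Suc k) (other e) (Suc ?j)" unfolding reaches_def using hl[OF _ _ q_Suc_le] by blast
  have r: "reaches (n + (n' + n)) e (Suc k) (other e) (Suc ?j)" by (rule reaches_comp[OF r12 r3]) simp
  show ?thesis
  proof (rule ccontr)
    assume "\<not> ?j < H e (Suc k)"
    then have lt: "H e (Suc k) < Suc ?j" by simp
    obtain z i k2 where c3: "visit (other e) (Suc ?j) z i e k2" using other_visit[OF e, of "Suc ?j"] jK0 by auto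
    have "Suc k \<le> k2" using H_up[OF e _ c3 lt] k01 by simp
    then show False using reaches_self[OF E_J[OF e] reaches_comp[OF r visit_reaches[OF c3] le_refl]] n by simp
  qed
qed

text \<open>Without any jump beyond \<open>K2\<close> the function \<open>H e\<close> would be
  bounded, but by equicontinuity the arrival exponents grow beyond every bound. After one jump
  \<open>top_Suc\<close> propagates.\<close>

lemma eventually_top: assumes e: "e \<in> E" shows "\<exists>k0>K2. \<forall>k\<ge>k0. H e (k - 1) < H e k"
proof -
  have "\<exists>k>K2. H e (k - 1) < H e k"
  proof (rule ccontr)
    assume no: "\<not> ?thesis"
    have const: "H e (K2 + i) \<le> H e K2" for i
    proof (induction i)
      case (Suc i) then show ?case using no by (metis add_Suc_right diff_Suc_1 le_add1 le_less_trans lessI linorder_not_less order.trans)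
    qed simp
    obtain k0 where k0: "\<And>k. k \<ge> k0 \<Longrightarrow> small_on e (q ^ k) (q ^ Suc (Suc (H e K2)))"
      using uniform_small[OF unif[OF E_C0[OF e] E_FK[OF e]] q_power_pos q_power_pos] by blast
    obtain y n where "visit e (K2 + k0) y n (other e) (H e (K2 + k0))" using H_ex[OF e, of "K2 + k0"] K12 by auto
    then have "Suc (H e K2) \<le> H e (K2 + k0)" using visit_small k0 by (meson le_add2)
    then show False using const[of k0] by simp
  qed
  then obtain k0 where k0: "k0 > K2" "H e (k0 - 1) < H e k0" by blast
  have "H e (k0 + i - 1) < H e (k0 + i)" for i
  proof (induction i)
    case (Suc i) then show ?case using top_Suc[OF e, of "k0 + i"] k0 by simp
  qed (use k0 in simp)
  then have "\<forall>k\<ge>k0. H e (k - 1) < H e k" by (metis le_add_diff_inverse)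
  then show ?thesis using k0 by blast
qed

lemma two_critical_points_impossible: False
proof -
  obtain e where e: "e \<in> E" using E_ne by blast
  obtain k1 where k1: "k1 > K2" "\<And>k. k \<ge> k1 \<Longrightarrow> H e (k - 1) < H e k" using eventually_top[OF e] by blast
  obtain k2 where k2: "k2 > K2" "\<And>k. k \<ge> k2 \<Longrightarrow> H (other e) (k - 1) < H (other e) k" using eventually_top[OF other(1)[OF e]] by blast
  define ks where "ks = max k1 k2"
  have ks: "ks > K2" using k1 by (simp add: ks_def)
  have top: "H e' (k - 1) < H e' k" if "e' \<in> E" "k \<ge> ks" for e' k
    using E_cases[OF e that(1)] k1(2) k2(2) that by (auto simp: ks_def)
  \<comment> \<open>\<open>u\<close> is nearer to \<open>e'\<close> than the sphere, so its image is
    strictly closer than \<open>q ^ H e' k\<close> to the image of \<open>e'\<close> and inherits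
    the exact distance of the latter from \<open>other e'\<close>.\<close>
  have step: "\<exists>n. d ((f ^^ n) u) (other e') = q ^ H e' k \<and> d ((f ^^ n) w) (other e') \<le> q ^ Suc (H e' k) \<and> d ((f ^^ n) u) ((f ^^ n) w) = q ^ H e' k"
    if a: "e' \<in> E" "k \<ge> ks" "u \<in> Z" "w \<in> Z" "d u e' \<le> q ^ Suc k" "d w e' = q ^ k" for e' k u w
  proof -
    have k: "k > K2" "k \<ge> K0" using a ks K01 K12 by auto
    obtain n where dr: "direct e' k n (H e' k)" and n: "d ((f ^^ n) e') (other e') = q ^ H e' k"
      and cv: "\<And>y. y \<in> Z \<Longrightarrow> d e' y = q ^ k \<Longrightarrow> visit e' k y n (other e') (H e' k)"
      using top_direct[OF a(1) k(1) top[OF a(1,2)]] by blast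
    have u: "d e' u \<le> q ^ Suc k" using a d_sym by simp
    then have uk: "d e' u \<le> q ^ k" using q_Suc_le[of k] by linarith
    have "d e' u / q ^ k < 1" using u q_power_less_iff[of "Suc k" k] by (simp del: power_Suc)
    then have "(d e' u / q ^ k) ^ m e' < 1" using m_ge[OF E_C[OF a(1)]] d_nonneg by (intro power_less_one_iff[THEN iffD2]) auto
    then have "d ((f ^^ n) e') ((f ^^ n) u) < q ^ H e' k" using direct_sphere[OF a(1) k(2) dr uk] by simp
    then have "d ((f ^^ n) u) ((f ^^ n) e') < d ((f ^^ n) e') (other e')" using n d_sym by metis
    then have 1: "d ((f ^^ n) u) (other e') = q ^ H e' k" using d_isosceles n by metis
    have w: "d ((f ^^ n) w) (other e') \<le> q ^ Suc (H e' k)" using cv[of w] a d_sym unfolding visit_def by simp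
    then have "d ((f ^^ n) w) (other e') < d (other e') ((f ^^ n) u)"
      using 1 d_sym q_power_less_iff[of "Suc (H e' k)" "H e' k"] by (metis lessI le_less_trans)
    then have "d ((f ^^ n) w) ((f ^^ n) u) = q ^ H e' k" using d_isosceles 1 d_sym by metis
    then show ?thesis using 1 w d_sym by metis
  qed
  have climb: "\<exists>n. q ^ ks \<le> d ((f ^^ n) u) ((f ^^ n) w)"
    if "e' \<in> E" "k \<ge> ks" "u \<in> Z" "w \<in> Z" "d u e' \<le> q ^ Suc k" "d w e' = q ^ k" for e' k u w
    using that
  proof (induction k arbitrary: e' u w rule: less_induct)
    case (less k)
    let ?j = "H e' k"
    obtain n where n: "d ((f ^^ n) u) (other e') = q ^ ?j" "d ((f ^^ n) w) (other e') \<le> q ^ Suc ?j" "d ((f ^^ n) u) ((f ^^ n) w) = q ^ ?j"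
      using step[OF less.prems] by blast
    show ?case
    proof (cases "?j \<ge> ks")
      case False
      then have "q ^ ks \<le> q ^ ?j" using q_power_le_iff by simp
      then show ?thesis using n(3) by metis
    next
      case True
      let ?g = "H (other e') ?j"
      have E': "other e' \<in> E" "other (other e') = e'" using other other_other less.prems by auto
      obtain n2 where n2: "d ((f ^^ n2) ((f ^^ n) w)) e' = q ^ ?g" "d ((f ^^ n2) ((f ^^ n) u)) e' \<le> q ^ Suc ?g"
        "d ((f ^^ n2) ((f ^^ n) w)) ((f ^^ n2) ((f ^^ n) u)) = q ^ ?g"
        using step[OF E'(1) True iter_Z[OF less.prems(4)] iter_Z[OF less.prems(3)] n(2,1)] E'(2) by auto
      obtain z i where "visit (other e') ?j z i (other (other e')) ?g" using H_ex[OF E'(1), of ?j] True ks K12 by auto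
      \<comment> \<open>A round trip lowers the exponent strictly, by \<open>H_down\<close>. So the
        induction stops at an exponent below \<open>ks\<close>, which means a distance of at least
        \<open>q ^ ks\<close>.\<close>
      then have gk: "?g < k" using H_down[OF less.prems(1)] E'(2) less.prems(2) ks K12 by auto
      show ?thesis
      proof (cases "?g \<ge> ks")
        case False
        then have "q ^ ks \<le> q ^ ?g" using q_power_le_iff by simp
        then have "q ^ ks \<le> d ((f ^^ (n2 + n)) u) ((f ^^ (n2 + n)) w)" using n2(3) d_sym by (simp add: iter_add)
        then show ?thesis by blast
      next
        case True
        then obtain i where "q ^ ks \<le> d ((f ^^ i) ((f ^^ (n2 + n)) u)) ((f ^^ i) ((f ^^ (n2 + n)) w))"
          using less.IH[OF gk less.prems(1) True, of "(f ^^ (n2 + n)) u" "(f ^^ (n2 + n)) w"] n2 iter_Z less.prems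
          by (auto simp: iter_add)
        then show ?thesis by (metis iter_add)
      qed
    qed
  qed
  obtain k0 where k0: "\<And>k. k \<ge> k0 \<Longrightarrow> small_on e (q ^ k) (q ^ Suc ks)"
    using uniform_small[OF unif[OF E_C0[OF e] E_FK[OF e]] q_power_pos q_power_pos] by blast
  define k where "k = max k0 ks"
  obtain y where y: "y \<in> Z" "d e y = q ^ k" using Z_sphere[OF E_Z[OF e]] by blast
  obtain n where "q ^ ks \<le> d ((f ^^ n) e) ((f ^^ n) y)"
    using climb[OF e, of k e y] y E_Z[OF e] d_sym by (auto simp: k_def)
  moreover have "d ((f ^^ n) e) ((f ^^ n) y) \<le> q ^ Suc ks"
    using k0[of k] y E_Z[OF e] unfolding small_on_def by (simp add: k_def)
  ultimately have "q ^ ks \<le> q ^ Suc ks" by linarith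
  then show False using q_power_le_iff by (metis Suc_n_not_le_n)
qed

end

section \<open>Choice of the scales and conclusion for the abstract system\<close>

context critical_dynamics begin

lemma small_on_finite:
  assumes S: "finite S" "S \<subseteq> FK" and \<epsilon>: "0 < \<epsilon>"
  shows "\<exists>K. \<forall>e\<in>S. \<forall>k\<ge>K. small_on e (q ^ k) \<epsilon>"
proof -
  have "\<exists>r>0. \<forall>e\<in>S. \<forall>k. q ^ k \<le> r \<longrightarrow> small_on e (q ^ k) \<epsilon>"
  proof (rule finite_positive_bound[OF S(1)])
    fix e assume "e \<in> S"
    then obtain r where r: "0 < r" "uniform_on e r" using FK_uniform S by blast
    obtain k0 where k0: "\<And>k. k \<ge> k0 \<Longrightarrow> small_on e (q ^ k) \<epsilon>" by (rule uniform_small[OF r(2,1) \<epsilon>]) iprover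
    then have "\<forall>k. q ^ k \<le> q ^ k0 \<longrightarrow> small_on e (q ^ k) \<epsilon>" by (simp add: q_power_le_iff)
    then show "\<exists>r>0. \<forall>k. q ^ k \<le> r \<longrightarrow> small_on e (q ^ k) \<epsilon>" using q_power_pos by blast
  qed (meson order_trans)
  then obtain r where r: "r > 0" "\<And>e k. e \<in> S \<Longrightarrow> q ^ k \<le> r \<Longrightarrow> small_on e (q ^ k) \<epsilon>" by blast
  obtain K where "\<forall>k\<ge>K. q ^ k < r" using q_power_small[OF r(1)] by blast
  then show ?thesis using r(2) less_imp_le by blast
qed

lemma uniform_on_finite:
  assumes S: "finite S" "S \<subseteq> FK"
  shows "\<exists>r>0. \<forall>e\<in>S. uniform_on e r"
proof (rule finite_positive_bound[OF S(1)])
  show "\<exists>r>0. uniform_on e r" if "e \<in> S" for e using FK_uniform that S by blast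
  show "uniform_on e s" if "uniform_on e r" "s \<le> r" for e r s
    using that uniform_on_subset[OF that(1), of e s] d_nonneg[of e e] unfolding uniform_on_def
    by (meson order_trans)
qed

text \<open>The second hypothesis is needed exactly at the points that
  \<open>recurrent_critical_point\<close> supplies. The set counted there is \<open>C0\<close>, the
  class of the recurrent point.\<close>

theorem FK_Int_J_empty:
  assumes norec: "\<And>c. c \<in> C \<Longrightarrow> \<mu> c < 1 \<Longrightarrow> c \<notin> orbit_cl (f c)"
    and cls: "\<And>c. c \<in> C \<Longrightarrow> c \<in> FK \<Longrightarrow> c \<in> orbit_cl (f c) \<Longrightarrow> card {c' \<in> C. c' \<in> orbit_cl c} \<le> 2"
  shows "FK \<inter> J = {}"
proof (rule ccontr)
  assume "FK \<inter> J \<noteq> {}"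
  then obtain x where "x \<in> FK" "x \<in> J" by blast
  then have "\<exists>c\<in>C \<inter> FK. c \<in> orbit_cl (f c)" by (rule recurrent_critical_point) (rule norec)
  then obtain c0 where c0: "c0 \<in> C" "c0 \<in> FK" "c0 \<in> orbit_cl (f c0)" by blast
  define C0 where "C0 = {c \<in> C. c \<in> orbit_cl c0}"
  have C0f: "finite C0" using finite_C by (simp add: C0_def)
  have tame: "\<mu> e = 1" if "e \<in> C0" for e
  proof -
    have e: "e \<in> C" "e \<in> orbit_cl c0" using that by (auto simp: C0_def)
    \<comment> \<open>Each member of \<open>C0\<close> inherits recurrence from \<open>c0\<close>,
      and the absence of recurrent wild points then makes it tame.\<close>
    have "e \<in> orbit_cl (f e)" using orbit_cl_trans[OF recurrent_return[OF c0(2,3) e(2)] e(2)] .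
    then show ?thesis using norec[OF e(1)] mu_le[OF e(1)] by linarith
  qed
  obtain g where g: "0 < g" "inv_set g (orbit_cl c0)" using uniform_gap[of c0] by blast
  have "\<exists>r>0. \<forall>c\<in>C. r < \<mu> c"
    by (rule finite_positive_bound[OF finite_C]) (auto dest: mu_pos dense)
  then obtain r where r: "r > 0" "\<And>c. c \<in> C \<Longrightarrow> r < \<mu> c" by blast
  have r1: "r < 1" using r(2)[OF c0(1)] mu_le[OF c0(1)] by linarith
  \<comment> \<open>The factor \<open>r\<close>, below every \<open>\<mu> c\<close>, turns the event
    bound \<open>\<mu> c * d c b \<le> \<zeta>\<close> into \<open>d c b \<le> g\<close>.\<close>
  define \<zeta> where "\<zeta> = min (min \<eta> 1) (g * r)"
  have \<zeta>: "0 < \<zeta>" "\<zeta> \<le> \<eta>" "\<zeta> \<le> 1" "\<zeta> \<le> g * r" using g r eta_pos by (auto simp: \<zeta>_def)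
  have "g * r \<le> g * 1" using g r1 by (intro mult_left_mono) auto
  then have \<zeta>g: "\<zeta> \<le> g" using \<zeta> by linarith
  have hit: "c \<in> C0" if a: "e \<in> C0" "c \<in> C" "d ((f ^^ n) e) b \<le> h" "h \<le> \<zeta>" "\<mu> c * d c b \<le> h" for e c n b h
  proof -
    have "r * d c b \<le> \<mu> c * d c b" using r(2)[OF a(2)] by (intro mult_right_mono d_nonneg) simp
    then have "r * d c b \<le> r * g" using a \<zeta> by (simp add: mult.commute)
    then have "d c b \<le> g" using r(1) by simp
    moreover have "d b ((f ^^ n) e) \<le> g" using a(3,4) \<zeta>g d_sym[of b "(f ^^ n) e"] by linarith
    ultimately have "d c ((f ^^ n) e) \<le> g" by (rule d_le)
    moreover have "(f ^^ n) e \<in> orbit_cl c0" using a(1) orbit_cl_forward_iter by (simp add: C0_def)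
    ultimately show ?thesis using g(2) a(2) unfolding inv_set_def C0_def by blast
  qed
  have F: "finite (C0 \<inter> FK)" "C0 \<inter> FK \<subseteq> FK" using C0f by auto
  obtain r0 where r0: "0 < r0" "\<And>e. e \<in> C0 \<inter> FK \<Longrightarrow> uniform_on e r0" using uniform_on_finite[OF F] by blast
  have "0 < q * \<zeta>" using q_pos \<zeta> by simp
  then obtain Ka where Ka: "\<And>e k. e \<in> C0 \<inter> FK \<Longrightarrow> k \<ge> Ka \<Longrightarrow> small_on e (q ^ k) (q * \<zeta>)"
    using small_on_finite[OF F] by blast
  have "0 < min r0 \<delta>" using r0 eta_pos eta_le by simp
  then obtain Kb where Kb: "\<And>k. k \<ge> Kb \<Longrightarrow> q ^ k < min r0 \<delta>" using q_power_small by blast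
  define K0 where "K0 = max Ka Kb"
  have qK0: "q ^ K0 \<le> r0" "q ^ K0 \<le> \<delta>" using Kb[of K0] by (auto simp: K0_def)
  obtain Kc where Kc: "\<And>e k. e \<in> C0 \<inter> FK \<Longrightarrow> k \<ge> Kc \<Longrightarrow> small_on e (q ^ k) (q ^ Suc K0)"
    using small_on_finite[OF F q_power_pos] by blast
  define K1 where "K1 = max K0 Kc"
  obtain Kd where Kd: "\<And>e k. e \<in> C0 \<inter> FK \<Longrightarrow> k \<ge> Kd \<Longrightarrow> small_on e (q ^ k) (q ^ Suc K1)"
    using small_on_finite[OF F q_power_pos] by blast
  define K2 where "K2 = max K1 Kd"
  interpret minimal_class_dynamics d f Z q C A \<mu> m \<delta> \<eta> C0 \<zeta> K0
  proof unfold_locales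
    show "card C0 \<le> 2" unfolding C0_def using cls[OF c0] .
    show "small_on e (q ^ k) (q * \<zeta>)" if "e \<in> C0" "e \<in> FK" "k \<ge> K0" for e k using Ka that by (simp add: K0_def)
    show "uniform_on e (q ^ K0)" if "e \<in> C0" "e \<in> FK" for e
      using uniform_on_subset[OF r0(2), of e e "q ^ K0"] that qK0 r0(1) by simp
    show "e \<in> C" if "e \<in> C0" for e using that by (simp add: C0_def)
    show "\<mu> e = 1" if "e \<in> C0" for e using tame that .
    show "0 < \<zeta>" "\<zeta> \<le> \<eta>" "\<zeta> \<le> 1" using \<zeta> by auto
    show "c \<in> C0" if "e \<in> C0" "c \<in> C" "d ((f ^^ n) e) b \<le> h" "h \<le> \<zeta>" "\<mu> c * d c b \<le> h" for e c n b h
      using hit that .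
    show "q ^ K0 \<le> \<delta>" using qK0 by simp
  qed
  interpret two_critical_points d f Z q C A \<mu> m \<delta> \<eta> C0 \<zeta> K0 K1 K2
  proof unfold_locales
    have "c0 \<in> C0" using c0 orbit_cl_self[of c0] by (simp add: C0_def)
    then show "E \<noteq> {}" using c0(2) unfolding E_def by blast
    show "small_on e (q ^ k) (q ^ Suc K0)" if "e \<in> E" "k \<ge> K1" for e k using Kc that by (simp add: E_def K1_def)
    show "small_on e (q ^ k) (q ^ Suc K1)" if "e \<in> E" "k \<ge> K2" for e k using Kd that by (simp add: E_def K2_def)
  qed (auto simp: K1_def K2_def)
  show False by (rule two_critical_points_impossible)
qed

end

section \<open>Compactness of finite extensions\<close>

context nonarch_abs begin

lemma v_le: "v x \<le> r \<Longrightarrow> v y \<le> r \<Longrightarrow> v (x + y) \<le> r"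
  using ultra[of x y] by linarith

lemma v_diff_le: "v x \<le> r \<Longrightarrow> v y \<le> r \<Longrightarrow> v (x - y) \<le> r"
  using v_le[of x r "- y"] by simp

lemma v_power: "v (x ^ n) = v x ^ n"
  by (induction n) (auto simp: mult)

lemma v_pos: "x \<noteq> 0 \<Longrightarrow> 0 < v x"
  using nonneg[of x] eq_zero[of x] by linarith

lemma v_inverse: "v (inverse x) = inverse (v x)"
proof (cases "x = 0")
  case False
  then have "v x * v (inverse x) = 1" by (simp flip: mult)
  then show ?thesis by (metis inverse_unique)
qed simp

lemma v_divide: "v (x / y) = v x / v y"
  by (simp add: divide_inverse mult v_inverse)

lemma v_add_eq: assumes "v x < v y" shows "v (x + y) = v y"
proof (rule antisym)
  show "v (x + y) \<le> v y" using v_le[of x "v y" y] assms by simp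
  have "v ((x + y) + (- x)) \<le> max (v (x + y)) (v (- x))" by (rule ultra)
  then show "v y \<le> v (x + y)" using assms by simp
qed

lemma v_close: assumes "v (x - y) < v y" shows "v x = v y"
  using v_add_eq[OF assms] by simp

lemma v_of_int_le: "v (of_int k) \<le> 1"
proof -
  have nat: "v (of_nat n) \<le> 1" for n by (induction n) (auto intro: v_le)
  show ?thesis by (cases k) (use nat v_minus[of "of_nat _"] in \<open>auto simp del: of_nat_Suc v_minus simp: v_minus\<close>)
qed

text \<open>The Heine-Borel property for subsets, phrased with sequences and \<open>v\<close>
  because the metric is a parameter and not that of a type class.\<close>

definition seq_compact_set :: "'a set \<Rightarrow> bool" where
  "seq_compact_set V \<longleftrightarrow> (\<forall>(s :: nat \<Rightarrow> 'a) B. (\<forall>n. s n \<in> V \<and> v (s n) \<le> B) \<longrightarrow>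
     (\<exists>x\<in>V. \<exists>r. strict_mono r \<and> (\<lambda>n. v (x - s (r n))) \<longlonglongrightarrow> 0))"

lemma seq_compact_setD:
  assumes "seq_compact_set V" "\<And>n. s n \<in> V" "\<And>n. v (s n) \<le> B"
  obtains x r where "x \<in> V" "strict_mono (r :: nat \<Rightarrow> nat)" "(\<lambda>n. v (x - s (r n))) \<longlonglongrightarrow> 0"
  using assms unfolding seq_compact_set_def by blast

lemma seq_compact_distance:
  assumes V: "seq_compact_set V" and b: "b \<notin> V"
  shows "\<exists>\<delta>>0. \<forall>w\<in>V. \<delta> \<le> v (b - w)"
proof (rule ccontr)
  assume "\<not> ?thesis"
  then have "\<forall>n. \<exists>w\<in>V. v (b - w) < 1 / real (Suc n)"
    by (metis not_less of_nat_0_less_iff zero_less_Suc zero_less_divide_1_iff)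
  then obtain s where s: "\<And>n. s n \<in> V" "\<And>n. v (b - s n) < 1 / real (Suc n)" by metis
  have bd: "v (s n) \<le> max 1 (v b)" for n
  proof -
    have "v (b - s n) \<le> 1" using s(2)[of n] by (smt (verit) divide_le_eq_1 of_nat_0_less_iff of_nat_Suc of_nat_0_le_iff)
    then show ?thesis using v_diff_le[of b "max 1 (v b)" "b - s n"] by simp
  qed
  obtain x r where x: "x \<in> V" "strict_mono r" "(\<lambda>n. v (x - s (r n))) \<longlonglongrightarrow> 0"
    by (rule seq_compact_setD[OF V s(1) bd])
  have "(\<lambda>n. 1 / real (Suc n)) \<longlonglongrightarrow> 0" by (rule LIMSEQ_Suc[OF lim_1_over_n])
  then have l: "(\<lambda>n. v (b - s n)) \<longlonglongrightarrow> 0"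
    by (rule Lim_null_comparison[rotated]) (use s nonneg in \<open>auto intro!: always_eventually less_imp_le\<close>)
  have "v (b - x) = 0"
  proof (rule ccontr)
    assume "v (b - x) \<noteq> 0"
    then have pos: "0 < v (b - x)" using nonneg[of "b - x"] by linarith
    have "\<forall>\<^sub>F n in sequentially. v (b - s (r n)) < v (b - x) \<and> v (x - s (r n)) < v (b - x)"
      using eventually_conj[OF eventually_subseq[OF x(2) order_tendstoD(2)[OF l pos]] order_tendstoD(2)[OF x(3) pos]] .
    then obtain n where n: "v (b - s (r n)) < v (b - x)" "v (x - s (r n)) < v (b - x)"
      using eventually_happens by fastforce
    have "v ((b - s (r n)) + - (x - s (r n))) \<le> max (v (b - s (r n))) (v (- (x - s (r n))))" by (rule ultra)
    then show False using n unfolding v_minus by simp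
  qed
  then show False using b x(1) eq_zero by simp
qed

lemma v_tendsto_bound:
  assumes "(\<lambda>n. v (x - s n)) \<longlonglongrightarrow> 0" "0 < e" obtains N where "\<And>n. n \<ge> N \<Longrightarrow> v (x - s n) < e"
  using order_tendstoD(2)[OF assms] unfolding eventually_sequentially by blast

text \<open>Induction on the generators. A new generator \<open>b\<close> outside the previous span
  has positive distance from it, so bounded sums \<open>w + a * b\<close> have bounded
  \<open>a\<close> and bounded \<open>w\<close>, and subsequences can be extracted one after the
  other.\<close>

lemma seq_compact_span:
  assumes F: "is_subfield F" "seq_compact_set F" and B: "finite B"
  shows "seq_compact_set {\<Sum>b\<in>B. c b * b | c. \<forall>b\<in>B. c b \<in> F}" (is "seq_compact_set (?V B)")
  using B
proof (induction B)
  case empty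
  show ?case unfolding seq_compact_set_def
    by (auto intro!: exI[of _ id] simp: strict_mono_id)
next
  case (insert b B)
  have mulF: "x * y \<in> F" and addF: "x + y \<in> F" and negF: "- x \<in> F" and invF: "inverse x \<in> F" if "x \<in> F" "y \<in> F" for x y
    using F that unfolding is_subfield_def by blast+
  have V_add: "x + y \<in> ?V B" if xy: "x \<in> ?V B" "y \<in> ?V B" for x y
  proof -
    obtain c where c: "x = (\<Sum>b\<in>B. c b * b)" "\<forall>b\<in>B. c b \<in> F" using xy by blast
    obtain c' where c': "y = (\<Sum>b\<in>B. c' b * b)" "\<forall>b\<in>B. c' b \<in> F" using xy by blast
    have "x + y = (\<Sum>b\<in>B. (c b + c' b) * b)" by (simp add: c c' sum.distrib distrib_right)
    moreover have "\<forall>b\<in>B. c b + c' b \<in> F" using c c' addF by blast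
    ultimately show ?thesis by (intro CollectI exI[of _ "\<lambda>b. c b + c' b"]) simp
  qed
  have V_mul: "a * x \<in> ?V B" if ax: "a \<in> F" "x \<in> ?V B" for a x
  proof -
    obtain c where c: "x = (\<Sum>b\<in>B. c b * b)" "\<forall>b\<in>B. c b \<in> F" using ax by blast
    have "a * x = (\<Sum>b\<in>B. (a * c b) * b)" by (simp add: c sum_distrib_left mult.assoc)
    moreover have "\<forall>b\<in>B. a * c b \<in> F" using c ax mulF by blast
    ultimately show ?thesis by (intro CollectI exI[of _ "\<lambda>b. a * c b"]) simp
  qed
  have Vi: "x \<in> ?V (insert b B) \<longleftrightarrow> (\<exists>w\<in>?V B. \<exists>a\<in>F. x = w + a * b)" for x
  proof
    assume "x \<in> ?V (insert b B)"
    then obtain c where c: "x = (\<Sum>b\<in>insert b B. c b * b)" "\<forall>b\<in>insert b B. c b \<in> F" by blast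
    then show "\<exists>w\<in>?V B. \<exists>a\<in>F. x = w + a * b"
      using insert.hyps by (intro bexI[of _ "\<Sum>b\<in>B. c b * b"] bexI[of _ "c b"]) auto
  next
    assume "\<exists>w\<in>?V B. \<exists>a\<in>F. x = w + a * b"
    then obtain c a where c: "x = (\<Sum>b\<in>B. c b * b) + a * b" "\<forall>b\<in>B. c b \<in> F" "a \<in> F" by blast
    have "(\<Sum>b'\<in>B. (c(b := a)) b' * b') = (\<Sum>b\<in>B. c b * b)"
      using insert.hyps by (intro sum.cong) auto
    then have "x = (\<Sum>b'\<in>insert b B. (c(b := a)) b' * b')" using insert.hyps c by simp
    moreover have "\<forall>b'\<in>insert b B. (c(b := a)) b' \<in> F" using c by simp
    ultimately show "x \<in> ?V (insert b B)" by blast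
  qed
  show ?case
  proof (cases "b \<in> ?V B")
    case True
    have "?V (insert b B) = ?V B"
    proof
      show "?V (insert b B) \<subseteq> ?V B"
      proof
        fix x assume "x \<in> ?V (insert b B)"
        then obtain w a where "w \<in> ?V B" "a \<in> F" "x = w + a * b" unfolding Vi by blast
        then show "x \<in> ?V B" by (simp only:) (intro V_add V_mul True)
      qed
      have "0 \<in> F" using F unfolding is_subfield_def by blast
      show "?V B \<subseteq> ?V (insert b B)"
      proof
        fix x assume x: "x \<in> ?V B"
        then have "\<exists>w\<in>?V B. \<exists>a\<in>F. x = w + a * b" using \<open>0 \<in> F\<close> by (intro bexI[of _ x] bexI[of _ 0]) auto
        then show "x \<in> ?V (insert b B)" unfolding Vi .
      qed
    qed
    then show ?thesis using insert.IH by (simp only:)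
  next
    case False
    obtain \<delta> where \<delta>: "0 < \<delta>" "\<And>w. w \<in> ?V B \<Longrightarrow> \<delta> \<le> v (b - w)" using seq_compact_distance[OF insert.IH False] by auto
    \<comment> \<open>For \<open>a \<noteq> 0\<close>, division by \<open>a\<close> turns
      \<open>w + a * b\<close> into the difference of \<open>b\<close> and an element of the span,
      which has value at least \<open>\<delta>\<close>.\<close>
    have low: "v a * \<delta> \<le> v (w + a * b)" if wa: "w \<in> ?V B" "a \<in> F" for w a
    proof (cases "a = 0")
      case False
      have "(- inverse a) * w \<in> ?V B" using wa by (intro V_mul negF invF)
      then have "\<delta> \<le> v (b - (- inverse a) * w)" using \<delta>(2) by blast
      then have "v a * \<delta> \<le> v (a * (b - (- inverse a) * w))" by (simp add: mult mult_left_mono nonneg)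
      moreover have "a * (b - (- inverse a) * w) = w + a * b"
        using False by (simp add: distrib_left mult.assoc[symmetric])
      ultimately show ?thesis by simp
    qed (simp add: nonneg)
    show ?thesis unfolding seq_compact_set_def
    proof (intro allI impI)
      fix s :: "nat \<Rightarrow> 'a" and R assume s: "\<forall>n. s n \<in> ?V (insert b B) \<and> v (s n) \<le> R"
      then have "\<forall>n. \<exists>w\<in>?V B. \<exists>a\<in>F. s n = w + a * b" unfolding Vi by blast
      then have ex: "\<exists>w. w \<in> ?V B \<and> (\<exists>a\<in>F. s n = w + a * b)" for n unfolding Bex_def by (rule spec)
      define w where "w n = (SOME w. w \<in> ?V B \<and> (\<exists>a\<in>F. s n = w + a * b))" for n
      have w1: "w n \<in> ?V B" and "\<exists>a\<in>F. s n = w n + a * b" for n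
        using someI_ex[OF ex[of n]] unfolding w_def[symmetric] by (rule conjunct1, rule conjunct2)
      then obtain a where a1: "\<And>n. a n \<in> F" "\<And>n. s n = w n + a n * b" by metis
      note wa = w1 a1
      have a: "v (a n) \<le> R / \<delta>" for n
      proof -
        have "v (a n) * \<delta> \<le> R" using low[OF wa(1)[of n] wa(2)[of n]] s wa(3)[of n] by (metis order_trans)
        then show ?thesis using \<delta>(1) by (simp add: field_simps)
      qed
      obtain a0 r1 where a0: "a0 \<in> F" "strict_mono r1" "(\<lambda>n. v (a0 - a (r1 n))) \<longlonglongrightarrow> 0"
        by (rule seq_compact_setD[OF F(2) wa(2) a])
      have w: "v (w n) \<le> max R (R / \<delta> * v b)" for n
      proof -
        have "v (s n) \<le> max R (R / \<delta> * v b)" using s by (simp add: le_max_iff_disj)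
        moreover have "v (a n * b) \<le> max R (R / \<delta> * v b)"
          using mult_right_mono[OF a[of n] nonneg[of b]] by (simp add: mult le_max_iff_disj)
        ultimately show ?thesis using v_diff_le wa(3)[of n] by (metis add_diff_cancel_right')
      qed
      obtain w0 r2 where w0: "w0 \<in> ?V B" "strict_mono r2" "(\<lambda>n. v (w0 - w (r1 (r2 n)))) \<longlonglongrightarrow> 0"
        by (rule seq_compact_setD[OF insert.IH, of "\<lambda>n. w (r1 n)", OF wa(1) w])
      have a0': "(\<lambda>n. v (a0 - a (r1 (r2 n)))) \<longlonglongrightarrow> 0" using LIMSEQ_subseq_LIMSEQ[OF a0(3) w0(2)] by (simp add: o_def)
      have lim: "(\<lambda>n. v (w0 - w (r1 (r2 n))) + v (a0 - a (r1 (r2 n))) * v b) \<longlonglongrightarrow> 0"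
        using tendsto_add[OF w0(3) tendsto_mult_right[OF a0', of "v b"]] by simp
      have "(\<lambda>n. v (w0 + a0 * b - s (r1 (r2 n)))) \<longlonglongrightarrow> 0"
      proof (rule Lim_null_comparison[OF always_eventually lim], rule allI)
        fix n
        have "w0 + a0 * b - s (r1 (r2 n)) = (w0 - w (r1 (r2 n))) + (a0 - a (r1 (r2 n))) * b"
          by (simp add: wa(3) algebra_simps)
        then have "v (w0 + a0 * b - s (r1 (r2 n))) \<le> max (v (w0 - w (r1 (r2 n)))) (v ((a0 - a (r1 (r2 n))) * b))"
          by (simp only: ultra)
        then show "norm (v (w0 + a0 * b - s (r1 (r2 n)))) \<le> v (w0 - w (r1 (r2 n))) + v (a0 - a (r1 (r2 n))) * v b"
          using nonneg[of "w0 - w (r1 (r2 n))"] nonneg[of "(a0 - a (r1 (r2 n))) * b"] nonneg[of "w0 + a0 * b - s (r1 (r2 n))"]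
          by (simp add: mult)
      qed
      moreover have "w0 + a0 * b \<in> ?V (insert b B)" unfolding Vi by (intro bexI[OF _ w0(1)] bexI[OF _ a0(1)] refl)
      moreover have "strict_mono (\<lambda>n. r1 (r2 n))" using strict_mono_o[OF a0(2) w0(2)] by (simp add: o_def)
      ultimately show "\<exists>x\<in>?V (insert b B). \<exists>r. strict_mono r \<and> (\<lambda>n. v (x - s (r n))) \<longlonglongrightarrow> 0" by blast
    qed
  qed
qed

end

section \<open>The p-adic numbers and the value group of \<open>K\<close>\<close>

context padic_complex_field begin

lemma padic_iff: "x \<in> padic_numbers v \<longleftrightarrow> (\<forall>r>0. \<exists>a::rat. v (x - of_rat a) < r)"
proof -
  interpret A: Metric_space UNIV "\<lambda>x y. v (x - y)" by (rule metric_abs)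
  show ?thesis unfolding padic_numbers_def abs_topology_def A.metric_closure_of by auto
qed

lemma p_gt_1: "1 < real p" using prime_p prime_gt_1_nat by simp

lemma inverse_p_less: "1 / real p < 1" using p_gt_1 by simp

text \<open>Otherwise a Bezout relation between \<open>p\<close> and \<open>k\<close> would write 1
  as a sum of two elements of value below 1.\<close>

lemma v_of_int_unit: assumes "\<not> int p dvd k" shows "v (of_int k) = 1"
proof (rule ccontr)
  assume "v (of_int k) \<noteq> 1"
  then have k: "v (of_int k) < 1" using v_of_int_le[of k] by linarith
  have "coprime (int p) k" using prime_p assms prime_imp_coprime[of "int p" k] by simp
  then obtain a b where ab: "a * int p + b * k = 1" using bezout_int[of "int p" k] by (auto simp: coprime_iff_gcd_eq_1)
  have "v (of_int (a * int p)) \<le> v (of_nat p)"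
    using mult_right_mono[OF v_of_int_le[of a] nonneg[of "of_nat p"]] by (simp add: mult)
  then have 1: "v (of_int (a * int p)) < 1" using abs_p inverse_p_less by linarith
  have 2: "v (of_int (b * k)) < 1"
    using mult_right_mono[OF v_of_int_le[of b] nonneg[of "of_int k"]] k by (simp add: mult)
  have "v (of_int (a * int p) + of_int (b * k)) \<le> max (v (of_int (a * int p))) (v (of_int (b * k)))" by (rule ultra)
  then have "v (of_int (a * int p) + of_int (b * k)) < 1" using 1 2 by linarith
  moreover have "of_int (a * int p) + of_int (b * k) = (1 :: 'a)" unfolding of_int_add[symmetric] ab by simp
  ultimately show False by simp
qed

lemma v_of_int_power_dvd: assumes "int p ^ N dvd k" shows "v (of_int k) \<le> (1 / real p) ^ N"
proof -
  obtain j where "k = int p ^ N * j" using assms by blast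
  then have "v (of_int k) = v (of_nat p) ^ N * v (of_int j)" by (simp add: mult v_power)
  also have "\<dots> \<le> (1 / real p) ^ N * 1" unfolding abs_p by (intro mult_left_mono v_of_int_le) simp
  finally show ?thesis by simp
qed

text \<open>A rational number close to \<open>x\<close> has value at most 1, so its reduced
  denominator is prime to \<open>p\<close> and can be inverted modulo \<open>p ^ N\<close>.\<close>

lemma padic_integer_approx:
  assumes x: "x \<in> padic_numbers v" "v x \<le> 1"
  shows "\<exists>a<p ^ N. v (x - of_nat a) \<le> (1 / real p) ^ N"
proof -
  have pN: "0 < (1 / real p) ^ N" "(1 / real p) ^ N \<le> 1" using p_gt_1 by (auto intro!: power_le_one)
  obtain r :: rat where r: "v (x - of_rat r) < (1 / real p) ^ N" using x pN(1) padic_iff by blast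
  then have "v (x - of_rat r) \<le> 1" using pN by linarith
  then have vr: "v (of_rat r) \<le> 1" using v_diff_le[OF x(2), of "x - of_rat r"] by simp
  obtain m n where mn: "quotient_of r = (m, n)" by fastforce
  have n: "n > 0" "coprime m n" "r = of_int m / of_int n"
    using quotient_of_denom_pos[OF mn] quotient_of_coprime[OF mn] quotient_of_div[OF mn] by auto
  have rr: "(of_rat r :: 'a) = of_int m / of_int n" by (simp add: n of_rat_divide)
  have pn: "\<not> int p dvd n"
  proof
    assume d: "int p dvd n"
    then have "\<not> int p dvd m" using n(2) prime_p by (meson coprime_common_divisor not_prime_unit prime_int_iff prime_nat_int_transfer)
    then have "v (of_int m) = 1" by (rule v_of_int_unit)
    moreover have "v (of_int n) \<le> (1 / real p) ^ 1" using v_of_int_power_dvd[of 1 n] d by simp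
    then have "v (of_int n) < 1" using inverse_p_less by simp
    ultimately show False using vr n(1) v_pos[of "of_int n"] unfolding rr by (simp add: v_divide field_simps)
  qed
  then have vn: "v (of_int n) = 1" by (rule v_of_int_unit)
  have "coprime (int p) n" using prime_p pn prime_imp_coprime[of "int p" n] by simp
  then have "coprime (int p ^ N) n" by simp
  then obtain s t where st: "s * int p ^ N + t * n = 1" using bezout_int[of "int p ^ N" n] by (auto simp: coprime_iff_gcd_eq_1)
  \<comment> \<open>By the Bezout relation \<open>t\<close> is an inverse of the denominator
    \<open>n\<close> modulo \<open>p ^ N\<close>, so \<open>b\<close> represents
    \<open>m / n\<close> there.\<close>
  define b where "b = (t * m) mod int p ^ N"
  have pN': "0 < int p ^ N" using p_gt_1 by simp
  have b: "0 \<le> b" "b < int p ^ N" using pN' by (auto simp: b_def)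
  have "n * b = n * (t * m) - n * (int p ^ N * ((t * m) div int p ^ N))"
    unfolding b_def by (simp add: minus_div_mult_eq_mod[symmetric] algebra_simps)
  also have "n * (t * m) = m - m * s * int p ^ N" using arg_cong[OF st, of "\<lambda>z. z * m"] by (simp add: algebra_simps)
  finally have "int p ^ N dvd m - n * b" by simp
  then have "v (of_int (m - n * b)) \<le> (1 / real p) ^ N" by (rule v_of_int_power_dvd)
  moreover have "of_rat r - of_int b = (of_int (m - n * b) / of_int n :: 'a)" using n(1) by (simp add: rr field_simps)
  ultimately have "v (of_rat r - of_int b) \<le> (1 / real p) ^ N" by (simp add: v_divide vn)
  then have "v ((x - of_rat r) + (of_rat r - of_int b)) \<le> (1 / real p) ^ N" using r by (intro v_le) auto
  then have "v (x - of_nat (nat b)) \<le> (1 / real p) ^ N" using b by simp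
  moreover have "nat b < p ^ N" using b by (simp add: nat_less_iff)
  ultimately show ?thesis by blast
qed

lemma padic_closed:
  assumes s: "\<And>n. s n \<in> padic_numbers v" and l: "(\<lambda>n. v (x - s n)) \<longlonglongrightarrow> 0" shows "x \<in> padic_numbers v"
  unfolding padic_iff
proof (intro allI impI)
  fix r :: real assume r: "0 < r"
  obtain N where "\<And>n. n \<ge> N \<Longrightarrow> v (x - s n) < r" using v_tendsto_bound[OF l r] by blast
  then have 1: "v (x - s N) < r" by simp
  obtain a where 2: "v (s N - of_rat a) < r" using s[of N] r unfolding padic_iff by blast
  have "v ((x - s N) + (s N - of_rat a)) < r" using ultra[of "x - s N" "s N - of_rat a"] 1 2 by linarith
  then show "\<exists>a. v (x - of_rat a) < r" by auto
qed

text \<open>The finitely many residues modulo \<open>p ^ N\<close> make the unit disc totally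
  bounded; completeness of the ambient field and closedness supply the limit.\<close>

lemma padic_unit_compact:
  assumes s: "\<And>n::nat. s n \<in> padic_numbers v" "\<And>n. v (s n) \<le> 1"
  shows "\<exists>x\<in>padic_numbers v. \<exists>r. strict_mono r \<and> (\<lambda>n. v (x - s (r n))) \<longlonglongrightarrow> 0"
proof -
  interpret A: Metric_space UNIV "\<lambda>x y. v (x - y)" by (rule metric_abs)
  let ?S = "{x \<in> padic_numbers v. v x \<le> 1}"
  have "A.mtotally_bounded ?S"
    unfolding A.mtotally_bounded_def
  proof (intro allI impI)
    fix e :: real assume e: "0 < e"
    have "1 / real p < 1" using p_gt_1 by simp
    then obtain N where N: "(1 / real p) ^ N < e" using real_arch_pow_inv[OF e] by blast
    have "of_nat a \<in> ?S" for a
    proof -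
      have "of_nat a \<in> padic_numbers v" unfolding padic_iff
        by (intro allI impI exI[of _ "of_nat a"]) simp
      then show ?thesis using v_of_int_le[of "int a"] by simp
    qed
    then have "of_nat ` {..<p ^ N} \<subseteq> ?S" by blast
    moreover have "?S \<subseteq> (\<Union>x\<in>of_nat ` {..<p ^ N}. A.mball x e)"
    proof
      fix x assume "x \<in> ?S"
      then obtain a where a: "a < p ^ N" "v (x - of_nat a) \<le> (1 / real p) ^ N" using padic_integer_approx by blast
      then have "v (of_nat a - x) < e" using N v_diff_commute[of x "of_nat a"] by linarith
      then show "x \<in> (\<Union>x\<in>of_nat ` {..<p ^ N}. A.mball x e)" using a(1) by auto
    qed
    ultimately show "\<exists>K. finite K \<and> K \<subseteq> ?S \<and> ?S \<subseteq> (\<Union>x\<in>K. A.mball x e)"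
      by (intro exI[of _ "of_nat ` {..<p ^ N}"]) blast
  qed
  moreover have "range s \<subseteq> ?S" using s by blast
  ultimately obtain r where r: "strict_mono r" "A.MCauchy (s \<circ> r)" unfolding A.mtotally_bounded_sequentially by blast
  then obtain x where x: "limitin A.mtopology (s \<circ> r) x sequentially" using complete unfolding A.mcomplete_def by blast
  have "(\<lambda>n. v (x - s (r n))) \<longlonglongrightarrow> 0"
  proof (rule LIMSEQ_I)
    fix e :: real assume "0 < e"
    then obtain N where "\<forall>n\<ge>N. v (s (r n) - x) < e" using x unfolding A.limit_metric_sequentially by auto
    then show "\<exists>no. \<forall>n\<ge>no. norm (v (x - s (r n)) - 0) < e" using v_diff_commute[of x] nonneg by (intro exI[of _ N]) simp
  qed
  then show ?thesis using padic_closed[of "\<lambda>n. s (r n)" x] s r by blast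
qed

lemma padic_seq_compact:
  assumes F: "is_subfield (padic_numbers v)" shows "seq_compact_set (padic_numbers v)"
  unfolding seq_compact_set_def
proof (intro allI impI)
  fix s :: "nat \<Rightarrow> 'a" and B assume s: "\<forall>n. s n \<in> padic_numbers v \<and> v (s n) \<le> B"
  obtain k where k: "B < real p ^ k" using real_arch_pow[OF p_gt_1] by blast
  define c where "c = (of_nat p :: 'a) ^ k"
  have c0: "c \<noteq> 0" using p_gt_1 by (simp add: c_def)
  have vc: "v c = 1 / real p ^ k" by (simp add: c_def v_power abs_p power_one_over)
  have mulF: "x * y \<in> padic_numbers v" and invF: "inverse x \<in> padic_numbers v" if "x \<in> padic_numbers v" "y \<in> padic_numbers v" for x y
    using F that unfolding is_subfield_def by blast+
  have cF: "c \<in> padic_numbers v" unfolding padic_iff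
    by (intro allI impI exI[of _ "of_nat p ^ k"]) (simp add: c_def of_rat_power)
  have 1: "v (c * s n) \<le> 1" for n
  proof -
    have "v (s n) \<le> real p ^ k" using s k by (meson less_imp_le order_trans)
    then show ?thesis using p_gt_1 by (simp add: mult vc field_simps)
  qed
  obtain x r where x: "x \<in> padic_numbers v" "strict_mono r" "(\<lambda>n. v (x - c * s (r n))) \<longlonglongrightarrow> 0"
    using padic_unit_compact[of "\<lambda>n. c * s n"] mulF cF s 1 by blast
  have "v (inverse c * x - s (r n)) = v (inverse c) * v (x - c * s (r n))" for n
  proof -
    have "inverse c * (x - c * s (r n)) = inverse c * x - s (r n)" using c0 by (simp add: right_diff_distrib)
    then show ?thesis by (metis mult)
  qed
  then have "(\<lambda>n. v (inverse c * x - s (r n))) \<longlonglongrightarrow> 0"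
    using tendsto_mult_left[OF x(3), of "v (inverse c)"] by simp
  moreover have "inverse c * x \<in> padic_numbers v" using mulF invF cF x by blast
  ultimately show "\<exists>x\<in>padic_numbers v. \<exists>r. strict_mono r \<and> (\<lambda>n. v (x - s (r n))) \<longlonglongrightarrow> 0" using x(2) by blast
qed

lemma finite_extension_seq_compact:
  assumes "finite_extension (padic_numbers v) K" shows "seq_compact_set K"
  using assms padic_seq_compact seq_compact_span unfolding finite_extension_def by blast

text \<open>By compactness the supremum of the values below 1 is attained on \<open>K\<close>, and
  an element \<open>\<pi>\<close> that attains it is a uniformizer.\<close>

lemma discrete_values:
  assumes K: "is_subfield K" "seq_compact_set K"
  obtains \<pi> where "\<pi> \<in> K" "0 < v \<pi>" "v \<pi> < 1" "\<And>x. x \<in> K \<Longrightarrow> x \<noteq> 0 \<Longrightarrow> v x \<le> 1 \<Longrightarrow> \<exists>k. v x = v \<pi> ^ k"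
proof -
  have K0: "0 \<in> K" "1 \<in> K" and mulK: "\<And>x y. x \<in> K \<Longrightarrow> y \<in> K \<Longrightarrow> x * y \<in> K" and addK: "\<And>x y. x \<in> K \<Longrightarrow> y \<in> K \<Longrightarrow> x + y \<in> K"
    and invK: "\<And>x. x \<in> K \<Longrightarrow> inverse x \<in> K" using K unfolding is_subfield_def by blast+
  let ?S = "v ` {x \<in> K. v x < 1}"
  have "of_nat n \<in> K" for n by (induction n) (auto simp: K0 addK)
  then have pS: "1 / real p \<in> ?S" using abs_p p_gt_1 by (intro image_eqI[of _ _ "of_nat p"]) auto
  have bdd: "bdd_above ?S" by (rule bdd_aboveI[of _ 1]) auto
  define S where "S = Sup ?S"
  have Sp: "1 / real p \<le> S" unfolding S_def using pS bdd by (rule cSup_upper)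
  then have S0: "0 < S" using p_gt_1 by (meson less_le_trans zero_less_divide_1_iff less_trans zero_less_one)
  have "\<forall>n. \<exists>x\<in>K. v x < 1 \<and> S - 1 / real (Suc n) < v x"
  proof
    fix n
    have "S - 1 / real (Suc n) < Sup ?S" by (simp add: S_def)
    then obtain y where "y \<in> ?S" "S - 1 / real (Suc n) < y" using less_cSupD[of ?S] pS by blast
    then show "\<exists>x\<in>K. v x < 1 \<and> S - 1 / real (Suc n) < v x" by blast
  qed
  then obtain s where s: "\<And>n. s n \<in> K" "\<And>n. v (s n) < 1" "\<And>n. S - 1 / real (Suc n) < v (s n)" by metis
  obtain \<pi> r where r: "\<pi> \<in> K" "strict_mono r" "(\<lambda>n. v (\<pi> - s (r n))) \<longlonglongrightarrow> 0"
    by (rule seq_compact_setD[OF K(2) s(1) less_imp_le[OF s(2)]])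
  obtain N1 where N1: "\<And>n. n \<ge> N1 \<Longrightarrow> v (\<pi> - s (r n)) < S / 2" using v_tendsto_bound[OF r(3), of "S / 2"] S0 by auto
  have "(\<lambda>n. 1 / real (Suc n)) \<longlonglongrightarrow> 0" by (rule LIMSEQ_Suc[OF lim_1_over_n])
  then have lim: "(\<lambda>n. 1 / real (Suc (r n))) \<longlonglongrightarrow> 0" using LIMSEQ_subseq_LIMSEQ[OF _ r(2)] by (fastforce simp: o_def)
  have "0 < S / 2" using S0 by simp
  from order_tendstoD(2)[OF lim this] obtain N2 where N2: "\<And>n. n \<ge> N2 \<Longrightarrow> 1 / real (Suc (r n)) < S / 2"
    unfolding eventually_sequentially by blast
  \<comment> \<open>An ultrametric absolute value is locally constant off 0, so the limit has
    exactly the value of the late terms and stays below 1.\<close>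
  have eq: "v \<pi> = v (s (r n))" if n: "n \<ge> max N1 N2" for n
  proof (rule v_close)
    have "S / 2 < v (s (r n))" using s(3)[of "r n"] N2[of n] n by (simp del: of_nat_Suc)
    then show "v (\<pi> - s (r n)) < v (s (r n))" using N1[of n] n by simp
  qed
  have "S \<le> v \<pi>"
  proof (rule LIMSEQ_le[OF _ tendsto_const])
    show "(\<lambda>n. S - 1 / real (Suc (r n))) \<longlonglongrightarrow> S" using tendsto_diff[OF tendsto_const lim] by fastforce
    show "\<exists>N. \<forall>n\<ge>N. S - 1 / real (Suc (r n)) \<le> v \<pi>" using eq s(3) by (metis less_imp_le)
  qed
  moreover have \<pi>1: "v \<pi> < 1" using eq[of "max N1 N2"] s(2) by simp
  ultimately have \<pi>: "0 < v \<pi>" using S0 by linarith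
  have max: "v x \<le> v \<pi>" if "x \<in> K" "v x < 1" for x
    using cSup_upper[OF _ bdd, of "v x"] that \<open>S \<le> v \<pi>\<close> unfolding S_def[symmetric] by force
  have "\<exists>k. v x = v \<pi> ^ k" if x: "x \<in> K" "x \<noteq> 0" "v x \<le> 1" for x
  proof -
    have "\<exists>k. v \<pi> ^ k < v x" using real_arch_pow_inv[OF v_pos[OF x(2)] \<pi>1] .
    \<comment> \<open>With \<open>k = Suc j\<close>, the quotient of \<open>x\<close> by
      \<open>\<pi> ^ j\<close> has a value above \<open>v \<pi>\<close> and at most 1; by maximality
      of \<open>v \<pi>\<close> among the values below 1 it equals 1.\<close>
    define k where "k = (LEAST k. v \<pi> ^ k < v x)"
    have k: "v \<pi> ^ k < v x" unfolding k_def using \<open>\<exists>k. v \<pi> ^ k < v x\<close> by (rule LeastI_ex)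
    have "k \<noteq> 0" using k x(3) by (cases k) auto
    then obtain j where j: "k = Suc j" by (cases k) auto
    have j2: "v x \<le> v \<pi> ^ j" using not_less_Least[of j "\<lambda>k. v \<pi> ^ k < v x"] j unfolding k_def by simp
    let ?y = "x * inverse (\<pi> ^ j)"
    have pj: "\<pi> ^ j \<in> K" by (induction j) (auto simp: K0 mulK r(1))
    have vy: "v ?y = v x / v \<pi> ^ j" by (simp add: mult v_inverse v_power divide_inverse)
    have "v \<pi> < v ?y" using k \<pi> unfolding vy j by (simp add: field_simps)
    then have "\<not> v ?y < 1" using max[of ?y] mulK invK pj x(1) by (meson not_less)
    moreover have "v ?y \<le> 1" using j2 \<pi> unfolding vy by (simp add: field_simps)
    ultimately have "v x / v \<pi> ^ j = 1" unfolding vy by linarith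
    moreover have "v \<pi> ^ j \<noteq> 0" using \<pi> by simp
    ultimately show ?thesis by (metis mult_1 nonzero_divide_eq_eq)
  qed
  then show ?thesis using that r(1) \<pi> \<pi>1 by blast
qed

end

section \<open>Local behaviour of rational maps\<close>

definition inv_pt :: "'a::field \<Rightarrow> 'a proj_line" where
  "inv_pt w = (if w = 0 then Infty else Pt (1 / w))"

section \<open>Charts of the projective line and local forms of quotients\<close>

context nonarch_abs begin

abbreviation sd :: "'a proj_line \<Rightarrow> 'a proj_line \<Rightarrow> real" where "sd \<equiv> spherical_dist v"

lemma sd_inv_pt: assumes "v w \<le> 1" "v z \<le> 1" shows "sd (inv_pt w) (inv_pt z) = v (w - z)"
proof -
  have m: "max (v (1 / w)) 1 = 1 / v w" if "w \<noteq> 0" "v w \<le> 1" for w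
    using v_pos[OF that(1)] that(2) by (simp add: v_divide field_simps max_def)
  consider "w = 0" "z = 0" | "w = 0" "z \<noteq> 0" | "w \<noteq> 0" "z = 0" | "w \<noteq> 0" "z \<noteq> 0" by blast
  then show ?thesis
  proof cases
    case 2
    then show ?thesis using v_pos[of z] assms by (auto simp: inv_pt_def v_divide field_simps)
  next
    case 3
    then show ?thesis using v_pos[of w] assms by (auto simp: inv_pt_def v_divide field_simps)
  next
    case 4
    have "1 / w - 1 / z = (z - w) / (w * z)" using 4 by (simp add: field_simps)
    then have "v (1 / w - 1 / z) = v (w - z) / (v w * v z)" using v_diff_commute[of w z] by (simp add: v_divide mult)
    then show ?thesis using 4 m assms v_pos[of w] v_pos[of z] by (simp add: inv_pt_def)
  qed (auto simp: inv_pt_def)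
qed

text \<open>A constant scale \<open>S\<close>, instead of an isometry, admits the affine coordinate
  also at points with \<open>v x > 1\<close>. Covering is demanded for the open ball only, since
  later radii stay strictly below \<open>S\<close>.\<close>

definition chart :: "'a proj_line \<Rightarrow> ('a \<Rightarrow> 'a proj_line) \<Rightarrow> real \<Rightarrow> bool" where
  "chart c \<sigma> S \<longleftrightarrow> \<sigma> 0 = c \<and> 0 < S \<and> (\<forall>s t. v s \<le> 1 \<longrightarrow> v t \<le> 1 \<longrightarrow> sd (\<sigma> s) (\<sigma> t) = S * v (s - t)) \<and>
     (\<forall>z. sd c z < S \<longrightarrow> (\<exists>s. v s \<le> 1 \<and> z = \<sigma> s))"

lemma chart_Infty: "chart Infty inv_pt 1"
  unfolding chart_def
proof (intro conjI allI impI)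
  show "\<exists>s. v s \<le> 1 \<and> z = inv_pt s" if "sd Infty z < 1" for z
  proof (cases z)
    case (Pt y)
    then have y: "1 < v y" using that by (auto split: if_splits)
    then have "y \<noteq> 0" by auto
    then have "v (1 / y) \<le> 1" "z = inv_pt (1 / y)" using y Pt by (auto simp: v_divide inv_pt_def)
    then show ?thesis by blast
  qed (auto intro: exI[of _ 0] simp: inv_pt_def)
qed (auto simp: inv_pt_def sd_inv_pt[unfolded inv_pt_def])

text \<open>For \<open>v s \<le> 1\<close> the factor \<open>max (v (x + s)) 1\<close> keeps its
  value at \<open>s = 0\<close>, whence the constant scale; a point closer to \<open>x\<close> than
  this scale is finite and differs from \<open>x\<close> by less than 1.\<close>

lemma chart_Pt: "chart (Pt x) (\<lambda>s. Pt (x + s)) (1 / (max (v x) 1)\<^sup>2)"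
proof -
  define M where "M = max (v x) 1"
  have M: "1 \<le> M" by (simp add: M_def)
  have near: "max (v (x + s)) 1 = M" if "v s \<le> 1" for s
  proof (cases "v x \<le> 1")
    case True
    then show ?thesis using v_le[OF True that] by (simp add: M_def)
  next
    case False
    then have "v s < v x" using that by simp
    then have "v (s + x) = v x" by (rule v_add_eq)
    then show ?thesis by (simp add: M_def add.commute)
  qed
  have 1: "sd (Pt (x + s)) (Pt (x + t)) = 1 / M\<^sup>2 * v (s - t)" if "v s \<le> 1" "v t \<le> 1" for s t
    using near that by (simp add: power2_eq_square)
  have 2: "\<exists>s. v s \<le> 1 \<and> z = Pt (x + s)" if z: "sd (Pt x) z < 1 / M\<^sup>2" for z
  proof (cases z)
    case (Pt y)
    define N where "N = max (v y) 1"
    have N: "1 \<le> N" by (simp add: N_def)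
    have "v (x - y) / (M * N) < 1 / M\<^sup>2" using z Pt by (simp add: M_def N_def)
    then have lt: "v (x - y) * M < N" using M N by (simp add: field_simps power2_eq_square)
    have "N \<le> M"
    proof (rule ccontr)
      assume "\<not> N \<le> M"
      then have "v x < v y" "N = v y" by (auto simp: M_def N_def max_def split: if_splits)
      then have "v (x - y) = v y" using v_add_eq[of x "- y"] by simp
      moreover have "v y * 1 \<le> v y * M" using M by (intro mult_left_mono nonneg)
      ultimately show False using lt \<open>N = v y\<close> by simp
    qed
    then have "v (x - y) * M < 1 * M" using lt by simp
    then have "v (x - y) < 1" using M by simp
    then have "v (y - x) \<le> 1" using v_diff_commute[of x y] by simp
    then show ?thesis using Pt by (intro exI[of _ "y - x"]) simp
  next
    case Infty
    have "1 / M\<^sup>2 \<le> 1 / M" using M by (simp add: field_simps power2_eq_square)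
    moreover have "sd (Pt x) Infty = 1 / M" by (auto simp: M_def max_def)
    ultimately show ?thesis using z Infty by simp
  qed
  show ?thesis unfolding chart_def M_def[symmetric] using M 1 2 by auto
qed

lemma chart_centre: "chart c \<sigma> S \<Longrightarrow> v s \<le> 1 \<Longrightarrow> sd c (\<sigma> s) = S * v s"
  unfolding chart_def by (metis diff_0 nonneg v_minus v_zero zero_le_one)

lemma poly_lipschitz: "\<exists>L\<ge>0. \<forall>s t. v s \<le> 1 \<longrightarrow> v t \<le> 1 \<longrightarrow> v (poly p (x + s) - poly p (x + t)) \<le> L * v (s - t)"
proof (induction p)
  case 0 show ?case by (intro exI[of _ 0]) simp
next
  case (pCons a p)
  then obtain L where L: "L \<ge> 0" "\<And>s t. v s \<le> 1 \<Longrightarrow> v t \<le> 1 \<Longrightarrow> v (poly p (x + s) - poly p (x + t)) \<le> L * v (s - t)" by blast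
  define M where "M = max (v x) 1"
  have M: "0 \<le> M" "v (x + s) \<le> M" if "v s \<le> 1" for s using v_le[of x M s] that by (auto simp: M_def)
  have M0: "0 \<le> M" by (simp add: M_def)
  define B where "B = max (v (poly p x)) L"
  have B: "v (poly p (x + t)) \<le> B" if t: "v t \<le> 1" for t
  proof -
    have "v (poly p (x + t) - poly p (x + 0)) \<le> L * v (t - 0)" using L(2)[of t 0] t by simp
    also have "\<dots> \<le> L * 1" using t L(1) by (intro mult_left_mono) auto
    finally have "v (poly p (x + t) - poly p x) \<le> B" by (simp add: B_def)
    then show ?thesis using v_le[of "poly p (x + t) - poly p x" B "poly p x"] by (simp add: B_def)
  qed
  have "v (poly (pCons a p) (x + s) - poly (pCons a p) (x + t)) \<le> max (M * L) B * v (s - t)"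
    if st: "v s \<le> 1" "v t \<le> 1" for s t
  proof -
    have eq: "poly (pCons a p) (x + s) - poly (pCons a p) (x + t) =
      (x + s) * (poly p (x + s) - poly p (x + t)) + (s - t) * poly p (x + t)" by (simp add: algebra_simps)
    have 1: "v ((x + s) * (poly p (x + s) - poly p (x + t))) \<le> max (M * L) B * v (s - t)"
    proof -
      have "v (x + s) * v (poly p (x + s) - poly p (x + t)) \<le> M * (L * v (s - t))"
        using M st L M0 by (intro mult_mono nonneg) auto
      also have "\<dots> \<le> max (M * L) B * v (s - t)" unfolding mult.assoc[symmetric] by (intro mult_right_mono nonneg) simp
      finally show ?thesis by (simp add: mult)
    qed
    have 2: "v ((s - t) * poly p (x + t)) \<le> max (M * L) B * v (s - t)"
    proof -
      have "v (s - t) * v (poly p (x + t)) \<le> v (s - t) * max (M * L) B"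
        using B[OF st(2)] by (intro mult_left_mono nonneg) simp
      then show ?thesis by (simp add: mult mult.commute)
    qed
    show ?thesis unfolding eq by (rule v_le[OF 1 2])
  qed
  moreover have "0 \<le> max (M * L) B" using M0 L(1) by (simp add: le_max_iff_disj)
  ultimately show ?case by blast
qed

text \<open>Replaces the power series expansion at a zero of order \<open>m\<close>: a Lipschitz
  cofactor that does not vanish at 0 gives all the estimates required.\<close>

definition power_form :: "('a \<Rightarrow> 'a) \<Rightarrow> nat \<Rightarrow> bool" where
  "power_form g m \<longleftrightarrow> (\<exists>R L r. 0 < r \<and> r \<le> 1 \<and> 0 \<le> L \<and> R 0 \<noteq> 0 \<and> (\<forall>s. v s \<le> r \<longrightarrow> g s = s ^ m * R s) \<and>
     (\<forall>s t. v s \<le> r \<longrightarrow> v t \<le> r \<longrightarrow> v (R s - R t) \<le> L * v (s - t)))"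

text \<open>The cofactor \<open>R\<close> is the quotient of \<open>N\<close>, freed from its zero
  at \<open>x\<close>, by \<open>D\<close>. It is Lipschitz because \<open>D\<close> has constant
  absolute value near \<open>x\<close>.\<close>

lemma power_form_poly:
  assumes D: "poly D x \<noteq> 0" and N: "N \<noteq> 0"
  shows "power_form (\<lambda>s. poly N (x + s) / poly D (x + s)) (order x N)"
proof -
  obtain E where E: "N = [:- x, 1:] ^ order x N * E" "\<not> [:- x, 1:] dvd E" using order_decomp[OF N] by blast
  have E0: "poly E x \<noteq> 0" using E(2) by (simp add: poly_eq_0_iff_dvd)
  have Nx: "poly N (x + s) = s ^ order x N * poly E (x + s)" for s
    by (subst E(1)) (simp add: poly_power)
  obtain LE where LE: "LE \<ge> 0" "\<And>s t. v s \<le> 1 \<Longrightarrow> v t \<le> 1 \<Longrightarrow> v (poly E (x + s) - poly E (x + t)) \<le> LE * v (s - t)"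
    using poly_lipschitz by blast
  obtain LD where LD: "LD \<ge> 0" "\<And>s t. v s \<le> 1 \<Longrightarrow> v t \<le> 1 \<Longrightarrow> v (poly D (x + s) - poly D (x + t)) \<le> LD * v (s - t)"
    using poly_lipschitz by blast
  define dx where "dx = v (poly D x)"
  have dx: "0 < dx" using v_pos[OF D] by (simp add: dx_def)
  \<comment> \<open>On this disc \<open>D\<close> varies by less than its absolute value
    \<open>dx\<close> at \<open>x\<close>.\<close>
  define r where "r = min 1 (dx / (2 * (LD + 1)))"
  have r: "0 < r" "r \<le> 1" using dx LD(1) by (auto simp: r_def)
  have vD: "v (poly D (x + s)) = dx" if s: "v s \<le> r" for s
  proof -
    have "v (poly D (x + s) - poly D (x + 0)) \<le> LD * v (s - 0)" using LD(2)[of s 0] s r by simp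
    also have "\<dots> \<le> LD * (dx / (2 * (LD + 1)))" using s LD(1) by (intro mult_left_mono) (auto simp: r_def)
    also have "\<dots> < dx" using dx LD(1)
      by (simp add: divide_less_eq mult.commute[of LD] distrib_left add_nonneg_pos)
    finally show ?thesis unfolding dx_def using v_close[of "poly D (x + s)" "poly D x"] by simp
  qed
  define B where "B = max (v (poly E x)) LE"
  have B: "v (poly E (x + t)) \<le> B" if t: "v t \<le> 1" for t
  proof -
    have "v (poly E (x + t) - poly E (x + 0)) \<le> LE * v (t - 0)" using LE(2)[of t 0] t by simp
    also have "\<dots> \<le> LE * 1" using t LE(1) by (intro mult_left_mono) auto
    finally have "v (poly E (x + t) - poly E x) \<le> B" by (simp add: B_def)
    then show ?thesis using v_le[of "poly E (x + t) - poly E x" B "poly E x"] by (simp add: B_def)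
  qed
  define R where "R s = poly E (x + s) / poly D (x + s)" for s
  define L where "L = max (LE * dx) (B * LD) / dx ^ 2"
  have B0: "0 \<le> B" using LE(1) by (simp add: B_def le_max_iff_disj)
  have lip: "v (R s - R t) \<le> L * v (s - t)" if st: "v s \<le> r" "v t \<le> r" for s t
  proof -
    have st1: "v s \<le> 1" "v t \<le> 1" using st r by auto
    have nz: "poly D (x + s) \<noteq> 0" "poly D (x + t) \<noteq> 0" using vD st dx by (metis less_irrefl v_zero)+
    have "R s - R t = ((poly E (x + s) - poly E (x + t)) * poly D (x + t) - poly E (x + t) * (poly D (x + s) - poly D (x + t)))
        / (poly D (x + s) * poly D (x + t))"
      using nz by (simp add: R_def field_simps)
    then have eq: "v (R s - R t) = v ((poly E (x + s) - poly E (x + t)) * poly D (x + t) - poly E (x + t) * (poly D (x + s) - poly D (x + t))) / dx ^ 2"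
      using vD st by (simp add: v_divide mult power2_eq_square)
    have 1: "v ((poly E (x + s) - poly E (x + t)) * poly D (x + t)) \<le> max (LE * dx) (B * LD) * v (s - t)"
    proof -
      have "v (poly E (x + s) - poly E (x + t)) * dx \<le> (LE * v (s - t)) * dx"
        using LE(2)[OF st1] dx by (intro mult_right_mono) auto
      also have "\<dots> = (LE * dx) * v (s - t)" by simp
      also have "\<dots> \<le> max (LE * dx) (B * LD) * v (s - t)" by (intro mult_right_mono nonneg) simp
      finally show ?thesis using vD[OF st(2)] by (simp add: mult)
    qed
    have 2: "v (poly E (x + t) * (poly D (x + s) - poly D (x + t))) \<le> max (LE * dx) (B * LD) * v (s - t)"
    proof -
      have "v (poly E (x + t)) * v (poly D (x + s) - poly D (x + t)) \<le> B * (LD * v (s - t))"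
        using B[OF st1(2)] LD(2)[OF st1] B0 by (intro mult_mono nonneg) auto
      also have "\<dots> = (B * LD) * v (s - t)" by simp
      also have "\<dots> \<le> max (LE * dx) (B * LD) * v (s - t)" by (intro mult_right_mono nonneg) simp
      finally show ?thesis by (simp add: mult)
    qed
    show ?thesis unfolding eq L_def using v_diff_le[OF 1 2] dx by (simp add: divide_right_mono)
  qed
  have "0 \<le> L" using LE(1) dx by (auto simp: L_def le_max_iff_disj)
  moreover have "R 0 \<noteq> 0" using E0 D by (simp add: R_def)
  moreover have "poly N (x + s) / poly D (x + s) = s ^ order x N * R s" for s by (simp add: Nx R_def)
  ultimately show ?thesis unfolding power_form_def using r lip by blast
qed

end

section \<open>Estimates for power forms and solvability over \<open>K\<close>\<close>

locale nonarch_abs_char_0 = nonarch_abs v for v :: "'a::field_char_0 \<Rightarrow> real"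
begin

lemma v_sum_le: "finite I \<Longrightarrow> (\<And>i. i \<in> I \<Longrightarrow> v (h i) \<le> r) \<Longrightarrow> 0 \<le> r \<Longrightarrow> v (sum h I) \<le> r"
  by (induction I rule: finite_induct) (auto intro: v_le)

lemma power_diff_factor: "s ^ m - t ^ m = (s - t) * (\<Sum>i<m. s ^ i * t ^ (m - 1 - i))" for s t :: 'a
proof (cases m)
  case (Suc n)
  then show ?thesis using diff_power_eq_sum[of s n t] by (simp only: diff_Suc_1)
qed simp

text \<open>The factor \<open>v b\<close> on the left avoids the exponent \<open>i - 1\<close> and
  so the special case \<open>i = 0\<close>.\<close>

lemma v_power_diff:
  assumes "v s = v b" "v (s - b) \<le> \<rho>" shows "v (s ^ i - b ^ i) * v b \<le> \<rho> * v b ^ i"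
proof (induction i)
  case 0
  have "0 \<le> \<rho>" using assms nonneg[of "s - b"] by linarith
  then show ?case by simp
next
  case (Suc i)
  have eq: "(s ^ Suc i - b ^ Suc i) * b = s * ((s ^ i - b ^ i) * b) + (s - b) * b ^ Suc i" by (simp add: algebra_simps)
  have 1: "v (s * ((s ^ i - b ^ i) * b)) \<le> \<rho> * v b ^ Suc i"
    using mult_left_mono[OF Suc nonneg[of b]] assms by (simp add: mult mult_ac)
  have 2: "v ((s - b) * b ^ Suc i) \<le> \<rho> * v b ^ Suc i"
    using mult_right_mono[OF assms(2), of "v b ^ Suc i"] nonneg[of b] by (simp add: mult v_power)
  show ?case using v_le[OF 1 2] unfolding eq[symmetric] by (simp add: mult)
qed

text \<open>The third estimate is the delicate one: on a disc of radius below
  \<open>v (of_nat m) * v b\<close> about \<open>b\<close> the map is linear up to a strictly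
  smaller error, so it is a similarity there. For \<open>m = 1\<close> this holds on every small
  disc, including those centred at the zero.\<close>

lemma power_form_local:
  assumes g: "power_form g m" and m: "1 \<le> m"
  shows "\<exists>a r. 0 < a \<and> 0 < r \<and> r \<le> 1 \<and> (\<forall>s. v s \<le> r \<longrightarrow> v (g s) = a * v s ^ m) \<and>
    (\<forall>s t. v s \<le> r \<longrightarrow> v t \<le> r \<longrightarrow> v (g s - g t) \<le> a * max (v s) (v t) ^ (m - 1) * v (s - t)) \<and>
    (\<forall>b \<rho>. v b \<le> r \<longrightarrow> 0 < \<rho> \<longrightarrow> (m = 1 \<and> \<rho> \<le> r) \<or> \<rho> < v (of_nat m) * v b \<longrightarrow>
       (\<exists>\<gamma>. v \<gamma> = v (of_nat m) * a * v b ^ (m - 1) \<and> 0 < v \<gamma> \<and>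
         (\<forall>s t. v (s - b) \<le> \<rho> \<longrightarrow> v (t - b) \<le> \<rho> \<longrightarrow> s \<noteq> t \<longrightarrow> v ((g s - g t) - \<gamma> * (s - t)) < v \<gamma> * v (s - t))))"
proof -
  obtain R L r0 where r0: "0 < r0" "r0 \<le> 1" "0 \<le> L" "R 0 \<noteq> 0" and gR: "\<And>s. v s \<le> r0 \<Longrightarrow> g s = s ^ m * R s"
    and RL: "\<And>s t. v s \<le> r0 \<Longrightarrow> v t \<le> r0 \<Longrightarrow> v (R s - R t) \<le> L * v (s - t)"
    using g unfolding power_form_def by blast
  define a where "a = v (R 0)"
  define \<mu> where "\<mu> = v (of_nat m)"
  have a: "0 < a" using v_pos r0(4) by (simp add: a_def)
  have \<mu>: "0 < \<mu>" "\<mu> \<le> 1" using v_pos[of "of_nat m"] v_of_int_le[of "int m"] m by (auto simp: \<mu>_def)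
  \<comment> \<open>Keeps the variation \<open>L * r\<close> of \<open>R\<close> below
    \<open>\<mu> * a\<close>, and hence also below its absolute value \<open>a\<close> at 0.\<close>
  define r where "r = min r0 (\<mu> * a / (2 * (L + 1)))"
  have r: "0 < r" "r \<le> r0" "r \<le> 1" using r0 a \<mu> by (auto simp: r_def)
  have "L * r \<le> L * (\<mu> * a / (2 * (L + 1)))" using r0(3) by (intro mult_left_mono) (auto simp: r_def)
  also have "\<dots> < \<mu> * a" using r0(3) mult_pos_pos[OF \<mu>(1) a]
    by (simp add: divide_less_eq mult.commute[of L]) (simp add: distrib_left add_nonneg_pos)
  finally have Lr: "L * r < \<mu> * a" .
  have \<mu>a: "\<mu> * a \<le> a" using \<mu> a by simp
  have Rsmall: "v (R s - R 0) < \<mu> * a" if s: "v s \<le> r" for s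
  proof -
    have "v (R s - R 0) \<le> L * v s" using RL[of s 0] s r r0 by simp
    also have "\<dots> \<le> L * r" using s r0(3) by (intro mult_left_mono)
    finally show ?thesis using Lr by linarith
  qed
  have vR: "v (R s) = a" if "v s \<le> r" for s
    using Rsmall[OF that] \<mu>a v_close[of "R s" "R 0"] by (simp add: a_def)
  have 1: "v (g s) = a * v s ^ m" if "v s \<le> r" for s
    using gR[of s] vR[OF that] that r by (simp add: mult v_power mult.commute)
  have pw: "M * M ^ (m - 1) = M ^ m" for M :: real using m by (cases m) auto
  have 2: "v (g s - g t) \<le> a * max (v s) (v t) ^ (m - 1) * v (s - t)" if st: "v s \<le> r" "v t \<le> r" for s t
  proof -
    define M where "M = max (v s) (v t)"
    have M: "0 \<le> M" "v s \<le> M" "v t \<le> M" "M \<le> r" using nonneg[of s] st by (auto simp: M_def le_max_iff_disj)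
    have eq: "g s - g t = (s ^ m - t ^ m) * R s + t ^ m * (R s - R t)"
      using gR st r by (simp add: algebra_simps)
    have "v (\<Sum>i<m. s ^ i * t ^ (m - 1 - i)) \<le> M ^ (m - 1)"
    proof (rule v_sum_le)
      fix i assume i: "i \<in> {..<m}"
      have "v s ^ i * v t ^ (m - 1 - i) \<le> M ^ i * M ^ (m - 1 - i)"
        using M nonneg by (intro mult_mono power_mono) auto
      also have "\<dots> = M ^ (m - 1)" using i by (simp flip: power_add)
      finally show "v (s ^ i * t ^ (m - 1 - i)) \<le> M ^ (m - 1)" by (simp add: mult v_power)
    qed (use M in auto)
    then have "v (s - t) * v (\<Sum>i<m. s ^ i * t ^ (m - 1 - i)) * a \<le> v (s - t) * M ^ (m - 1) * a"
      using a by (intro mult_right_mono mult_left_mono nonneg) auto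
    then have A: "v ((s ^ m - t ^ m) * R s) \<le> a * M ^ (m - 1) * v (s - t)"
      unfolding power_diff_factor using vR[OF st(1)] by (simp add: mult mult_ac)
    have "v t ^ m * v (R s - R t) \<le> M ^ m * (L * v (s - t))"
      using M nonneg RL st r by (intro mult_mono power_mono) auto
    also have "\<dots> = (L * M) * (M ^ (m - 1) * v (s - t))" using pw[of M] by (simp add: mult_ac)
    also have "\<dots> \<le> a * (M ^ (m - 1) * v (s - t))"
    proof -
      have "L * M \<le> L * r" using M r0(3) by (intro mult_left_mono)
      then have "L * M \<le> a" using Lr \<mu>a by linarith
      then show ?thesis using M nonneg by (intro mult_right_mono) auto
    qed
    finally have B: "v (t ^ m * (R s - R t)) \<le> a * M ^ (m - 1) * v (s - t)" by (simp add: mult v_power mult.assoc)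
    show ?thesis unfolding eq M_def[symmetric] by (rule v_le[OF A B])
  qed
  have 3: "\<exists>\<gamma>. v \<gamma> = v (of_nat m) * a * v b ^ (m - 1) \<and> 0 < v \<gamma> \<and>
         (\<forall>s t. v (s - b) \<le> \<rho> \<longrightarrow> v (t - b) \<le> \<rho> \<longrightarrow> s \<noteq> t \<longrightarrow> v ((g s - g t) - \<gamma> * (s - t)) < v \<gamma> * v (s - t))"
    if b: "v b \<le> r" and \<rho>: "0 < \<rho>" "(m = 1 \<and> \<rho> \<le> r) \<or> \<rho> < v (of_nat m) * v b" for b \<rho>
  proof -
    \<comment> \<open>The derivative at \<open>b\<close> of the leading term
      \<open>s ^ m * R 0\<close>.\<close>
    define \<gamma> where "\<gamma> = of_nat m * b ^ (m - 1) * R 0"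
    have v\<gamma>: "v \<gamma> = \<mu> * a * v b ^ (m - 1)" by (simp add: \<gamma>_def mult v_power \<mu>_def a_def)
    have vb: "m = 1 \<or> 0 < v b"
    proof (rule disjCI)
      assume "\<not> 0 < v b"
      then have "v b = 0" using nonneg[of b] by linarith
      then show "m = 1" using \<rho> by auto
    qed
    then have bm: "0 < v b ^ (m - 1)" by auto
    have \<gamma>0: "0 < v \<gamma>" unfolding v\<gamma> using a \<mu> bm by simp
    have D: "v s \<le> r \<and> (m = 1 \<or> v s = v b)" if s: "v (s - b) \<le> \<rho>" for s
    proof (cases "m = 1 \<and> \<rho> \<le> r")
      case True
      have "v (s - b + b) \<le> r" using s True b by (intro v_le) auto
      then show ?thesis using True by simp
    next
      case False
      then have "\<rho> < \<mu> * v b" using \<rho> by (auto simp: \<mu>_def)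
      also have "\<dots> \<le> 1 * v b" using \<mu> by (intro mult_right_mono nonneg)
      finally have "v (s - b) < v b" using s by simp
      then have "v s = v b" by (rule v_close)
      then show ?thesis using b by simp
    qed
    have main: "v ((g s - g t) - \<gamma> * (s - t)) < v \<gamma> * v (s - t)"
      if s: "v (s - b) \<le> \<rho>" and t: "v (t - b) \<le> \<rho>" and st: "s \<noteq> t" for s t
    proof -
      have sr: "v s \<le> r" "v t \<le> r" using D s t by auto
      have d0: "0 < v (s - t)" using st v_pos by simp
      define \<Sigma> where "\<Sigma> = (\<Sum>i<m. s ^ i * t ^ (m - 1 - i))"
      have gs: "g s - g t = (s ^ m - t ^ m) * R s + t ^ m * (R s - R t)"
        using gR sr r by (simp add: algebra_simps)
      \<comment> \<open>Three error terms: the first is small by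
        \<open>\<rho> < \<mu> * v b\<close>, and zero for \<open>m = 1\<close>; the other two are
        small by \<open>L * r < \<mu> * a\<close>.\<close>
      have eq: "(g s - g t) - \<gamma> * (s - t) = ((s - t) * (\<Sigma> - of_nat m * b ^ (m - 1)) * R s +
          (s - t) * (of_nat m * b ^ (m - 1)) * (R s - R 0)) + t ^ m * (R s - R t)"
        unfolding gs power_diff_factor \<Sigma>_def[symmetric] \<gamma>_def by (simp add: algebra_simps)
      have 1: "v ((s - t) * (\<Sigma> - of_nat m * b ^ (m - 1)) * R s) < v \<gamma> * v (s - t)"
      proof (cases "m = 1")
        case True
        then have "\<Sigma> - of_nat m * b ^ (m - 1) = 0" by (simp add: \<Sigma>_def)
        then show ?thesis using \<gamma>0 d0 by simp
      next
        case False
        then have vbp: "0 < v b" and vs: "v s = v b" "v t = v b" using vb D s t by auto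
        have \<rho>': "\<rho> < \<mu> * v b" using \<rho> False by (simp add: \<mu>_def)
        have "\<Sigma> - of_nat m * b ^ (m - 1) = (\<Sum>i<m. s ^ i * t ^ (m - 1 - i) - b ^ (m - 1))"
          by (simp add: \<Sigma>_def sum_subtractf)
        then have "v (\<Sigma> - of_nat m * b ^ (m - 1)) \<le> \<rho> * v b ^ (m - 1) / v b"
        proof (simp only:, intro v_sum_le)
          fix i assume i: "i \<in> {..<m}"
          define j where "j = m - 1 - i"
          have ij: "m - 1 = i + j" using i by (auto simp: j_def)
          have e: "(s ^ i * t ^ j - b ^ (i + j)) * b = t ^ j * ((s ^ i - b ^ i) * b) + b ^ i * ((t ^ j - b ^ j) * b)"
            by (simp add: algebra_simps power_add)
          have "v (t ^ j * ((s ^ i - b ^ i) * b)) \<le> \<rho> * v b ^ (i + j)"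
            using mult_left_mono[OF v_power_diff[OF vs(1) s, of i], of "v b ^ j"] vbp vs
            by (simp add: mult v_power power_add mult_ac)
          moreover have "v (b ^ i * ((t ^ j - b ^ j) * b)) \<le> \<rho> * v b ^ (i + j)"
            using mult_left_mono[OF v_power_diff[OF vs(2) t, of j], of "v b ^ i"] vbp vs
            by (simp add: mult v_power power_add mult_ac)
          ultimately have "v ((s ^ i * t ^ j - b ^ (i + j)) * b) \<le> \<rho> * v b ^ (i + j)"
            unfolding e by (rule v_le)
          then show "v (s ^ i * t ^ (m - 1 - i) - b ^ (m - 1)) \<le> \<rho> * v b ^ (m - 1) / v b"
            unfolding ij add_diff_cancel_left' by (simp only: mult pos_le_divide_eq[OF vbp])
        qed (use \<rho> vbp in auto)
        also have "\<dots> < \<mu> * v b ^ (m - 1)"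
          using \<rho>' vbp bm by (simp add: field_simps)
        finally have "v (\<Sigma> - of_nat m * b ^ (m - 1)) < \<mu> * v b ^ (m - 1)" .
        then have "v (\<Sigma> - of_nat m * b ^ (m - 1)) * (v (s - t) * a) < \<mu> * v b ^ (m - 1) * (v (s - t) * a)"
          using d0 a by (intro mult_strict_right_mono) auto
        then show ?thesis unfolding v\<gamma> using vR[OF sr(1)] by (simp add: mult mult_ac)
      qed
      have "v (R s - R 0) < a" using Rsmall[OF sr(1)] \<mu>a by linarith
      then have "v (R s - R 0) * (v (s - t) * \<mu> * v b ^ (m - 1)) < a * (v (s - t) * \<mu> * v b ^ (m - 1))"
        using d0 \<mu> bm by (intro mult_strict_right_mono) auto
      then have 2: "v ((s - t) * (of_nat m * b ^ (m - 1)) * (R s - R 0)) < v \<gamma> * v (s - t)"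
        unfolding v\<gamma> by (simp add: mult v_power \<mu>_def mult_ac)
      have 3: "v (t ^ m * (R s - R t)) < v \<gamma> * v (s - t)"
      proof -
        have "v t ^ m = v t ^ (m - 1) * v t" using pw[of "v t"] by (simp add: mult.commute)
        also have "v t ^ (m - 1) = v b ^ (m - 1)" using D[OF t] by auto
        finally have tm: "v t ^ m = v b ^ (m - 1) * v t" .
        have "L * v t \<le> L * r" using sr r0(3) by (intro mult_left_mono)
        then have lt: "L * v t < \<mu> * a" using Lr by linarith
        have "v t ^ m * v (R s - R t) \<le> v t ^ m * (L * v (s - t))"
          using RL sr r nonneg by (intro mult_left_mono) auto
        also have "\<dots> = (L * v t) * (v b ^ (m - 1) * v (s - t))" by (simp add: tm mult_ac)
        also have "\<dots> < (\<mu> * a) * (v b ^ (m - 1) * v (s - t))"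
          using lt bm d0 by (intro mult_strict_right_mono) auto
        finally show ?thesis unfolding v\<gamma> by (simp add: mult v_power mult_ac)
      qed
      show ?thesis unfolding eq using ultra 1 2 3 by (meson le_less_trans max_less_iff_conj)
    qed
    show ?thesis using v\<gamma> \<gamma>0 main unfolding \<mu>_def by blast
  qed
  show ?thesis using a r(1,3) 1 2 3 by (intro exI[of _ a] exI[of _ r] conjI) blast+
qed

text \<open>A Newton step with a slope from \<open>K\<close> stays in the disc and strictly
  decreases \<open>v (g s - w)\<close> unless this is 0. By compactness the infimum of these values
  is attained on the points of \<open>K\<close> in the disc, so it is 0; no rate of convergence is
  involved.\<close>

lemma newton_surjective:
  assumes K: "is_subfield K" "seq_compact_set K" and \<pi>: "\<pi> \<in> K" "0 < v \<pi>" "v \<pi> < 1"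
    and gK: "\<And>s. s \<in> K \<Longrightarrow> v (s - b) \<le> \<rho> \<Longrightarrow> g s \<in> K" and b: "b \<in> K" and \<rho>: "0 < \<rho>"
    and ap: "\<And>s t. v (s - b) \<le> \<rho> \<Longrightarrow> v (t - b) \<le> \<rho> \<Longrightarrow> s \<noteq> t \<Longrightarrow> v ((g s - g t) - \<gamma> * (s - t)) < v \<gamma> * v (s - t)"
    and \<gamma>: "0 < v \<gamma>" and w: "w \<in> K" "v (g b - w) \<le> v \<gamma> * \<rho>"
  shows "\<exists>s\<in>K. v (s - b) \<le> \<rho> \<and> g s = w"
proof -
  have mulK: "\<And>x y. x \<in> K \<Longrightarrow> y \<in> K \<Longrightarrow> x * y \<in> K" and addK: "\<And>x y. x \<in> K \<Longrightarrow> y \<in> K \<Longrightarrow> x + y \<in> K"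
    and negK: "\<And>x. x \<in> K \<Longrightarrow> - x \<in> K" and invK: "\<And>x. x \<in> K \<Longrightarrow> inverse x \<in> K" and oneK: "1 \<in> K"
    using K unfolding is_subfield_def by blast+
  have subK: "x - y \<in> K" if "x \<in> K" "y \<in> K" for x y using addK[OF that(1) negK[OF that(2)]] by simp
  have sc: "v (g s - g t) = v \<gamma> * v (s - t)" if "v (s - b) \<le> \<rho>" "v (t - b) \<le> \<rho>" for s t
  proof (cases "s = t")
    case False
    then have "v ((g s - g t) - \<gamma> * (s - t)) < v (\<gamma> * (s - t))" using ap that by (simp add: mult)
    then show ?thesis using v_close by (metis mult)
  qed simp
  obtain N where N: "v \<pi> ^ N < \<rho>" using real_arch_pow_inv[OF \<rho> \<pi>(3)] by blast
  define u where "u = b + \<pi> ^ N"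
  have "\<pi> ^ N \<in> K" by (induction N) (auto simp: oneK mulK \<pi>(1))
  then have u: "u \<in> K" "v (u - b) \<le> \<rho>" "u \<noteq> b" "u - b \<noteq> 0" using N \<pi> b addK by (auto simp: u_def v_power)
  have bb: "v (b - b) \<le> \<rho>" using \<rho> by simp
  \<comment> \<open>The slope \<open>\<gamma>\<close> is not known to lie in \<open>K\<close>; this
    difference quotient does, and it is closer to \<open>\<gamma>\<close> than
    \<open>v \<gamma>\<close>.\<close>
  define \<gamma>' where "\<gamma>' = (g u - g b) * inverse (u - b)"
  have \<gamma>'K: "\<gamma>' \<in> K" unfolding \<gamma>'_def by (rule mulK[OF subK[OF gK[OF u(1,2)] gK[OF b bb]] invK[OF subK[OF u(1) b]]])
  have "\<gamma>' - \<gamma> = ((g u - g b) - \<gamma> * (u - b)) / (u - b)" using u(4) by (simp add: \<gamma>'_def field_simps)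
  then have "v (\<gamma>' - \<gamma>) = v ((g u - g b) - \<gamma> * (u - b)) / v (u - b)" by (simp add: v_divide)
  also have "\<dots> < v \<gamma>" using ap[OF u(2) bb u(3)] v_pos[OF u(4)] by (simp add: divide_less_eq)
  finally have \<gamma>'c: "v (\<gamma>' - \<gamma>) < v \<gamma>" .
  then have v\<gamma>': "v \<gamma>' = v \<gamma>" by (rule v_close)
  have \<gamma>'0: "\<gamma>' \<noteq> 0" using v\<gamma>' \<gamma> by auto
  define B where "B = {s \<in> K. v (s - b) \<le> \<rho>}"
  have bB: "b \<in> B" using b bb by (simp add: B_def)
  have improve: "\<exists>s'\<in>B. v (g s' - w) < v (g s - w)" if s: "s \<in> B" "g s \<noteq> w" for s
  proof -
    have sK: "s \<in> K" "v (s - b) \<le> \<rho>" using s by (auto simp: B_def)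
    define h where "h = (g s - w) * inverse \<gamma>'"
    have h0: "h \<noteq> 0" using s(2) \<gamma>'0 by (simp add: h_def)
    have hg: "\<gamma>' * h = g s - w" using \<gamma>'0 by (simp add: h_def)
    have vh: "v \<gamma> * v h = v (g s - w)" using hg v\<gamma>' by (metis mult)
    have "v (g s - g b) \<le> v \<gamma> * \<rho>" using sc[OF sK(2) bb] sK(2) \<gamma> by simp
    then have "v ((g s - g b) + (g b - w)) \<le> v \<gamma> * \<rho>" using w(2) by (rule v_le)
    then have "v \<gamma> * v h \<le> v \<gamma> * \<rho>" using vh by simp
    then have vh\<rho>: "v h \<le> \<rho>" using \<gamma> by simp
    have "v ((s - b) - h) \<le> \<rho>" by (rule v_diff_le[OF sK(2) vh\<rho>])
    then have s'\<rho>: "v ((s - h) - b) \<le> \<rho>" by (simp add: algebra_simps)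
    have s'B: "s - h \<in> B" using s'\<rho> sK subK mulK invK gK w \<gamma>'K by (simp add: B_def h_def)
    have "v ((g (s - h) - g s) - \<gamma> * ((s - h) - s)) < v \<gamma> * v ((s - h) - s)"
      using ap[OF s'\<rho> sK(2)] h0 by simp
    then have 1: "v ((g (s - h) - g s) + \<gamma> * h) < v \<gamma> * v h" by simp
    have 2: "v ((\<gamma>' - \<gamma>) * h) < v \<gamma> * v h" using \<gamma>'c v_pos[OF h0] by (simp add: mult)
    have "g (s - h) - w = ((g (s - h) - g s) + \<gamma> * h) + (\<gamma>' - \<gamma>) * h" using hg by (simp add: algebra_simps)
    then have "v (g (s - h) - w) < v \<gamma> * v h" using 1 2 ultra by (metis le_less_trans max_less_iff_conj)
    then show ?thesis using s'B vh by auto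
  qed
  let ?V = "(\<lambda>s. v (g s - w)) ` B"
  have bdd: "bdd_below ?V" by (rule bdd_belowI[of _ 0]) (auto simp: nonneg)
  define I where "I = Inf ?V"
  have "\<forall>n. \<exists>s\<in>B. v (g s - w) < I + 1 / real (Suc n)"
  proof
    fix n
    have "Inf ?V < I + 1 / real (Suc n)" by (simp add: I_def)
    then obtain y where "y \<in> ?V" "y < I + 1 / real (Suc n)" using cInf_lessD[of ?V] bB by blast
    then show "\<exists>s\<in>B. v (g s - w) < I + 1 / real (Suc n)" by blast
  qed
  then obtain s where s: "\<And>n. s n \<in> B" "\<And>n. v (g (s n) - w) < I + 1 / real (Suc n)" by metis
  have sK: "s n \<in> K" for n using s by (simp add: B_def)
  have sb: "v (s n) \<le> max \<rho> (v b)" for n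
    using v_le[of "s n - b" "max \<rho> (v b)" b] s(1)[of n] by (simp add: B_def le_max_iff_disj)
  obtain x r where x: "x \<in> K" "strict_mono r" "(\<lambda>n. v (x - s (r n))) \<longlonglongrightarrow> 0"
    by (rule seq_compact_setD[OF K(2) sK sb])
  obtain n0 where "v (x - s (r n0)) < \<rho>" using v_tendsto_bound[OF x(3) \<rho>] by blast
  then have "v ((x - s (r n0)) + (s (r n0) - b)) \<le> \<rho>" using s(1)[of "r n0"] by (intro v_le) (auto simp: B_def)
  then have xB: "x \<in> B" using x(1) by (simp add: B_def)
  have "v (g x - w) \<le> I"
  proof (rule ccontr)
    assume c: "\<not> v (g x - w) \<le> I"
    define e where "e = v (g x - w) - I"
    have e: "0 < e" using c by (simp add: e_def)
    have I0: "0 \<le> I" unfolding I_def by (rule cInf_greatest) (use bB nonneg in auto)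
    have vx: "0 < v (g x - w)" using c I0 by linarith
    have "0 < v (g x - w) / v \<gamma>" using vx \<gamma> by simp
    then obtain N1 where N1: "\<And>n. n \<ge> N1 \<Longrightarrow> v (x - s (r n)) < v (g x - w) / v \<gamma>"
      using v_tendsto_bound[OF x(3)] by blast
    have "(\<lambda>n. 1 / real (Suc n)) \<longlonglongrightarrow> 0" by (rule LIMSEQ_Suc[OF lim_1_over_n])
    from order_tendstoD(2)[OF this e] obtain N2 where N2: "\<And>n. n \<ge> N2 \<Longrightarrow> 1 / real (Suc n) < e"
      unfolding eventually_sequentially by blast
    define n where "n = max N1 N2"
    have rn: "n \<le> r n" using x(2) by (rule strict_mono_imp_increasing)
    have "1 / real (Suc (r n)) < e" using N2[of "r n"] rn by (simp add: n_def)
    then have A: "v (g (s (r n)) - w) < v (g x - w)" using s(2)[of "r n"] by (simp add: e_def)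
    have "v \<gamma> * v (x - s (r n)) < v (g x - w)" using N1[of n] \<gamma> by (simp add: n_def field_simps)
    then have "v (g x - g (s (r n))) < v (g x - w)" using sc[of x "s (r n)"] xB s(1)[of "r n"] by (simp add: B_def)
    then have "v ((g x - g (s (r n))) + (g (s (r n)) - w)) < v (g x - w)" using A ultra by (metis le_less_trans max_less_iff_conj)
    then show False by simp
  qed
  moreover have "I \<le> v (g s' - w)" if "s' \<in> B" for s' unfolding I_def using bdd that by (intro cInf_lower) auto
  ultimately have "g x = w" using improve[OF xB] by (meson le_less_trans not_less)
  then show ?thesis using xB by (auto simp: B_def)
qed

end

section \<open>Rational maps in charts\<close>

lemma coeff_rev_poly: "coeff (rev_poly d P) i = (if i \<le> d then coeff P (d - i) else 0)"
  unfolding rev_poly_def by (simp add: coeff_sum)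

lemma poly_rev_poly:
  assumes "degree P \<le> d" "s \<noteq> 0" shows "poly (rev_poly d P) s = s ^ d * poly P (1 / s)"
proof -
  have "poly (rev_poly d P) s = (\<Sum>i\<le>d. coeff P (d - i) * s ^ i)"
    unfolding rev_poly_def by (simp add: poly_sum poly_monom)
  also have "\<dots> = (\<Sum>i\<le>d. coeff P i * s ^ (d - i))"
    by (rule sum.reindex_bij_witness[of _ "\<lambda>i. d - i" "\<lambda>i. d - i"]) auto
  also have "\<dots> = (\<Sum>i\<le>d. s ^ d * (coeff P i * (1 / s) ^ i))"
    by (rule sum.cong) (use assms in \<open>auto simp: power_diff power_one_over field_simps\<close>)
  also have "\<dots> = s ^ d * (\<Sum>i\<le>degree P. coeff P i * (1 / s) ^ i)"
    unfolding sum_distrib_left[symmetric]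
    by (intro arg_cong2[of _ _ _ _ "(*)"] refl sum.mono_neutral_right) (use assms in \<open>auto simp: coeff_eq_0\<close>)
  finally show ?thesis by (simp add: poly_altdef)
qed

lemma poly_in_subfield:
  assumes "is_subfield K" "\<And>i. coeff p i \<in> K" "x \<in> K" shows "poly p x \<in> K"
  using assms(2)
proof (induction p)
  case 0 then show ?case using assms(1) by (simp add: is_subfield_def)
next
  case (pCons a p)
  have "a \<in> K" using pCons.prems[of 0] by simp
  moreover have "coeff p i \<in> K" for i using pCons.prems[of "Suc i"] by simp
  ultimately show ?case using pCons.IH assms(1,3) by (simp add: is_subfield_def)
qed

locale nonarch_rational_map = nonarch_abs_char_0 v for v :: "'a::field_char_0 \<Rightarrow> real" +
  fixes P Q :: "'a poly" and K :: "'a set"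
  assumes K: "is_subfield K" and PK: "coeff P i \<in> K" and QK: "coeff Q i \<in> K"
    and Q0: "Q \<noteq> 0" and cop: "coprime P Q" and deg: "2 \<le> rat_degree P Q"
begin

definition f :: "'a proj_line \<Rightarrow> 'a proj_line" where "f = rat_map P Q"

definition Z :: "'a proj_line set" where "Z = proj_line_over K"

lemma Z_iff [simp]: "Pt x \<in> Z \<longleftrightarrow> x \<in> K" "Infty \<in> Z"
  by (auto simp: Z_def proj_line_over_def)

lemma K_ops: "0 \<in> K" "1 \<in> K" "x \<in> K \<Longrightarrow> y \<in> K \<Longrightarrow> x + y \<in> K" "x \<in> K \<Longrightarrow> y \<in> K \<Longrightarrow> x * y \<in> K"
  "x \<in> K \<Longrightarrow> - x \<in> K" "x \<in> K \<Longrightarrow> inverse x \<in> K" "x \<in> K \<Longrightarrow> y \<in> K \<Longrightarrow> x / y \<in> K" "x \<in> K \<Longrightarrow> y \<in> K \<Longrightarrow> x - y \<in> K"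
  using K unfolding is_subfield_def divide_inverse diff_conv_add_uminus by blast+

lemma K_add_iff: "x \<in> K \<Longrightarrow> x + s \<in> K \<longleftrightarrow> s \<in> K"
  using K_ops(3)[of x s] K_ops(8)[of "x + s" x] by auto

lemma inv_pt_Z: "inv_pt s \<in> Z \<longleftrightarrow> s \<in> K"
proof (cases "s = 0")
  case False
  then show ?thesis using K_ops(6)[of s] K_ops(6)[of "1 / s"] by (auto simp: inv_pt_def divide_inverse)
qed (simp add: inv_pt_def K_ops)

lemma not_proportional: "P \<noteq> smult y Q"
proof
  assume eq: "P = smult y Q"
  then have "Q dvd P" by (simp add: dvd_smult)
  then have "is_unit Q" using cop by (simp add: coprime_absorb_right)
  then have "degree Q = 0" by (simp add: is_unit_iff_degree Q0)
  moreover have "degree P \<le> degree Q" unfolding eq by (rule degree_smult_le)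
  ultimately show False using deg unfolding rat_degree_def by simp
qed

lemma no_common_root: "\<not> (poly P x = 0 \<and> poly Q x = 0)"
  using cop coprime_poly_0 by blast

text \<open>Makes infinity look like a finite point: there the pair consists of the reversed
  polynomials, with \<open>x = 0\<close>, and everything else is stated for finite points only. The
  last clause records that the chart respects \<open>K\<close>.\<close>

definition source_chart where
  "source_chart c \<sigma> S x P1 Q1 \<longleftrightarrow> chart c \<sigma> S \<and> (\<forall>s. f (\<sigma> s) = fin_value P1 Q1 (x + s)) \<and>
     local_degree P Q c = fin_local_degree P1 Q1 x \<and> (\<forall>y. P1 \<noteq> smult y Q1) \<and> Q1 \<noteq> 0 \<and>
     \<not> (poly P1 x = 0 \<and> poly Q1 x = 0) \<and> (\<forall>i. coeff P1 i \<in> K) \<and> (\<forall>i. coeff Q1 i \<in> K) \<and>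
     (c \<in> Z \<longrightarrow> x \<in> K \<and> (\<forall>s. \<sigma> s \<in> Z \<longleftrightarrow> s \<in> K))"

lemma source_chart_exists: "\<exists>\<sigma> S x P1 Q1. source_chart c \<sigma> S x P1 Q1"
proof (cases c)
  case (Pt x)
  have "source_chart c (\<lambda>s. Pt (x + s)) (1 / (max (v x) 1)\<^sup>2) x P Q"
    unfolding source_chart_def Pt using chart_Pt not_proportional Q0 no_common_root PK QK K_add_iff
    by (simp add: f_def)
  then show ?thesis by blast
next
  case Infty
  define d where "d = rat_degree P Q"
  have d: "degree P \<le> d" "degree Q \<le> d" "0 < d" using deg by (auto simp: d_def rat_degree_def)
  let ?P = "rev_poly d P" and ?Q = "rev_poly d Q"
  have inj: "A = B" if "rev_poly d A = rev_poly d B" "degree A \<le> d" "degree B \<le> d" for A B :: "'a poly"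
  proof (rule poly_eqI)
    fix n
    show "coeff A n = coeff B n"
    proof (cases "n \<le> d")
      case True
      then show ?thesis using arg_cong[OF that(1), of "\<lambda>p. coeff p (d - n)"] by (simp add: coeff_rev_poly)
    next
      case False
      then show ?thesis using that by (simp add: coeff_eq_0)
    qed
  qed
  have "rev_poly d (smult y Q) = smult y ?Q" for y by (rule poly_eqI) (simp add: coeff_rev_poly)
  moreover have "degree (smult y Q) \<le> d" for y using degree_smult_le[of y Q] d by simp
  ultimately have np: "?P \<noteq> smult y ?Q" for y using inj[of P "smult y Q"] not_proportional[of y] d by metis
  have "rev_poly d 0 = (0 :: 'a poly)" by (rule poly_eqI) (simp add: coeff_rev_poly)
  then have Q1: "?Q \<noteq> 0" using inj[of Q 0] Q0 d by auto
  have "poly ?P 0 = coeff P d" "poly ?Q 0 = coeff Q d" by (simp_all add: poly_0_coeff_0 coeff_rev_poly)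
  moreover have "coeff P d \<noteq> 0 \<or> coeff Q d \<noteq> 0"
  proof (cases "degree P = d")
    case True
    then have "lead_coeff P \<noteq> 0" using d by auto
    then show ?thesis using True by simp
  next
    case False
    then have "degree Q = d" by (auto simp: d_def rat_degree_def max_def split: if_splits)
    then show ?thesis using Q0 by auto
  qed
  ultimately have nc: "\<not> (poly ?P 0 = 0 \<and> poly ?Q 0 = 0)" by simp
  have fs: "f (inv_pt s) = fin_value ?P ?Q s" for s
  proof (cases "s = 0")
    case False
    then have "poly ?P s = s ^ d * poly P (1 / s)" "poly ?Q s = s ^ d * poly Q (1 / s)" using poly_rev_poly d by auto
    then show ?thesis using False by (simp add: f_def inv_pt_def fin_value_def)
  qed (simp add: f_def inv_pt_def d_def)
  have "coeff ?P i \<in> K" "coeff ?Q i \<in> K" for i using PK QK K_ops by (auto simp: coeff_rev_poly)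
  then have "source_chart c inv_pt 1 0 ?P ?Q"
    unfolding source_chart_def Infty using chart_Infty fs np Q1 nc inv_pt_Z K_ops by (simp add: d_def)
  then show ?thesis by blast
qed

text \<open>Reads the quotient in a coordinate that vanishes at its value: \<open>P1 / Q1\<close>
  minus the value if this is finite, and \<open>Q1 / P1\<close> at a pole. The order of the zero is
  then the local degree.\<close>

definition target_chart where
  "target_chart P1 Q1 x \<sigma> S g \<longleftrightarrow> chart (fin_value P1 Q1 x) \<sigma> S \<and> power_form g (fin_local_degree P1 Q1 x) \<and>
     1 \<le> fin_local_degree P1 Q1 x \<and> (\<exists>r>0. \<forall>s. v s \<le> r \<longrightarrow> fin_value P1 Q1 (x + s) = \<sigma> (g s)) \<and>
     (x \<in> K \<longrightarrow> (\<forall>s\<in>K. g s \<in> K) \<and> (\<forall>s. \<sigma> s \<in> Z \<longleftrightarrow> s \<in> K))"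

lemma poly_nonzero_near: assumes "poly D x \<noteq> 0" shows "\<exists>r>0. \<forall>s. v s \<le> r \<longrightarrow> poly D (x + s) \<noteq> 0"
proof -
  obtain L where L: "L \<ge> 0" "\<And>s t. v s \<le> 1 \<Longrightarrow> v t \<le> 1 \<Longrightarrow> v (poly D (x + s) - poly D (x + t)) \<le> L * v (s - t)"
    using poly_lipschitz by blast
  define r where "r = min 1 (v (poly D x) / (2 * (L + 1)))"
  have p: "0 < v (poly D x)" using v_pos[OF assms] .
  have r: "0 < r" "r \<le> 1" using p L(1) by (auto simp: r_def)
  have "poly D (x + s) \<noteq> 0" if s: "v s \<le> r" for s
  proof
    assume z: "poly D (x + s) = 0"
    have "v (poly D x) \<le> L * v s" using L(2)[of s 0] s r z by simp
    also have "\<dots> \<le> L * (v (poly D x) / (2 * (L + 1)))" using s L(1) by (intro mult_left_mono) (auto simp: r_def)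
    also have "\<dots> < v (poly D x)" using p L(1) by (simp add: divide_less_eq mult.commute[of L] distrib_left add_nonneg_pos)
    finally show False by simp
  qed
  then show ?thesis using r by blast
qed

lemma target_chart_exists:
  assumes np: "\<forall>y. P1 \<noteq> smult y Q1" and Q1: "Q1 \<noteq> 0" and nc: "\<not> (poly P1 x = 0 \<and> poly Q1 x = 0)"
    and cK: "\<forall>i. coeff P1 i \<in> K" "\<forall>i. coeff Q1 i \<in> K"
  shows "\<exists>\<sigma> S g. target_chart P1 Q1 x \<sigma> S g"
proof (cases "poly Q1 x = 0")
  case False
  define y where "y = poly P1 x / poly Q1 x"
  define N where "N = P1 - smult y Q1"
  have N: "N \<noteq> 0" "poly N x = 0" using np False by (auto simp: N_def y_def)
  have ord: "fin_local_degree P1 Q1 x = order x N" using False by (simp add: fin_local_degree_def N_def y_def)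
  define g where "g s = poly N (x + s) / poly Q1 (x + s)" for s
  obtain r where r: "r > 0" "\<And>s. v s \<le> r \<Longrightarrow> poly Q1 (x + s) \<noteq> 0" using poly_nonzero_near[OF False] by blast
  have gs: "fin_value P1 Q1 (x + s) = Pt (y + g s)" if "v s \<le> r" for s
    using r(2)[OF that] by (simp add: fin_value_def g_def N_def diff_divide_distrib)
  have "power_form g (order x N)" unfolding g_def using power_form_poly[OF False N(1)] .
  moreover have "1 \<le> order x N" using N order_root[of N x] by (simp add: Suc_le_eq)
  moreover have "chart (fin_value P1 Q1 x) (\<lambda>s. Pt (y + s)) (1 / (max (v y) 1)\<^sup>2)"
    using chart_Pt[of y] False by (simp add: fin_value_def y_def)
  moreover have "(\<forall>s\<in>K. g s \<in> K) \<and> (\<forall>s. Pt (y + s) \<in> Z \<longleftrightarrow> s \<in> K)" if xK: "x \<in> K"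
  proof -
    have pK: "poly P1 z \<in> K" "poly Q1 z \<in> K" if "z \<in> K" for z using poly_in_subfield[OF K _ that] cK by blast+
    have yK: "y \<in> K" using pK xK K_ops(7) by (simp add: y_def)
    have "g s \<in> K" if "s \<in> K" for s
      using K_ops(7)[OF K_ops(8)[OF pK(1) K_ops(4)[OF yK pK(2)]] pK(2)] K_ops(3)[OF xK that]
      by (simp add: g_def N_def)
    then show ?thesis using K_add_iff[OF yK] by simp
  qed
  ultimately have "target_chart P1 Q1 x (\<lambda>s. Pt (y + s)) (1 / (max (v y) 1)\<^sup>2) g"
    unfolding target_chart_def ord using gs r(1) by blast
  then show ?thesis by blast
next
  case True
  then have P1x: "poly P1 x \<noteq> 0" using nc by simp
  have ord: "fin_local_degree P1 Q1 x = order x Q1" using True by (simp add: fin_local_degree_def)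
  define g where "g s = poly Q1 (x + s) / poly P1 (x + s)" for s
  obtain r where r: "r > 0" "\<And>s. v s \<le> r \<Longrightarrow> poly P1 (x + s) \<noteq> 0" using poly_nonzero_near[OF P1x] by blast
  have gs: "fin_value P1 Q1 (x + s) = inv_pt (g s)" if "v s \<le> r" for s
    using r(2)[OF that] by (simp add: fin_value_def g_def inv_pt_def)
  have "power_form g (order x Q1)" unfolding g_def using power_form_poly[OF P1x Q1] .
  moreover have "1 \<le> order x Q1" using True Q1 order_root[of Q1 x] by (simp add: Suc_le_eq)
  moreover have "chart (fin_value P1 Q1 x) inv_pt 1" using chart_Infty True by (simp add: fin_value_def)
  moreover have "(\<forall>s\<in>K. g s \<in> K) \<and> (\<forall>s. inv_pt s \<in> Z \<longleftrightarrow> s \<in> K)" if xK: "x \<in> K"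
  proof -
    have pK: "poly P1 z \<in> K" "poly Q1 z \<in> K" if "z \<in> K" for z using poly_in_subfield[OF K _ that] cK by blast+
    have "g s \<in> K" if "s \<in> K" for s using K_ops(7)[OF pK(2) pK(1)] K_ops(3)[OF xK that] by (simp add: g_def)
    then show ?thesis using inv_pt_Z by simp
  qed
  ultimately have "target_chart P1 Q1 x inv_pt 1 g"
    unfolding target_chart_def ord using gs r(1) by blast
  then show ?thesis by blast
qed

end

section \<open>Local behaviour in the spherical metric\<close>

locale compact_rational_map = nonarch_rational_map v P Q K
  for v :: "'a::field_char_0 \<Rightarrow> real" and P Q :: "'a poly" and K :: "'a set" +
  fixes \<pi> :: 'a
  assumes compact_K: "seq_compact_set K" and pi_K: "\<pi> \<in> K" and pi_pos: "0 < v \<pi>" and pi_less: "v \<pi> < 1"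
    and K_val: "x \<in> K \<Longrightarrow> x \<noteq> 0 \<Longrightarrow> v x \<le> 1 \<Longrightarrow> \<exists>k. v x = v \<pi> ^ k"
begin

text \<open>Transfers \<open>power_form_local\<close> and \<open>newton_surjective\<close> through
  the two charts, for critical and ordinary points alike. The alternative
  \<open>m = 1 \<and> s \<le> r\<close> admits \<open>b = c\<close> in the unramified case.\<close>

lemma local_behaviour:
  fixes c
  defines "m \<equiv> local_degree P Q c"
  defines "\<mu> \<equiv> v (of_nat m)"
  shows "1 \<le> m \<and> (\<exists>A>0. \<exists>r>0. (\<forall>x. sd c x \<le> r \<longrightarrow> sd (f c) (f x) = A * sd c x ^ m) \<and>
    (\<forall>x y. sd c x \<le> r \<longrightarrow> sd c y \<le> r \<longrightarrow> sd (f x) (f y) \<le> A * max (sd c x) (sd c y) ^ (m - 1) * sd x y) \<and>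
    (\<forall>b s. sd c b \<le> r \<longrightarrow> 0 < s \<longrightarrow> (m = 1 \<and> s \<le> r) \<or> s < \<mu> * sd c b \<longrightarrow>
       (\<forall>x y. sd b x \<le> s \<longrightarrow> sd b y \<le> s \<longrightarrow> sd (f x) (f y) = \<mu> * A * sd c b ^ (m - 1) * sd x y) \<and>
       (c \<in> Z \<longrightarrow> b \<in> Z \<longrightarrow> (\<forall>w\<in>Z. sd (f b) w \<le> \<mu> * A * sd c b ^ (m - 1) * s \<longrightarrow> (\<exists>z\<in>Z. sd b z \<le> s \<and> f z = w)))))"
proof -
  obtain \<sigma> S x P1 Q1 where src: "source_chart c \<sigma> S x P1 Q1" using source_chart_exists by blast
  have ch: "chart c \<sigma> S" and fs: "\<And>s. f (\<sigma> s) = fin_value P1 Q1 (x + s)" and mdeg: "m = fin_local_degree P1 Q1 x"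
    and Zc: "c \<in> Z \<Longrightarrow> x \<in> K \<and> (\<forall>s. \<sigma> s \<in> Z \<longleftrightarrow> s \<in> K)"
    using src unfolding source_chart_def m_def by blast+
  have "\<exists>\<sigma> S g. target_chart P1 Q1 x \<sigma> S g"
    using src unfolding source_chart_def by (intro target_chart_exists) blast+
  then obtain \<sigma>' S' g where tgt: "target_chart P1 Q1 x \<sigma>' S' g" by blast
  have ch': "chart (f c) \<sigma>' S'" using tgt ch fs[of 0] unfolding target_chart_def chart_def by simp
  have pf: "power_form g m" and m1: "1 \<le> m" using tgt unfolding target_chart_def mdeg by auto
  have ZK: "x \<in> K \<Longrightarrow> (\<forall>s\<in>K. g s \<in> K) \<and> (\<forall>s. \<sigma>' s \<in> Z \<longleftrightarrow> s \<in> K)" using tgt unfolding target_chart_def by blast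
  obtain r2 where r2: "r2 > 0" "\<And>s. v s \<le> r2 \<Longrightarrow> fin_value P1 Q1 (x + s) = \<sigma>' (g s)"
    using tgt unfolding target_chart_def by blast
  obtain a r1 where a: "0 < a" and r1: "0 < r1" "r1 \<le> 1"
    and G: "\<forall>s. v s \<le> r1 \<longrightarrow> v (g s) = a * v s ^ m"
    "\<forall>s t. v s \<le> r1 \<longrightarrow> v t \<le> r1 \<longrightarrow> v (g s - g t) \<le> a * max (v s) (v t) ^ (m - 1) * v (s - t)"
    "\<forall>b \<rho>. v b \<le> r1 \<longrightarrow> 0 < \<rho> \<longrightarrow> (m = 1 \<and> \<rho> \<le> r1) \<or> \<rho> < v (of_nat m) * v b \<longrightarrow>
       (\<exists>\<gamma>. v \<gamma> = v (of_nat m) * a * v b ^ (m - 1) \<and> 0 < v \<gamma> \<and>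
         (\<forall>s t. v (s - b) \<le> \<rho> \<longrightarrow> v (t - b) \<le> \<rho> \<longrightarrow> s \<noteq> t \<longrightarrow> v ((g s - g t) - \<gamma> * (s - t)) < v \<gamma> * v (s - t)))"
    using power_form_local[OF pf m1] by (elim exE conjE)
  note g1 = G(1)[rule_format] and g2 = G(2)[rule_format] and g3 = G(3)[rule_format]
  have S: "0 < S" "\<sigma> 0 = c" and S': "0 < S'" using ch ch' unfolding chart_def by auto
  have d\<sigma>: "sd (\<sigma> s) (\<sigma> t) = S * v (s - t)" if "v s \<le> 1" "v t \<le> 1" for s t using ch that unfolding chart_def by blast
  have d\<sigma>': "sd (\<sigma>' s) (\<sigma>' t) = S' * v (s - t)" if "v s \<le> 1" "v t \<le> 1" for s t using ch' that unfolding chart_def by blast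
  \<comment> \<open>The bound \<open>1 / (2 * a)\<close> keeps \<open>g\<close> within 1/2, so
    images and the points \<open>w\<close> to be hit are at distance below \<open>S'\<close> from
    the target centre, where the target chart is onto.\<close>
  define r where "r = min (min r1 r2) (1 / (2 * a))"
  have r: "0 < r" "r \<le> r1" "r \<le> r2" "r \<le> 1" using r1 r2(1) a by (auto simp: r_def)
  have "a * r \<le> a * (1 / (2 * a))" using a by (intro mult_left_mono) (auto simp: r_def)
  then have ar: "a * r \<le> 1 / 2" using a by simp
  have arm: "a * t ^ m \<le> 1 / 2" if "0 \<le> t" "t \<le> r" for t
  proof -
    have "t ^ m \<le> t ^ 1" using that r m1 by (intro power_decreasing) auto
    then have "a * t ^ m \<le> a * r" using a that by (intro mult_left_mono) auto
    then show ?thesis using ar by linarith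
  qed
  have gsmall: "v (g s) \<le> 1 / 2" if "v s \<le> r" for s
    using g1[of s] arm[OF nonneg that] that r by simp
  have gs1: "v (g s) \<le> 1" if "v s \<le> r" for s using gsmall[OF that] by linarith
  have f\<sigma>: "f (\<sigma> s) = \<sigma>' (g s)" if "v s \<le> r" for s using fs r2(2) that r by simp
  have df: "sd (f (\<sigma> s)) (f (\<sigma> t)) = S' * v (g s - g t)" if "v s \<le> r" "v t \<le> r" for s t
    using f\<sigma> d\<sigma>' gs1 that by simp
  \<comment> \<open>Strictly below \<open>S\<close>, as the source chart is only known to cover the
    open ball of this radius.\<close>
  define \<delta> where "\<delta> = S * r / 2"
  have \<delta>: "0 < \<delta>" "\<delta> < S" "\<delta> / S \<le> r" using S r by (auto simp: \<delta>_def)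
  have near: "\<exists>s. z = \<sigma> s \<and> v s \<le> r \<and> sd c z = S * v s" if z: "sd c z \<le> \<delta>" for z
  proof -
    obtain s where s: "v s \<le> 1" "z = \<sigma> s" using ch z \<delta> unfolding chart_def by (meson le_less_trans)
    then have d: "sd c z = S * v s" using chart_centre[OF ch] by simp
    have "S * v s \<le> S * (r / 2)" using z d by (simp add: \<delta>_def)
    then have "v s \<le> r / 2" using S(1) by simp
    then show ?thesis using s d r by auto
  qed
  have g0: "g 0 = 0" using g1[of 0] r1 m1 eq_zero[of "g 0"] by simp
  define A where "A = S' * a / S ^ m"
  have A: "0 < A" using S S' a by (simp add: A_def)
  have Am: "A * (S * t) ^ m = S' * (a * t ^ m)" for t using S by (simp add: A_def power_mult_distrib)
  have Am1: "A * (S * t) ^ (m - 1) * S = S' * (a * t ^ (m - 1))" for t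
    using S m1 by (cases m) (auto simp: A_def power_mult_distrib)
  have L1: "sd (f c) (f z) = A * sd c z ^ m" if z: "sd c z \<le> \<delta>" for z
  proof -
    obtain s where s: "z = \<sigma> s" "v s \<le> r" "sd c z = S * v s" using near[OF z] by blast
    have "sd (f c) (f z) = S' * v (g 0 - g s)" using df[of 0 s] s S(2) r by simp
    also have "\<dots> = S' * (a * v s ^ m)" using g1[of s] s r by (simp add: g0)
    finally show ?thesis using Am s(3) by simp
  qed
  have L2: "sd (f y) (f z) \<le> A * max (sd c y) (sd c z) ^ (m - 1) * sd y z" if yz: "sd c y \<le> \<delta>" "sd c z \<le> \<delta>" for y z
  proof -
    obtain s where s: "y = \<sigma> s" "v s \<le> r" "sd c y = S * v s" using near[OF yz(1)] by blast
    obtain t where t: "z = \<sigma> t" "v t \<le> r" "sd c z = S * v t" using near[OF yz(2)] by blast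
    have mx: "max (sd c y) (sd c z) = S * max (v s) (v t)" using s t S(1) by (simp add: max_mult_distrib_left)
    have "sd (f y) (f z) = S' * v (g s - g t)" using df s t by simp
    also have "\<dots> \<le> S' * (a * max (v s) (v t) ^ (m - 1) * v (s - t))"
      using g2[of s t] s t r S' by (intro mult_left_mono) auto
    also have "\<dots> = A * max (sd c y) (sd c z) ^ (m - 1) * (S * v (s - t))" unfolding mx
      using Am1[of "max (v s) (v t)"] by (simp add: mult_ac)
    also have "S * v (s - t) = sd y z" using d\<sigma> s t r by simp
    finally show ?thesis .
  qed
  have \<mu>1: "\<mu> \<le> 1" using v_of_int_le[of "int m"] by (simp add: \<mu>_def)
  have L3: "(\<forall>x y. sd b x \<le> s \<longrightarrow> sd b y \<le> s \<longrightarrow> sd (f x) (f y) = \<mu> * A * sd c b ^ (m - 1) * sd x y) \<and>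
       (c \<in> Z \<longrightarrow> b \<in> Z \<longrightarrow> (\<forall>w\<in>Z. sd (f b) w \<le> \<mu> * A * sd c b ^ (m - 1) * s \<longrightarrow> (\<exists>z\<in>Z. sd b z \<le> s \<and> f z = w)))"
    if b: "sd c b \<le> \<delta>" and s: "0 < s" "(m = 1 \<and> s \<le> \<delta>) \<or> s < \<mu> * sd c b" for b s
  proof -
    obtain \<beta> where \<beta>: "b = \<sigma> \<beta>" "v \<beta> \<le> r" "sd c b = S * v \<beta>" using near[OF b] by blast
    define \<rho> where "\<rho> = s / S"
    have \<rho>0: "0 < \<rho>" using s S by (simp add: \<rho>_def)
    have s\<delta>: "s \<le> \<delta>"
    proof (cases "m = 1 \<and> s \<le> \<delta>")
      case False
      then have "s < \<mu> * sd c b" using s by blast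
      also have "\<dots> \<le> 1 * sd c b" using \<mu>1 spherical_dist_nonneg by (intro mult_right_mono)
      finally show ?thesis using b by simp
    qed simp
    have \<rho>r: "\<rho> \<le> r" using s\<delta> \<delta>(3) S by (simp add: \<rho>_def field_simps)
    have alt: "(m = 1 \<and> \<rho> \<le> r) \<or> \<rho> < \<mu> * v \<beta>"
      using s(2) \<rho>r S(1) by (auto simp: \<rho>_def \<beta>(3) field_simps)
    have "v \<beta> \<le> r1" "(m = 1 \<and> \<rho> \<le> r1) \<or> \<rho> < v (of_nat m) * v \<beta>"
      using \<beta>(2) alt r by (auto simp: \<mu>_def)
    then have "\<exists>\<gamma>. v \<gamma> = \<mu> * a * v \<beta> ^ (m - 1) \<and> 0 < v \<gamma> \<and>
         (\<forall>s t. v (s - \<beta>) \<le> \<rho> \<longrightarrow> v (t - \<beta>) \<le> \<rho> \<longrightarrow> s \<noteq> t \<longrightarrow> v ((g s - g t) - \<gamma> * (s - t)) < v \<gamma> * v (s - t))"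
      unfolding \<mu>_def using G(3) \<rho>0 by blast
    then obtain \<gamma> where \<gamma>: "v \<gamma> = \<mu> * a * v \<beta> ^ (m - 1)" "0 < v \<gamma>"
      and ap: "\<And>s t. v (s - \<beta>) \<le> \<rho> \<Longrightarrow> v (t - \<beta>) \<le> \<rho> \<Longrightarrow> s \<noteq> t \<Longrightarrow> v ((g s - g t) - \<gamma> * (s - t)) < v \<gamma> * v (s - t)"
      by blast
    have \<lambda>: "\<mu> * A * sd c b ^ (m - 1) * S = S' * v \<gamma>"
      using Am1[of "v \<beta>"] by (simp add: \<beta>(3) \<gamma>(1) mult_ac)
    have in_disc: "v t \<le> r" if "v (t - \<beta>) \<le> \<rho>" for t
      using v_le[of "t - \<beta>" r \<beta>] that \<rho>r \<beta>(2) by simp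
    have pt: "\<exists>t. z = \<sigma> t \<and> v (t - \<beta>) \<le> \<rho> \<and> v t \<le> r" if z: "sd b z \<le> s" for z
    proof -
      have "sd c z \<le> \<delta>" using spherical_dist_ultra[of c z b] b z s\<delta> by linarith
      then obtain t where t: "z = \<sigma> t" "v t \<le> r" using near by blast
      have "S * v (\<beta> - t) \<le> s" using z d\<sigma>[of \<beta> t] t \<beta> r by simp
      then have "v (t - \<beta>) \<le> \<rho>" using S(1) v_diff_commute[of t \<beta>] by (simp add: \<rho>_def field_simps)
      then show ?thesis using t by blast
    qed
    have scale: "v (g t - g u) = v \<gamma> * v (t - u)" if "v (t - \<beta>) \<le> \<rho>" "v (u - \<beta>) \<le> \<rho>" for t u
    proof (cases "t = u")
      case False
      then have "v ((g t - g u) - \<gamma> * (t - u)) < v (\<gamma> * (t - u))" using ap that by (simp add: mult)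
      then show ?thesis using v_close by (metis mult)
    qed simp
    have 1: "sd (f y) (f z) = \<mu> * A * sd c b ^ (m - 1) * sd y z" if yz: "sd b y \<le> s" "sd b z \<le> s" for y z
    proof -
      obtain t where t: "y = \<sigma> t" "v (t - \<beta>) \<le> \<rho>" "v t \<le> r" using pt[OF yz(1)] by blast
      obtain u where u: "z = \<sigma> u" "v (u - \<beta>) \<le> \<rho>" "v u \<le> r" using pt[OF yz(2)] by blast
      have "sd (f y) (f z) = S' * v \<gamma> * v (t - u)" using df[of t u] scale[of t u] t u by simp
      also have "\<dots> = \<mu> * A * sd c b ^ (m - 1) * (S * v (t - u))" unfolding \<lambda>[symmetric] by simp
      also have "S * v (t - u) = sd y z" using d\<sigma> t u r by simp
      finally show ?thesis .
    qed
    have 2: "\<exists>z\<in>Z. sd b z \<le> s \<and> f z = w"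
      if cZ: "c \<in> Z" and bZ: "b \<in> Z" and w: "w \<in> Z" "sd (f b) w \<le> \<mu> * A * sd c b ^ (m - 1) * s" for w
    proof -
      have xK: "x \<in> K" and \<beta>K: "\<beta> \<in> K" and \<sigma>K: "\<And>s. \<sigma> s \<in> Z \<longleftrightarrow> s \<in> K" using Zc[OF cZ] bZ \<beta>(1) by auto
      have gK: "\<And>s. s \<in> K \<Longrightarrow> g s \<in> K" and \<sigma>'K: "\<And>s. \<sigma>' s \<in> Z \<longleftrightarrow> s \<in> K" using ZK[OF xK] by auto
      have sS: "s = S * \<rho>" using S by (simp add: \<rho>_def)
      have "\<mu> * A * sd c b ^ (m - 1) * s = \<mu> * A * sd c b ^ (m - 1) * S * \<rho>" by (simp add: sS)
      then have w': "sd (f b) w \<le> S' * (v \<gamma> * \<rho>)" using w(2) unfolding \<lambda> by (simp add: mult.assoc)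
      have vg: "v \<gamma> * \<rho> \<le> 1 / 2"
      proof (cases "m = 1")
        case True
        then have "v \<gamma> * \<rho> = a * \<rho>" by (simp add: \<gamma>(1) \<mu>_def)
        also have "\<dots> \<le> a * r" using \<rho>r a by simp
        finally show ?thesis using ar by linarith
      next
        case False
        then have lt: "\<rho> < \<mu> * v \<beta>" using alt by blast
        have "\<mu> * v \<beta> \<le> 1 * v \<beta>" using \<mu>1 by (intro mult_right_mono nonneg)
        then have "\<rho> \<le> v \<beta>" using lt by simp
        moreover have "v \<gamma> \<le> 1 * a * v \<beta> ^ (m - 1)" unfolding \<gamma>(1) using \<mu>1 a nonneg
          by (intro mult_right_mono) auto
        ultimately have "v \<gamma> * \<rho> \<le> (1 * a * v \<beta> ^ (m - 1)) * v \<beta>" using \<rho>0 a nonneg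
          by (intro mult_mono) auto
        also have "\<dots> = a * v \<beta> ^ m" using m1 by (cases m) auto
        finally show ?thesis using arm[OF nonneg \<beta>(2)] by linarith
      qed
      have "S' * (v \<gamma> * \<rho>) \<le> S' * (1 / 2)" using vg S' by (intro mult_left_mono) auto
      then have bw: "sd (f b) w < S'" using w' S' by linarith
      have "sd (f c) (f b) = S' * v (g 0 - g \<beta>)" using df[of 0 \<beta>] S(2) \<beta> r by simp
      also have "\<dots> = S' * v (g \<beta>)" by (simp add: g0)
      also have "\<dots> \<le> S' * (1 / 2)" using gsmall[OF \<beta>(2)] S' by (intro mult_left_mono) auto
      finally have "sd (f c) (f b) < S'" using S' by simp
      then have "sd (f c) w < S'" using bw spherical_dist_ultra[of "f c" w "f b"] by linarith
      then obtain \<omega> where \<omega>: "v \<omega> \<le> 1" "w = \<sigma>' \<omega>" using ch' unfolding chart_def by blast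
      have \<omega>K: "\<omega> \<in> K" using \<sigma>'K \<omega> w(1) by blast
      have "sd (f b) w = S' * v (g \<beta> - \<omega>)" using f\<sigma>[OF \<beta>(2)] d\<sigma>'[OF gs1[OF \<beta>(2)] \<omega>(1)] \<beta>(1) \<omega>(2) by simp
      then have "v (g \<beta> - \<omega>) \<le> v \<gamma> * \<rho>" using w' S' by simp
      then obtain t where t: "t \<in> K" "v (t - \<beta>) \<le> \<rho>" "g t = \<omega>"
        using newton_surjective[OF K compact_K pi_K pi_pos pi_less gK \<beta>K \<rho>0 ap \<gamma>(2) \<omega>K] by blast
      have "v t \<le> r" using in_disc t(2) .
      then have "f (\<sigma> t) = w" "sd b (\<sigma> t) = S * v (\<beta> - t)"
        using f\<sigma> t \<omega> d\<sigma>[of \<beta> t] \<beta> r by auto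
      moreover have "S * v (\<beta> - t) \<le> s" using t(2) S(1) v_diff_commute[of \<beta> t] by (simp add: sS)
      ultimately show ?thesis using \<sigma>K t(1) by (intro bexI[of _ "\<sigma> t"]) auto
    qed
    show ?thesis using 1 2 by blast
  qed
  show ?thesis using m1 A \<delta>(1) L1 L2 L3 by blast
qed

lemma sd_sym: "sd x y = sd y x"
  by (cases x; cases y) (auto simp: v_diff_commute mult.commute)

lemma sd_zero: "sd x y = 0 \<longleftrightarrow> x = y"
  using Metric_space.zero[OF metric_spherical[of UNIV], of x y] by (cases x; cases y) (auto simp: proj_line_over_def)

lemma f_continuous: assumes "0 < e" shows "\<exists>r>0. \<forall>y. sd c y < r \<longrightarrow> sd (f c) (f y) < e"
proof -
  obtain A r where A: "0 < A" "0 < r" "\<And>x. sd c x \<le> r \<Longrightarrow> sd (f c) (f x) = A * sd c x ^ local_degree P Q c"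
    and m: "1 \<le> local_degree P Q c"
    using local_behaviour[of c] by blast
  have "sd (f c) (f y) < e" if y: "sd c y < min (min r 1) (e / A)" for y
  proof -
    have "sd c y ^ local_degree P Q c \<le> sd c y ^ 1"
      using y m spherical_dist_nonneg by (intro power_decreasing) auto
    then have "A * sd c y ^ local_degree P Q c \<le> A * sd c y" using A(1) by simp
    also have "\<dots> < e" using y A(1) by (simp add: field_simps)
    finally show ?thesis using A(3)[of y] y by simp
  qed
  moreover have "0 < min (min r 1) (e / A)" using A assms by simp
  ultimately show ?thesis by blast
qed

lemma Z_charts: assumes "z \<in> Z" shows "\<exists>w\<in>K. v w \<le> 1 \<and> (z = Pt w \<or> z = inv_pt w)"
proof (cases z)
  case (Pt x)
  then have x: "x \<in> K" using assms by simp
  show ?thesis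
  proof (cases "v x \<le> 1")
    case False
    then have "x \<noteq> 0" "v (inverse x) \<le> 1" by (auto simp: v_inverse inverse_le_1_iff)
    then show ?thesis using Pt x K_ops(6) by (intro bexI[of _ "inverse x"]) (auto simp: inv_pt_def divide_inverse)
  qed (use Pt x in blast)
next
  case Infty
  then show ?thesis using K_ops(1) by (intro bexI[of _ 0]) (auto simp: inv_pt_def)
qed

lemma sd_Pt: "v x \<le> 1 \<Longrightarrow> v y \<le> 1 \<Longrightarrow> sd (Pt x) (Pt y) = v (x - y)"
  by (simp add: max_def)

lemma f_Z: assumes "z \<in> Z" shows "f z \<in> Z"
proof -
  obtain \<sigma> S x P1 Q1 where src: "source_chart z \<sigma> S x P1 Q1" using source_chart_exists by blast
  have "\<exists>\<sigma> S g. target_chart P1 Q1 x \<sigma> S g"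
    using src unfolding source_chart_def by (intro target_chart_exists) blast+
  then obtain \<sigma>' S' g where tgt: "target_chart P1 Q1 x \<sigma>' S' g" by blast
  have "f z = fin_value P1 Q1 x" using src unfolding source_chart_def chart_def by (metis add.right_neutral)
  moreover have "\<sigma>' 0 = fin_value P1 Q1 x" using tgt unfolding target_chart_def chart_def by blast
  moreover have "\<sigma>' 0 \<in> Z" using tgt src assms K_ops(1) unfolding target_chart_def source_chart_def by blast
  ultimately show ?thesis by simp
qed

lemma finite_fibre: "finite {x. f x = y}"
proof -
  have "{x. f x = y} \<subseteq> insert Infty (Pt ` {x. f (Pt x) = y})"
  proof
    fix x assume "x \<in> {x. f x = y}"
    then show "x \<in> insert Infty (Pt ` {x. f (Pt x) = y})" by (cases x) auto
  qed
  moreover have "finite {x. f (Pt x) = y}"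
  proof (cases y)
    case (Pt t)
    have "{x. f (Pt x) = y} \<subseteq> {x. poly (P - smult t Q) x = 0}"
      by (auto simp: f_def fin_value_def Pt split: if_splits)
    moreover have "P - smult t Q \<noteq> 0" using not_proportional by simp
    ultimately show ?thesis using poly_roots_finite finite_subset by blast
  next
    case Infty
    have "{x. f (Pt x) = y} \<subseteq> {x. poly Q x = 0}"
      by (auto simp: f_def fin_value_def Infty split: if_splits)
    then show ?thesis using poly_roots_finite[OF Q0] finite_subset by blast
  qed
  ultimately show ?thesis using finite_subset by blast
qed

text \<open>In homogeneous coordinates both norms are values of elements of \<open>K\<close>, being
  maxima of values of coordinates; so the spherical distance is the value of a quotient in
  \<open>K\<close>.\<close>

lemma K_val_quotient:
  assumes "z \<in> Z" "w \<in> Z" "z \<noteq> w" shows "\<exists>k. sd z w = v \<pi> ^ k"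
proof -
  have le: "sd z w \<le> 1"
  proof -
    have "v (hdet (hcoord z) (hcoord w)) \<le> hnorm (hcoord z) * hnorm (hcoord w)"
    proof -
      have "v (fst a * snd b) \<le> hnorm a * hnorm b" "v (snd a * fst b) \<le> hnorm a * hnorm b" for a b
        unfolding mult hnorm_def by (intro mult_mono nonneg; simp add: nonneg le_max_iff_disj)+
      then show ?thesis unfolding hdet_def by (intro v_diff_le)
    qed
    then show ?thesis unfolding spherical_dist_hcoord using hnorm_pos by (simp add: divide_le_eq_1)
  qed
  have "\<exists>n\<in>K. v n = hnorm (hcoord u)" if "u \<in> Z" for u
    using that K_ops(2) by (cases u) (auto simp: hnorm_def max_def intro: bexI[of _ 1])
  then obtain n1 n2 where n: "n1 \<in> K" "n2 \<in> K" "v n1 = hnorm (hcoord z)" "v n2 = hnorm (hcoord w)" using assms by meson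
  have h: "fst (hcoord u) \<in> K \<and> snd (hcoord u) \<in> K" if "u \<in> Z" for u using that K_ops by (cases u) auto
  define t where "t = hdet (hcoord z) (hcoord w) / (n1 * n2)"
  have "t \<in> K" unfolding t_def hdet_def using h assms n by (intro K_ops(4,7,8)) auto
  moreover have vt: "v t = sd z w" by (simp add: t_def v_divide mult n spherical_dist_hcoord)
  moreover have "t \<noteq> 0" using vt assms(3) sd_zero by auto
  ultimately show ?thesis using K_val le by metis
qed

lemma sphere_nonempty: assumes "z \<in> Z" shows "\<exists>w\<in>Z. sd z w = v \<pi> ^ k"
proof -
  obtain x where x: "x \<in> K" "v x \<le> 1" "z = Pt x \<or> z = inv_pt x" using Z_charts[OF assms] by blast
  have p: "\<pi> ^ k \<in> K" by (induction k) (auto simp: K_ops pi_K)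
  have pk: "v (\<pi> ^ k) \<le> 1" using pi_pos pi_less by (simp add: v_power power_le_one)
  have y: "x + \<pi> ^ k \<in> K" "v (x + \<pi> ^ k) \<le> 1" using x p pk K_ops v_le by auto
  have d: "v (x - (x + \<pi> ^ k)) = v \<pi> ^ k" by (simp add: v_power)
  from x(3) show ?thesis
  proof
    assume "z = Pt x" then show ?thesis using sd_Pt[OF x(2) y(2)] d y by (intro bexI[of _ "Pt (x + \<pi> ^ k)"]) auto
  next
    assume "z = inv_pt x" then show ?thesis using sd_inv_pt[OF x(2) y(2)] d y inv_pt_Z by (intro bexI[of _ "inv_pt (x + \<pi> ^ k)"]) auto
  qed
qed

lemma compact_chart:
  assumes s: "\<And>n::nat. s n \<in> K \<and> v (s n) \<le> 1"
    and \<tau>: "\<And>x y. v x \<le> 1 \<Longrightarrow> v y \<le> 1 \<Longrightarrow> sd (\<tau> x) (\<tau> y) = v (x - y)" "\<And>x. x \<in> K \<Longrightarrow> \<tau> x \<in> Z"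
  shows "\<exists>x\<in>Z. \<exists>r. strict_mono r \<and> (\<lambda>n. sd x (\<tau> (s (r n)))) \<longlonglongrightarrow> 0"
proof -
  have sK: "s n \<in> K" and s1: "v (s n) \<le> 1" for n using s by auto
  obtain x r where x: "x \<in> K" "strict_mono r" "(\<lambda>n. v (x - s (r n))) \<longlonglongrightarrow> 0"
    by (rule seq_compact_setD[OF compact_K sK s1])
  obtain n where "v (x - s (r n)) < 1" using v_tendsto_bound[OF x(3) zero_less_one] by blast
  then have "v ((x - s (r n)) + s (r n)) \<le> 1" using s1 by (intro v_le) auto
  then have "v x \<le> 1" by simp
  then have "(\<lambda>n. sd (\<tau> x) (\<tau> (s (r n)))) \<longlonglongrightarrow> 0" using x(3) \<tau>(1) s1 by simp
  then show ?thesis using x \<tau>(2) by blast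
qed

text \<open>Two unit discs, in the coordinates \<open>z\<close> and \<open>1 / z\<close>, cover
  \<open>Z\<close>, and one of them contains infinitely many terms.\<close>

lemma Z_seq_compact: assumes s: "\<And>n::nat. s n \<in> Z" shows "\<exists>x\<in>Z. \<exists>r. strict_mono r \<and> (\<lambda>n. sd x (s (r n))) \<longlonglongrightarrow> 0"
proof -
  have "\<forall>n. \<exists>w. w \<in> K \<and> v w \<le> 1 \<and> (s n = Pt w \<or> s n = inv_pt w)" using Z_charts[OF s] by blast
  then obtain w where w: "\<And>n. w n \<in> K \<and> v (w n) \<le> 1" "\<And>n. s n = Pt (w n) \<or> s n = inv_pt (w n)" by metis
  have sub: "\<exists>x\<in>Z. \<exists>r. strict_mono r \<and> (\<lambda>n. sd x (s (r n))) \<longlonglongrightarrow> 0"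
    if inf: "infinite {n. s n = \<tau> (w n)}"
      and \<tau>: "\<And>x y. v x \<le> 1 \<Longrightarrow> v y \<le> 1 \<Longrightarrow> sd (\<tau> x) (\<tau> y) = v (x - y)" "\<And>x. x \<in> K \<Longrightarrow> \<tau> x \<in> Z" for \<tau>
  proof -
    obtain r0 :: "nat \<Rightarrow> nat" where r0: "strict_mono r0" "\<And>n. s (r0 n) = \<tau> (w (r0 n))"
      using infinite_enumerate[OF inf] by auto
    obtain x r where x: "x \<in> Z" "strict_mono r" "(\<lambda>n. sd x (\<tau> (w (r0 (r n))))) \<longlonglongrightarrow> 0"
      using compact_chart[of "\<lambda>n. w (r0 n)" \<tau>, OF w(1) \<tau>] by blast
    have "strict_mono (\<lambda>n. r0 (r n))" using strict_mono_o[OF r0(1) x(2)] by (simp add: o_def)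
    moreover have "(\<lambda>n. sd x (s (r0 (r n)))) \<longlonglongrightarrow> 0" using x(3) r0(2) by simp
    ultimately show ?thesis using x(1) by blast
  qed
  have "{n. s n = Pt (w n)} \<union> {n. s n = inv_pt (w n)} = UNIV" using w(2) by auto
  then have "infinite {n. s n = Pt (w n)} \<or> infinite {n. s n = inv_pt (w n)}"
    by (metis finite_UnI infinite_UNIV_nat)
  then show ?thesis
  proof
    assume "infinite {n. s n = Pt (w n)}"
    then show ?thesis by (rule sub) (auto simp: sd_Pt)
  next
    assume "infinite {n. s n = inv_pt (w n)}"
    then show ?thesis by (rule sub) (auto simp: sd_inv_pt inv_pt_Z)
  qed
qed

end

section \<open>Fatou and Julia sets of rational maps\<close>

context nonarch_rational_map begin

text \<open>A finite critical point that is not a pole is a zero of the Wronskian \<open>W\<close>.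
  If \<open>W\<close> were 0, then \<open>N = P - smult y Q\<close>, for the value \<open>y\<close>
  at a non-pole \<open>x\<close>, would satisfy \<open>pderiv N * Q = N * pderiv Q\<close>; but in
  characteristic 0 differentiation lowers the order of \<open>N\<close> at its root
  \<open>x\<close>.\<close>

lemma finite_critical: "finite {c. critical_point P Q c}"
proof -
  define W where "W = pderiv P * Q - P * pderiv Q"
  obtain x where x: "poly Q x \<noteq> 0"
  proof -
    have "{x. poly Q x = 0} \<noteq> UNIV" using poly_roots_finite[OF Q0] infinite_UNIV_char_0[where 'a='a] by metis
    then show ?thesis using that by blast
  qed
  have "W \<noteq> 0"
  proof
    assume "W = 0"
    define y where "y = poly P x / poly Q x"
    define N where "N = P - smult y Q"
    have N0: "N \<noteq> 0" using not_proportional[of y] by (simp add: N_def)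
    have root: "poly N x = 0" using x by (simp add: N_def y_def)
    then have ord: "order x N \<noteq> 0" using N0 by (simp add: order_root)
    have N': "pderiv N \<noteq> 0"
    proof
      assume "pderiv N = 0"
      then obtain a where "N = [:a:]" by (meson pderiv_iszero)
      then show False using N0 root by simp
    qed
    have e: "pderiv N * Q = N * pderiv Q"
      using \<open>W = 0\<close> by (simp add: N_def W_def pderiv_diff pderiv_smult algebra_simps)
    have Qx: "order x Q = 0" using x by (simp add: order_root)
    have n0: "pderiv N * Q \<noteq> 0" using N' Q0 by simp
    have "order x N \<le> order x (N * pderiv Q)" using n0 e by (simp add: order_mult)
    also have "\<dots> = order x (pderiv N)" using order_mult[OF n0, of x] Qx e by simp
    also have "\<dots> < order x N" using order_pderiv[OF N0 root] by simp
    finally show False by simp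
  qed
  have root: "poly (pderiv N) x = 0" if N: "2 \<le> order x N" for N and x :: 'a
  proof -
    have "[:- x, 1:] ^ 2 dvd N" using N order_1 power_le_dvd by blast
    then obtain E where "N = [:- x, 1:] ^ 2 * E" by (rule dvdE)
    then have "N = [:- x, 1:] * ([:- x, 1:] * E)" by (simp only: power2_eq_square mult.assoc)
    then show ?thesis by (simp only: pderiv_mult poly_add poly_mult) simp
  qed
  have "{c. critical_point P Q c} \<subseteq> insert Infty (Pt ` ({x. poly W x = 0} \<union> {x. poly Q x = 0}))"
  proof
    fix c assume c: "c \<in> {c. critical_point P Q c}"
    show "c \<in> insert Infty (Pt ` ({x. poly W x = 0} \<union> {x. poly Q x = 0}))"
    proof (cases c)
      case (Pt x)
      have "poly W x = 0" if Qx: "poly Q x \<noteq> 0"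
      proof -
        define y where "y = poly P x / poly Q x"
        have "2 \<le> order x (P - smult y Q)"
          using c Pt Qx by (simp add: critical_point_def fin_local_degree_def y_def)
        then have "poly (pderiv P) x = y * poly (pderiv Q) x" using root by (fastforce simp: pderiv_diff pderiv_smult)
        moreover have "poly P x = y * poly Q x" using Qx by (simp add: y_def)
        ultimately show ?thesis by (simp add: W_def)
      qed
      then show ?thesis using Pt by blast
    qed simp
  qed
  moreover have "finite ({x. poly W x = 0} \<union> {x. poly Q x = 0})"
    using poly_roots_finite[OF \<open>W \<noteq> 0\<close>] poly_roots_finite[OF Q0] by simp
  ultimately show ?thesis using finite_subset by blast
qed

end

context nonarch_abs begin

lemma fatou_set_iff:
  "x \<in> fatou_set v L g \<longleftrightarrow> x \<in> proj_line_over L \<and>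
     (\<exists>r>0. iterates_equicontinuous_on v g {y \<in> proj_line_over L. sd x y < r})"
proof -
  interpret M: Metric_space "proj_line_over L" sd by (rule metric_spherical)
  have ball: "M.mball x r = {y \<in> proj_line_over L. sd x y < r}" if "x \<in> proj_line_over L" for x r
    using that by (auto simp: M.mball_def)
  have mono: "iterates_equicontinuous_on v g V" if "iterates_equicontinuous_on v g U" "V \<subseteq> U" for U V
    using that unfolding iterates_equicontinuous_on_def by (meson subsetD)
  show ?thesis
  proof
    assume "x \<in> fatou_set v L g"
    then obtain U where U: "x \<in> proj_line_over L" "openin M.mtopology U" "x \<in> U" "iterates_equicontinuous_on v g U"
      unfolding fatou_set_def proj_topology_def by blast
    then obtain r where "r > 0" "M.mball x r \<subseteq> U" unfolding M.openin_mtopology by blast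
    then show "x \<in> proj_line_over L \<and> (\<exists>r>0. iterates_equicontinuous_on v g {y \<in> proj_line_over L. sd x y < r})"
      using U mono ball by metis
  next
    assume "x \<in> proj_line_over L \<and> (\<exists>r>0. iterates_equicontinuous_on v g {y \<in> proj_line_over L. sd x y < r})"
    then obtain r where r: "x \<in> proj_line_over L" "r > 0" "iterates_equicontinuous_on v g (M.mball x r)"
      using ball by metis
    then show "x \<in> fatou_set v L g"
      unfolding fatou_set_def proj_topology_def using M.openin_mball M.centre_in_mball_iff by blast
  qed
qed

lemma proj_line_over_UNIV: "proj_line_over UNIV = (UNIV :: 'a proj_line set)"
  by (metis UNIV_eq_I insertCI proj_line.exhaust proj_line_over_def rangeI)

lemma orbit_closure_iff:
  "y \<in> orbit_closure v g x \<longleftrightarrow> (\<forall>e>0. \<exists>n. sd ((g ^^ n) x) y < e)"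
proof -
  interpret M: Metric_space UNIV sd using metric_spherical[of UNIV] unfolding proj_line_over_UNIV .
  have "orbit_closure v g x = M.mtopology closure_of (range (\<lambda>n. (g ^^ n) x))"
    unfolding orbit_closure_def proj_topology_def proj_line_over_UNIV ..
  then show ?thesis unfolding M.metric_closure_of using M.commute by auto
qed

end

section \<open>The rational map as an instance of the abstract system\<close>

context compact_rational_map begin

sublocale dyn: ultrametric_dynamics sd f Z "v \<pi>"
proof
  show "sd x y = 0 \<longleftrightarrow> x = y" for x y by (rule sd_zero)
  show "sd x y = sd y x" for x y by (rule sd_sym)
  show "sd x z \<le> max (sd x y) (sd y z)" for x y z by (rule spherical_dist_ultra)
  show "\<exists>r>0. \<forall>y. sd x y < r \<longrightarrow> sd (f x) (f y) < e" if "0 < e" for e x by (rule f_continuous[OF that])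
  show "0 < v \<pi>" "v \<pi> < 1" by (rule pi_pos, rule pi_less)
  show "\<exists>k. sd x y = v \<pi> ^ k" if "x \<in> Z" "y \<in> Z" "x \<noteq> y" for x y by (rule K_val_quotient[OF that])
  show "\<exists>y\<in>Z. sd x y = v \<pi> ^ k" if "x \<in> Z" for x k by (rule sphere_nonempty[OF that])
  show "\<exists>x\<in>Z. \<exists>r. strict_mono r \<and> (\<lambda>n. sd x (s (r n))) \<longlonglongrightarrow> 0" if "\<And>n::nat. s n \<in> Z" for s
    by (rule Z_seq_compact[OF that])
  show "f x \<in> Z" if "x \<in> Z" for x by (rule f_Z[OF that])
  show "finite {x. f x = y}" for y by (rule finite_fibre)
qed

lemma equicontinuous_eq: "iterates_equicontinuous_on v f U = dyn.equicontinuous_on U"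
  unfolding iterates_equicontinuous_on_def dyn.equicontinuous_on_def ..

lemma fatou_K: "fatou_set v K f = dyn.FK"
  unfolding dyn.FK_def set_eq_iff fatou_set_iff equicontinuous_eq Z_def[symmetric] by simp

lemma julia_C: "julia_set v UNIV f = dyn.J"
proof (rule set_eqI)
  fix x show "x \<in> julia_set v UNIV f \<longleftrightarrow> x \<in> dyn.J"
    unfolding dyn.J_def julia_set_def by (simp add: fatou_set_iff equicontinuous_eq proj_line_over_UNIV)
qed

lemma orbit_cl_eq: "orbit_closure v f x = dyn.orbit_cl x"
  unfolding set_eq_iff orbit_closure_iff dyn.orbit_cl_def by simp

text \<open>\<open>Z\<close> is closed, being sequentially compact. As a consequence the class of a
  \<open>K\<close>-rational critical point is entirely \<open>K\<close>-rational.\<close>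

lemma orbit_cl_subset_Z: assumes "x \<in> Z" shows "dyn.orbit_cl x \<subseteq> Z"
proof
  fix z assume "z \<in> dyn.orbit_cl x"
  then have "\<forall>k. \<exists>n. sd ((f ^^ n) x) z < 1 / real (Suc k)" unfolding dyn.orbit_cl_def by (simp del: of_nat_Suc)
  then obtain n where n: "\<And>k. sd ((f ^^ n k) x) z < 1 / real (Suc k)" by metis
  have nZ: "(f ^^ n k) x \<in> Z" for k using dyn.iter_Z[OF assms] .
  obtain y r where y: "y \<in> Z" "strict_mono r" "(\<lambda>k. sd y ((f ^^ n (r k)) x)) \<longlonglongrightarrow> 0"
    using Z_seq_compact[of "\<lambda>k. (f ^^ n k) x"] nZ by blast
  have le: "sd y z \<le> e" if e: "e > 0" for e
  proof -
    have "(\<lambda>k. 1 / real (Suc k)) \<longlonglongrightarrow> 0" by (rule LIMSEQ_Suc[OF lim_1_over_n])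
    from eventually_subseq[OF y(2) order_tendstoD(2)[OF this e]]
    have "\<forall>\<^sub>F k in sequentially. 1 / real (Suc (r k)) < e \<and> sd y ((f ^^ n (r k)) x) < e"
      using order_tendstoD(2)[OF y(3) e] by (rule eventually_conj)
    then obtain k where k: "1 / real (Suc (r k)) < e" "sd y ((f ^^ n (r k)) x) < e" using eventually_happens by fastforce
    have "sd ((f ^^ n (r k)) x) z < e" using n[of "r k"] k(1) by linarith
    then show ?thesis using dyn.d_less[OF k(2), of z] by simp
  qed
  have "sd y z \<le> 0" by (rule field_le_epsilon) (use le in simp)
  then have "sd y z = 0" using dyn.d_nonneg[of y z] by simp
  then show "z \<in> Z" using y(1) sd_zero by simp
qed

text \<open>The definition of recurrence asks for infinitely many times. Late returns are obtained
  by concatenation: after a close return \<open>k\<close>, continuity of \<open>f ^^ n\<close> makes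
  \<open>n + k\<close> a return whenever \<open>n\<close> is one.\<close>

lemma recurrent_of_orbit_cl: assumes x: "x \<in> dyn.orbit_cl (f x)" shows "recurrent v f x"
  unfolding recurrent_def
proof (intro allI impI)
  interpret M: Metric_space UNIV sd using metric_spherical[of UNIV] unfolding proj_line_over_UNIV .
  fix U assume U: "openin (proj_topology v UNIV) U \<and> x \<in> U"
  then obtain r where r: "r > 0" "M.mball x r \<subseteq> U"
    unfolding proj_topology_def proj_line_over_UNIV M.openin_mtopology by blast
  have near: "\<exists>n\<ge>1. sd ((f ^^ n) x) x < e" if "e > 0" for e
  proof -
    obtain n where "sd ((f ^^ n) (f x)) x < e" using x \<open>e > 0\<close> unfolding dyn.orbit_cl_def by blast
    then show ?thesis by (intro exI[of _ "Suc n"]) (simp add: dyn.iter_Suc del: funpow.simps)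
  qed
  have "\<exists>n\<ge>N. sd ((f ^^ n) x) x < r" for N
  proof (induction N)
    case 0 then show ?case using near[OF r(1)] by blast
  next
    case (Suc N)
    then obtain n where n: "n \<ge> N" "sd ((f ^^ n) x) x < r" by blast
    obtain s where s: "s > 0" "\<And>y. sd x y < s \<Longrightarrow> sd ((f ^^ n) x) ((f ^^ n) y) < r"
      using dyn.iter_cont[OF r(1)] by blast
    obtain k where k: "k \<ge> 1" "sd ((f ^^ k) x) x < s" using near[OF s(1)] by blast
    have "sd ((f ^^ n) x) ((f ^^ (n + k)) x) < r" using s(2)[of "(f ^^ k) x"] k(2) sd_sym[of x] by (simp add: dyn.iter_add)
    then have "sd ((f ^^ (n + k)) x) x < r" using n(2) dyn.d_less[of "(f ^^ (n + k)) x" "(f ^^ n) x"] sd_sym by metis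
    then show ?case using n k by (intro exI[of _ "n + k"]) simp
  qed
  then have "\<exists>n\<ge>N. (f ^^ n) x \<in> U" for N using r(2) sd_sym unfolding M.mball_def by fastforce
  then show "\<exists>\<^sub>F n in sequentially. (f ^^ n) x \<in> U" unfolding frequently_sequentially by blast
qed

lemma reg_of_unramified:
  assumes x: "local_degree P Q x = 1" "x \<in> Z" shows "\<exists>r>0. dyn.reg_at x r"
proof -
  obtain A r where A: "0 < A" "0 < r"
    and L: "\<And>b s. sd x b \<le> r \<Longrightarrow> 0 < s \<Longrightarrow> s \<le> r \<Longrightarrow> (\<forall>y z. sd b y \<le> s \<longrightarrow> sd b z \<le> s \<longrightarrow> sd (f y) (f z) = A * sd y z) \<and>
       (b \<in> Z \<longrightarrow> (\<forall>w\<in>Z. sd (f b) w \<le> A * s \<longrightarrow> (\<exists>z\<in>Z. sd b z \<le> s \<and> f z = w)))"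
    using local_behaviour[of x] x by auto
  have "dyn.reg_at x r" unfolding dyn.reg_at_def
  proof (rule exI[of _ A], intro conjI ballI allI impI)
    show "sd (f y) (f z) = A * sd y z" if "sd x y \<le> r" "sd x z \<le> r" for y z using L[of x r] A that by simp
    show "\<exists>z\<in>Z. sd b z \<le> s \<and> f z = w" if b: "b \<in> Z" "sd x b \<le> r" "s \<le> r" "w \<in> Z" "sd (f b) w \<le> A * s" for b s w
    proof (cases "0 < s")
      case True then show ?thesis using L[OF b(2) True b(3)] b by blast
    next
      \<comment> \<open>\<open>reg_at\<close> quantifies over all \<open>s\<close>, also those that
        are not positive; then the hypotheses force \<open>s = 0\<close> and
        \<open>w = f b\<close>.\<close>
      case False
      then have "A * s \<le> 0" using A by (simp add: mult_le_0_iff)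
      then have "sd (f b) w = 0" "A * s = 0" using b(5) dyn.d_nonneg[of "f b" w] by linarith+
      then have "f b = w" "s = 0" using A sd_zero by auto
      then show ?thesis using b by (intro bexI[of _ b]) auto
    qed
  qed (rule A)
  then show ?thesis using A by blast
qed

lemma crit_of_ramified:
  assumes c: "2 \<le> local_degree P Q c" "c \<in> Z"
  shows "\<exists>A>0. \<exists>r>0. dyn.crit_at c A (local_degree P Q c) (v (of_nat (local_degree P Q c))) r"
  using local_behaviour[of c] c unfolding dyn.crit_at_def by auto

end

section \<open>Translation of the hypotheses and conclusion\<close>

context padic_complex_field begin

text \<open>One inclusion holds because equicontinuity on a disc of the whole line restricts to its
  \<open>K\<close>-points. The other one is \<open>FK_Int_J_empty\<close>, for which a recurrent
  critical point in the Fatou set over \<open>K\<close> has to be shown to have a minimal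
  class.\<close>

lemma julia_restriction:
  assumes ext: "finite_extension (padic_numbers v) K"
    and PK: "\<forall>i. coeff P i \<in> K" and QK: "\<forall>i. coeff Q i \<in> K"
    and Q0: "Q \<noteq> 0" and cop: "coprime P Q" and deg: "rat_degree P Q \<ge> 2"
    and wild: "\<not> (\<exists>c \<in> julia_set v UNIV (rat_map P Q) \<inter> proj_line_over K.
            critical_point P Q c \<and> wild p P Q c \<and> recurrent v (rat_map P Q) c)"
    and minimal: "\<forall>C. minimal_class v P Q C \<longrightarrow>
           finite (C \<inter> (julia_set v UNIV (rat_map P Q) \<inter> proj_line_over K)) \<and>
           card (C \<inter> (julia_set v UNIV (rat_map P Q) \<inter> proj_line_over K)) \<le> 2"
  shows "julia_set v UNIV (rat_map P Q) \<inter> proj_line_over K = julia_set v K (rat_map P Q)"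
proof -
  have K: "is_subfield K" using ext unfolding finite_extension_def by blast
  have cK: "seq_compact_set K" using finite_extension_seq_compact[OF ext] .
  obtain \<pi> where \<pi>: "\<pi> \<in> K" "0 < v \<pi>" "v \<pi> < 1" "\<And>x. x \<in> K \<Longrightarrow> x \<noteq> 0 \<Longrightarrow> v x \<le> 1 \<Longrightarrow> \<exists>k. v x = v \<pi> ^ k"
    using discrete_values[OF K cK] by blast
  interpret compact_rational_map v P Q K \<pi>
    by unfold_locales (use K cK \<pi> PK QK Q0 cop deg in auto)
  define C where "C = {c \<in> dyn.J \<inter> Z. critical_point P Q c}"
  define \<mu> where "\<mu> c = v (of_nat (local_degree P Q c))" for c
  have finC: "finite C" using finite_critical by (rule finite_subset[rotated]) (auto simp: C_def)
  have deg2: "2 \<le> local_degree P Q c" if "c \<in> C" for c using that by (simp add: C_def critical_point_def)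
  have "\<forall>c\<in>C. \<exists>A. 0 < A \<and> (\<exists>r>0. dyn.crit_at c A (local_degree P Q c) (\<mu> c) r)"
    using crit_of_ramified deg2 unfolding C_def \<mu>_def by blast
  then obtain A where A: "\<And>c. c \<in> C \<Longrightarrow> 0 < A c" "\<And>c. c \<in> C \<Longrightarrow> \<exists>r>0. dyn.crit_at c (A c) (local_degree P Q c) (\<mu> c) r"
    by metis
  have reg: "\<exists>r>0. dyn.reg_at x r" if x: "x \<in> dyn.J" "x \<in> Z" "x \<notin> C" for x
  proof (rule reg_of_unramified[OF _ x(2)])
    have "\<not> 2 \<le> local_degree P Q x" using x by (simp add: C_def critical_point_def)
    then show "local_degree P Q x = 1" using local_behaviour[of x] by linarith
  qed
  obtain \<delta> \<eta> where \<delta>: "0 < \<eta>" "\<eta> \<le> \<delta>" "\<And>c. c \<in> C \<Longrightarrow> dyn.crit_at c (A c) (local_degree P Q c) (\<mu> c) \<delta>"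
    "\<And>c c'. c \<in> C \<Longrightarrow> c' \<in> C \<Longrightarrow> c \<noteq> c' \<Longrightarrow> \<delta> < sd c c'"
    "\<And>a. a \<in> dyn.J \<Longrightarrow> a \<in> Z \<Longrightarrow> (\<And>c. c \<in> C \<Longrightarrow> \<delta> < sd c a) \<Longrightarrow> dyn.reg_at a \<eta>"
    using dyn.uniform_constants[OF finC A(2) reg] by blast
  have \<mu>: "0 < \<mu> c" "\<mu> c \<le> 1" if "c \<in> C" for c
    using deg2[OF that] v_of_int_le[of "int (local_degree P Q c)"] v_pos[of "of_nat (local_degree P Q c)"]
    by (auto simp: \<mu>_def)
  interpret cd: critical_dynamics sd f Z "v \<pi>" C A \<mu> "local_degree P Q" \<delta> \<eta>
  proof unfold_locales
    show "c \<in> dyn.J" "c \<in> Z" if "c \<in> C" for c using that by (auto simp: C_def)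
    show "\<delta> < sd c c'" if "c \<in> C" "c' \<in> C" "c \<noteq> c'" for c c' using \<delta>(4) that .
    show "dyn.reg_at a \<eta>" if "a \<in> dyn.J" "a \<in> Z" "\<And>c. c \<in> C \<Longrightarrow> \<delta> < sd c a" for a using \<delta>(5) that .
  qed (use finC A(1) deg2 \<mu> \<delta>(1-3) in auto)
  have JC: "julia_set v UNIV (rat_map P Q) = dyn.J" and FK: "fatou_set v K (rat_map P Q) = dyn.FK"
    using julia_C fatou_K unfolding f_def by auto
  have orbit_cl_v: "orbit_closure v (rat_map P Q) x = dyn.orbit_cl x" for x using orbit_cl_eq unfolding f_def .
  have Zv: "proj_line_over K = Z" by (simp add: Z_def)
  have "dyn.FK \<inter> dyn.J = {}"
  proof (rule cd.FK_Int_J_empty)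
    show "c \<notin> dyn.orbit_cl (f c)" if c: "c \<in> C" "\<mu> c < 1" for c
    proof
      assume "c \<in> dyn.orbit_cl (f c)"
      then have "recurrent v (rat_map P Q) c" using recurrent_of_orbit_cl unfolding f_def by blast
      moreover have "p dvd local_degree P Q c"
      proof (rule ccontr)
        assume "\<not> p dvd local_degree P Q c"
        then have "v (of_int (int (local_degree P Q c))) = 1" by (intro v_of_int_unit) (simp add: int_dvd_int_iff)
        then show False using c(2) by (simp add: \<mu>_def)
      qed
      ultimately show False using wild c(1) unfolding JC Zv C_def wild_def by blast
    qed
    show "card {c' \<in> C. c' \<in> dyn.orbit_cl c} \<le> 2" if c: "c \<in> C" "c \<in> dyn.FK" "c \<in> dyn.orbit_cl (f c)" for c
    proof -
      let ?R = "critical_rel v P Q" and ?J = "julia_critical_points v P Q"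
      have J: "x \<in> ?J \<longleftrightarrow> x \<in> dyn.J \<and> critical_point P Q x" for x by (simp add: julia_critical_points_def JC)
      have R: "(x, y) \<in> ?R \<longleftrightarrow> x \<in> ?J \<and> y \<in> ?J \<and> x \<in> dyn.orbit_cl y \<and> y \<in> dyn.orbit_cl x" for x y
        by (simp add: critical_rel_def orbit_cl_v)
      have eqv: "equiv ?J ?R"
      proof (rule equivI)
        show "?R \<subseteq> ?J \<times> ?J" using R by auto
        show "refl_on ?J ?R" unfolding refl_on_def using R dyn.orbit_cl_self by auto
        show "sym ?R" unfolding sym_def using R by blast
        show "trans ?R" unfolding trans_def using R dyn.orbit_cl_trans by blast
      qed
      have cJ: "c \<in> ?J" and cZ: "c \<in> Z" using c by (auto simp: C_def J)
      \<comment> \<open>Recurrence and equicontinuity make the relation symmetric: whatever lies in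
        the orbit closure of \<open>c\<close> has \<open>c\<close> in its own orbit closure.\<close>
      have bck: "c \<in> dyn.orbit_cl z" if "z \<in> dyn.orbit_cl c" for z
        using dyn.recurrent_return[OF c(2,3) that] dyn.orbit_cl_trans[OF dyn.orbit_cl_forward[OF dyn.orbit_cl_self]] by blast
      \<comment> \<open>The class is exactly the set of critical points in the orbit closure of
        \<open>c\<close>. All of them lie in \<open>Z\<close>, so the bound on the
        \<open>K\<close>-rational representatives bounds the whole class.\<close>
      have X: "?R `` {c} = {c' \<in> C. c' \<in> dyn.orbit_cl c}"
        using R J cJ bck orbit_cl_subset_Z[OF cZ] by (auto simp: C_def)
      \<comment> \<open>A class below that of \<open>c\<close> has a member in the orbit closure of
        \<open>c\<close>; by \<open>bck\<close> this member is equivalent to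
        \<open>c\<close>.\<close>
      have "minimal_class v P Q (?R `` {c})"
        unfolding minimal_class_def critical_classes_def
      proof (intro conjI ballI impI)
        show "?R `` {c} \<in> ?J // ?R" using cJ by (rule quotientI)
        fix D assume D: "D \<in> ?J // ?R" and le: "class_le v P Q D (?R `` {c})"
        obtain e c1 where e: "e \<in> D" "c1 \<in> ?R `` {c}" "dyn.orbit_cl e \<subseteq> dyn.orbit_cl c1"
          using le unfolding class_le_def orbit_cl_v by blast
        have "e \<in> ?J" using D e(1) eqv by (metis in_quotient_imp_subset subsetD)
        moreover have "e \<in> dyn.orbit_cl c" using e dyn.orbit_cl_self dyn.orbit_cl_trans R by blast
        ultimately have "(c, e) \<in> ?R" using R cJ bck by blast
        then have "e \<in> ?R `` {c}" by blast
        then show "D = ?R `` {c}" using quotient_disj[OF eqv D quotientI[OF cJ]] e(1) by blast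
      qed
      then have "card (?R `` {c} \<inter> (dyn.J \<inter> Z)) \<le> 2" using minimal unfolding JC Zv by blast
      moreover have "?R `` {c} \<inter> (dyn.J \<inter> Z) = ?R `` {c}" unfolding X by (auto simp: C_def)
      ultimately show ?thesis unfolding X by simp
    qed
  qed
  moreover have "Z - dyn.FK \<subseteq> dyn.J"
  proof
    fix x assume x: "x \<in> Z - dyn.FK"
    show "x \<in> dyn.J"
    proof (rule ccontr)
      assume "x \<notin> dyn.J"
      then obtain r where r: "r > 0" "dyn.equicontinuous_on {y. sd x y < r}" unfolding dyn.J_def by blast
      then have "dyn.equicontinuous_on {y \<in> Z. sd x y < r}" by (elim dyn.equicontinuous_on_mono) auto
      then show False using x r(1) unfolding dyn.FK_def by blast
    qed
  qed
  ultimately show ?thesis unfolding JC julia_set_def[of v K] FK Zv by blast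
qed

end

theorem theorem1p9:
  fixes p :: nat
    and v :: "'a::field_char_0 \<Rightarrow> real"
    and K :: "'a set"
    and P Q :: "'a poly"
  assumes "prime p"
    and "padic_complex_field p v"
    and "finite_extension (padic_numbers v) K"
    and "\<forall>i. coeff P i \<in> K" and "\<forall>i. coeff Q i \<in> K"
    and "Q \<noteq> 0" and "coprime P Q"
    and "rat_degree P Q \<ge> 2"
    and "\<not> (\<exists>c \<in> julia_set v UNIV (rat_map P Q) \<inter> proj_line_over K.
            critical_point P Q c \<and> wild p P Q c \<and> recurrent v (rat_map P Q) c)"
    and "\<forall>C. minimal_class v P Q C \<longrightarrow>
           finite (C \<inter> (julia_set v UNIV (rat_map P Q) \<inter> proj_line_over K)) \<and>
           card (C \<inter> (julia_set v UNIV (rat_map P Q) \<inter> proj_line_over K)) \<le> 2"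
  shows "julia_set v UNIV (rat_map P Q) \<inter> proj_line_over K = julia_set v K (rat_map P Q)"
  using padic_complex_field.julia_restriction[OF assms(2-10)] .

end
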